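(* Let $a\in\mathbb{C}$ with $|a-\tfrac14|<\tfrac14$ and $\varphi(z)=az^2+(1-2a)z+a$. Then for every $\psi\in H^\infty$ continuous at $1$, $$\sigma(W_{\psi,\varphi})=\sigma(\psi(1)C_\varphi)=\{\psi(1)e^{-2at}: t\ge 0\}\cup\{0\},$$ where all operators act on the Hardy space $H^2$.
   Context: $H^2$ is the Hardy space of analytic $f(z)=\sum a_nz^n$ on the open unit disk $\mathbb{D}$ with $\sum|a_n|^2<\infty$; $H^\infty$ is the space of bounded analytic functions on $\mathbb{D}$. For an analytic self-map $\varphi$ of $\mathbb{D}$, $C_\varphi f=f\circ\varphi$ is the composition operator, and for $\psi\in H^\infty$, $W_{\psi,\varphi}=T_\psi C_\varphi$, i.e. $W_{\psi,\varphi}f=\psi\cdot(f\circ\varphi)$, is the weighted composition operator. "$\psi$ continuous at $1$" means $\psi$ extends continuously to $\mathbb{D}\cup\{1\}$, with value $\psi(1)$ at $1$. $\sigma(T)$ denotes the spectrum $\{\lambda\in\mathbb{C}: T-\lambda I \text{ not invertible}\}$. *)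

theory Defs
  imports "HOL-Analysis.Analysis"
begin

text \<open>Elements of H^2 are represented by functions complex => complex; only their
values on the open unit disk matter (two representatives are identified when they
agree on the disk).\<close>

definition taylor_coeff :: "(complex \<Rightarrow> complex) \<Rightarrow> nat \<Rightarrow> complex" where
  "taylor_coeff f n = (deriv ^^ n) f 0 / of_nat (fact n)"

definition hardy2 :: "(complex \<Rightarrow> complex) set" where
  "hardy2 = {f. f holomorphic_on ball 0 1 \<and> summable (\<lambda>n. (cmod (taylor_coeff f n))^2)}"

definition h2_norm :: "(complex \<Rightarrow> complex) \<Rightarrow> real" where
  "h2_norm f = sqrt (\<Sum>n. (cmod (taylor_coeff f n))^2)"

definition hinfty :: "(complex \<Rightarrow> complex) set" where
  "hinfty = {f. f holomorphic_on ball 0 1 \<and> bounded (f ` ball 0 1)}"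

definition eq_on_disk :: "(complex \<Rightarrow> complex) \<Rightarrow> (complex \<Rightarrow> complex) \<Rightarrow> bool" where
  "eq_on_disk f g \<longleftrightarrow> (\<forall>z\<in>ball 0 1. f z = g z)"

definition h2_invertible :: "((complex \<Rightarrow> complex) \<Rightarrow> (complex \<Rightarrow> complex)) \<Rightarrow> bool" where
  "h2_invertible T \<longleftrightarrow>
     (\<forall>f\<in>hardy2. T f \<in> hardy2) \<and>
     (\<exists>S. (\<forall>f\<in>hardy2. S f \<in> hardy2) \<and>
          (\<forall>f\<in>hardy2. \<forall>g\<in>hardy2. eq_on_disk f g \<longrightarrow> eq_on_disk (S f) (S g)) \<and>
          (\<forall>f\<in>hardy2. eq_on_disk (S (T f)) f) \<and>
          (\<forall>f\<in>hardy2. eq_on_disk (T (S f)) f) \<and>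
          (\<exists>C. \<forall>f\<in>hardy2. h2_norm (S f) \<le> C * h2_norm f))"

definition h2_spectrum :: "((complex \<Rightarrow> complex) \<Rightarrow> (complex \<Rightarrow> complex)) \<Rightarrow> complex set" where
  "h2_spectrum T = {c. \<not> h2_invertible (\<lambda>f z. T f z - c * f z)}"

definition wcomp :: "(complex \<Rightarrow> complex) \<Rightarrow> (complex \<Rightarrow> complex) \<Rightarrow> (complex \<Rightarrow> complex) \<Rightarrow> (complex \<Rightarrow> complex)" where
  "wcomp \<psi> \<phi> f = (\<lambda>z. \<psi> z * f (\<phi> z))"

definition comp_op :: "(complex \<Rightarrow> complex) \<Rightarrow> (complex \<Rightarrow> complex) \<Rightarrow> (complex \<Rightarrow> complex)" where
  "comp_op \<phi> f = (\<lambda>z. f (\<phi> z))"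

end

theory Submission
  imports Defs "HOL-Complex_Analysis.Complex_Analysis" "HOL-Real_Asymp.Real_Asymp"
begin

text \<open>In the coordinate \<open>u = 1 / (1 - z)\<close> the disk is the half plane \<open>Re u > 1/2\<close>, and \<open>\<phi>\<close> is
  \<open>u \<mapsto> u + a + O(1/u)\<close>, whose iterates push the whole disk into every horodisk \<open>Re u > N\<close>.
  On a small horodisk the operator \<open>W\<close> is therefore a small perturbation of \<open>\<psi>(1)\<close> times a
  weighted translation by \<open>a\<close>. Under the Laplace transform this translation becomes
  multiplication by \<open>e\<^sup>-\<^sup>a\<^sup>s\<close> on the half line, which bounds \<open>W - \<mu>\<close> below there in terms of
  the distance from \<open>\<mu>\<close> to the spiral. As a high power of \<open>W\<close> only sees values on the horodisk,
  a lower bound for \<open>W - \<mu>\<close> on the disk follows. It is uniform along the path \<open>\<mu> e\<^sup>a\<^sup>t\<close>, which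
  goes to infinity without meeting the spiral, so the method of continuity yields invertibility.
  Conversely \<open>e\<^sup>-\<^sup>s\<^sup>u / (1 - z + \<epsilon>)\<close>, as \<open>\<epsilon> \<rightarrow> 0\<close>, are approximate eigenvectors for
  \<open>\<psi>(1) e\<^sup>-\<^sup>a\<^sup>s\<close>, and \<open>0\<close> is a limit of these values.\<close>

section \<open>Circle means and the Hardy space norm\<close>

text \<open>The hypothesis |a - 1/4| < 1/4 is the same as 2|a|^2 < Re a. It keeps the real part of
  the increment a / (1 - a/u) above a positive constant on the whole half plane, so one fixed power
  of W reaches a given horodisk. The obstacle is that "small perturbation" must hold in operator
  norm although both maps touch the boundary at 1, where Euclidean closeness says nothing. The right
  measure is the pseudohyperbolic distance. Rescaling a horodisk to the disk replaces a by a \<rho>;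
  in the coordinate u the two maps then differ by O(\<rho>^2), while their joint distance to the
  boundary line is at least of order \<rho>. So the pseudohyperbolic distance is O(\<rho>), and
  comparing Cauchy kernels against the Poisson kernel turns this into an O(\<rho>) bound for the
  difference of the composition operators. The translation carries the weight u / (u + a) because f
  is u times a Laplace transform; only with this weight is it exactly a multiplication, and after
  rescaling the weight is within O(\<rho>) of 1.\<close>

lemma sum_le_of_sums:
  fixes f :: "nat \<Rightarrow> real"
  assumes "f sums s" "\<And>n. 0 \<le> f n"
  shows "(\<Sum>n<N. f n) \<le> s"
  using assms by (metis finite_lessThan sum_le_suminf sums_iff)

lemma taylor_coeff_sums:
  assumes "f holomorphic_on ball 0 1" "cmod z < 1"
  shows "(\<lambda>n. taylor_coeff f n * z ^ n) sums f z"
  using holomorphic_power_series[OF assms(1), of z] assms(2) by (simp add: taylor_coeff_def)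

text \<open>A power series converging throughout the disk has radius at least 1, so the derivatives
  at 0 can be read off the formal series. Every coefficient computation below goes through
  this.\<close>

lemma taylor_coeff_unique:
  assumes "\<And>z. cmod z < 1 \<Longrightarrow> (\<lambda>n. b n * z ^ n) sums f z"
  shows "f holomorphic_on ball 0 1" and "taylor_coeff f n = b n"
proof -
  show "f holomorphic_on ball 0 1"
    by (rule power_series_holomorphic[where a = b]) (use assms in auto)
  have "conv_radius b \<ge> 1"
    by (rule conv_radius_geI_ex') (use assms[THEN sums_summable] in \<open>auto simp: ereal_less\<close>)
  then have r: "fps_conv_radius (Abs_fps b) > 0"
    by (simp add: fps_conv_radius_def order_less_le_trans[of 0 1])
  have "\<forall>\<^sub>F z in nhds 0. eval_fps (Abs_fps b) z = f z"
    using eventually_nhds_in_open[of "ball 0 1" "0::complex"]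
    by (auto elim!: eventually_mono simp: eval_fps_def dest!: assms intro: sums_unique[symmetric])
  then have "(deriv ^^ n) (eval_fps (Abs_fps b)) 0 = (deriv ^^ n) f 0"
    by (intro higher_deriv_cong_ev refl)
  with fps_nth_conv_deriv[OF r, of n] show "taylor_coeff f n = b n"
    by (simp add: taylor_coeff_def)
qed

lemma taylor_coeff_eq_on_disk:
  assumes "eq_on_disk f g"
  shows "taylor_coeff f n = taylor_coeff g n"
proof -
  have "\<forall>\<^sub>F z in nhds 0. f z = g z"
    using eventually_nhds_in_open[of "ball 0 1" "0::complex"] assms
    by (auto elim!: eventually_mono simp: eq_on_disk_def)
  then show ?thesis
    unfolding taylor_coeff_def by (simp add: higher_deriv_cong_ev)
qed

lemma h2_norm_eq_on_disk: "eq_on_disk f g \<Longrightarrow> h2_norm f = h2_norm g"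
  by (simp add: h2_norm_def taylor_coeff_eq_on_disk)

text \<open>The angle is scaled to \<open>{0..1}\<close> so that the measure has mass 1. Unlike the
  coefficient sum, this mean is monotone under pointwise domination, which is how most norm bounds
  below are obtained.\<close>

definition h2_mean :: "real \<Rightarrow> (complex \<Rightarrow> complex) \<Rightarrow> real" where
  "h2_mean r f = integral {0..1} (\<lambda>x. (cmod (f (rcis r (2 * pi * x))))\<^sup>2)"

lemma continuous_on_rcis [continuous_intros]:
  "continuous_on A g \<Longrightarrow> continuous_on A (\<lambda>x. rcis r (g x))"
  unfolding rcis_def by (intro continuous_intros)

lemma continuous_on_circle:
  assumes "f holomorphic_on ball 0 1" "\<bar>r\<bar> < 1"
  shows "continuous_on A (\<lambda>x. f (rcis r (2 * pi * x)))"
  by (rule continuous_on_compose2[OF holomorphic_on_imp_continuous_on[OF assms(1)]])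
     (use assms(2) in \<open>auto intro!: continuous_intros\<close>)

lemma has_integral_cis:
  "((\<lambda>x. cis (2 * pi * of_int k * x)) has_integral (if k = 0 then 1 else 0)) {0..1}"
proof (cases "k = 0")
  case True
  then show ?thesis using has_integral_const_real[of "1::complex" 0 1] by simp
next
  case False
  define c where "c = 2 * pi * real_of_int k"
  have c: "c \<noteq> 0" using False by (simp add: c_def)
  have "((\<lambda>x. cis (c * x)) has_integral cis (c * 1) / (\<i> * c) - cis (c * 0) / (\<i> * c)) {0..1}"
  proof (rule fundamental_theorem_of_calculus)
    fix x :: real
    have "((\<lambda>z. exp (\<i> * c * z) / (\<i> * c)) has_field_derivative exp (\<i> * c * of_real x)) (at (of_real x))"
      using c by (auto intro!: derivative_eq_intros)
    then have "((\<lambda>x. exp (\<i> * c * of_real x) / (\<i> * c)) has_vector_derivative exp (\<i> * c * of_real x)) (at x within {0..1})"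
      by (rule has_vector_derivative_real_field)
    then show "((\<lambda>x. cis (c * x) / (\<i> * c)) has_vector_derivative cis (c * x)) (at x within {0..1})"
      by (simp add: cis_conv_exp mult_ac)
  qed auto
  moreover have "cis (c * 1) = 1"
    by (simp add: c_def cis_multiple_2pi)
  ultimately show ?thesis
    using False by (simp add: c_def mult_ac)
qed

lemma integral_trig_poly_norm_sq:
  "((\<lambda>x. (cmod (\<Sum>n<N. b n * rcis r (2 * pi * x) ^ n))\<^sup>2) has_integral
      (\<Sum>n<N. (cmod (b n))\<^sup>2 * r ^ (2 * n))) {0..1}"
proof -
  have t: "b m * rcis r (2 * pi * x) ^ m * cnj (b n * rcis r (2 * pi * x) ^ n) =
     b m * cnj (b n) * r ^ (m + n) * cis (2 * pi * of_int (int m - int n) * x)" for m n x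
  proof -
    have "cis (2 * pi * of_int (int m - int n) * x) = cis (m * (2 * pi * x)) * cis (- (n * (2 * pi * x)))"
      by (simp add: cis_mult algebra_simps)
    then show ?thesis
      by (simp add: rcis_def power_mult_distrib Complex.DeMoivre cis_cnj power_add)
  qed
  have "((\<lambda>x. \<Sum>m<N. \<Sum>n<N. b m * cnj (b n) * r ^ (m + n) * cis (2 * pi * of_int (int m - int n) * x))
      has_integral (\<Sum>m<N. \<Sum>n<N. b m * cnj (b n) * r ^ (m + n) * (if int m - int n = 0 then 1 else 0))) {0..1}"
    by (intro has_integral_sum has_integral_mult_right has_integral_cis finite_lessThan)
  also have "(\<lambda>x. \<Sum>m<N. \<Sum>n<N. b m * cnj (b n) * r ^ (m + n) * cis (2 * pi * of_int (int m - int n) * x))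
     = (\<lambda>x. complex_of_real ((cmod (\<Sum>n<N. b n * rcis r (2 * pi * x) ^ n))\<^sup>2))"
    unfolding complex_norm_square cnj_sum sum_product t ..
  also have "(\<Sum>m<N. \<Sum>n<N. b m * cnj (b n) * r ^ (m + n) * (if int m - int n = 0 then 1 else 0))
     = (\<Sum>n<N. b n * cnj (b n) * r ^ (n + n))"
    by (intro sum.cong refl) (simp add: sum.delta' if_distrib cong: if_cong)
  also have "\<dots> = complex_of_real (\<Sum>n<N. (cmod (b n))\<^sup>2 * r ^ (2 * n))"
    by (simp add: complex_norm_square[symmetric] mult_2 del: of_real_power)
  finally have "((\<lambda>x. Re (complex_of_real ((cmod (\<Sum>n<N. b n * rcis r (2 * pi * x) ^ n))\<^sup>2))) has_integral
      Re (complex_of_real (\<Sum>n<N. (cmod (b n))\<^sup>2 * r ^ (2 * n)))) {0..1}"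
    by (rule has_integral_Re)
  then show ?thesis by simp
qed

lemma parseval:
  assumes f: "f holomorphic_on ball 0 1" and r: "0 \<le> r" "r < 1"
  shows "(\<lambda>n. (cmod (taylor_coeff f n))\<^sup>2 * r ^ (2 * n)) sums h2_mean r f"
proof -
  let ?b = "taylor_coeff f"
  let ?p = "\<lambda>N x. \<Sum>n<N. ?b n * rcis r (2 * pi * x) ^ n"
  \<comment> \<open>The room between r and s makes the Taylor series absolutely summable on the
    circle of radius r; its sum M is the dominating constant.\<close>
  obtain s where s: "r < s" "s < 1" using dense[OF r(2)] by blast
  have "summable (\<lambda>n. ?b n * of_real s ^ n)"
    using taylor_coeff_sums[OF f, of "of_real s"] s r by (auto dest: sums_summable)
  then have sm: "summable (\<lambda>n. cmod (?b n * of_real r ^ n))"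
    by (rule powser_insidea) (use s r in auto)
  define M where "M = (\<Sum>n. cmod (?b n * of_real r ^ n))"
  have bound: "cmod (?p N x) \<le> M" for N x
  proof -
    have "cmod (?p N x) \<le> (\<Sum>n<N. cmod (?b n * of_real r ^ n))"
      by (rule order.trans[OF norm_sum]) (use r in \<open>simp add: norm_mult norm_power\<close>)
    also have "\<dots> \<le> M"
      unfolding M_def by (rule sum_le_suminf[OF sm]) auto
    finally show ?thesis .
  qed
  have "(\<lambda>N. integral {0..1} (\<lambda>x. (cmod (?p N x))\<^sup>2)) \<longlonglongrightarrow> integral {0..1} (\<lambda>x. (cmod (f (rcis r (2 * pi * x))))\<^sup>2)"
  proof (rule dominated_convergence(2)[where h = "\<lambda>_. M\<^sup>2"])
    show "(\<lambda>x. (cmod (?p N x))\<^sup>2) integrable_on {0..1}" for N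
      using integral_trig_poly_norm_sq by (rule has_integral_integrable)
    show "norm ((cmod (?p N x))\<^sup>2) \<le> M\<^sup>2" for N x
      using bound by (simp add: power_mono)
    show "(\<lambda>N. (cmod (?p N x))\<^sup>2) \<longlonglongrightarrow> (cmod (f (rcis r (2 * pi * x))))\<^sup>2" for x
    proof -
      have "(\<lambda>n. ?b n * rcis r (2 * pi * x) ^ n) sums f (rcis r (2 * pi * x))"
        by (rule taylor_coeff_sums[OF f]) (use r in auto)
      then show "(\<lambda>N. (cmod (?p N x))\<^sup>2) \<longlonglongrightarrow> (cmod (f (rcis r (2 * pi * x))))\<^sup>2"
        unfolding sums_def by (intro tendsto_intros)
    qed
  qed (auto intro: integrable_const_ivl)
  then show ?thesis
    unfolding sums_def h2_mean_def integral_trig_poly_norm_sq[THEN integral_unique] .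
qed

section \<open>Membership and norm bounds from circle means\<close>

lemma hardy2_holomorphic: "f \<in> hardy2 \<Longrightarrow> f holomorphic_on ball 0 1"
  by (simp add: hardy2_def)

lemma hardy2_sums:
  "f \<in> hardy2 \<Longrightarrow> (\<lambda>n. (cmod (taylor_coeff f n))\<^sup>2) sums (h2_norm f)\<^sup>2"
  by (simp add: hardy2_def h2_norm_def suminf_nonneg summable_sums)

lemma h2_norm_nonneg: "f \<in> hardy2 \<Longrightarrow> h2_norm f \<ge> 0"
  by (auto simp: hardy2_def h2_norm_def intro!: suminf_nonneg)

lemma h2_mean_le:
  assumes "f \<in> hardy2" "0 \<le> r" "r < 1"
  shows "h2_mean r f \<le> (h2_norm f)\<^sup>2"
proof (rule sums_le[OF _ parseval hardy2_sums])
  fix n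
  have "r ^ (2 * n) \<le> 1" using assms by (simp add: power_le_one)
  then show "(cmod (taylor_coeff f n))\<^sup>2 * r ^ (2 * n) \<le> (cmod (taylor_coeff f n))\<^sup>2"
    by (simp add: mult_left_le)
qed (use assms in \<open>auto simp: hardy2_holomorphic\<close>)

text \<open>Fatou's lemma for the Parseval series: a finite partial sum is continuous in r, so its
  bound survives r -> 1, and only afterwards does the number of terms grow.\<close>

lemma hardy2I_mean:
  assumes f: "f holomorphic_on ball 0 1" and "0 \<le> C"
    and M: "\<And>r. 0 \<le> r \<Longrightarrow> r < 1 \<Longrightarrow> h2_mean r f \<le> C\<^sup>2"
  shows "f \<in> hardy2" and "h2_norm f \<le> C"
proof -
  let ?b = "\<lambda>n. (cmod (taylor_coeff f n))\<^sup>2"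
  have part: "(\<Sum>n<N. ?b n) \<le> C\<^sup>2" for N
  proof (rule tendsto_upperbound)
    show "((\<lambda>r. \<Sum>n<N. ?b n * r ^ (2 * n)) \<longlongrightarrow> (\<Sum>n<N. ?b n)) (at_left 1)"
      by (rule tendsto_eq_intros | simp)+
    show "\<forall>\<^sub>F r in at_left 1. (\<Sum>n<N. ?b n * r ^ (2 * n)) \<le> C\<^sup>2"
      using eventually_at_left_real[of 0 1]
    proof (rule eventually_mono)
      fix r :: real assume "r \<in> {0<..<1}"
      then have r: "0 \<le> r" "r < 1" by auto
      have "(\<Sum>n<N. ?b n * r ^ (2 * n)) \<le> h2_mean r f"
        by (rule sum_le_of_sums[OF parseval[OF f r]]) (use r in auto)
      then show "(\<Sum>n<N. ?b n * r ^ (2 * n)) \<le> C\<^sup>2" using M[OF r] by linarith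
    qed auto
  qed auto
  then have sm: "summable ?b"
    by (intro summableI_nonneg_bounded[where x = "C\<^sup>2"]) auto
  then show "f \<in> hardy2" using f by (simp add: hardy2_def)
  have "suminf ?b \<le> C\<^sup>2" using sm part by (rule suminf_le_const)
  then show "h2_norm f \<le> C"
    unfolding h2_norm_def using \<open>0 \<le> C\<close> by (simp add: real_sqrt_le_iff' real_le_lsqrt)
qed

text \<open>The additive constant B serves the approximate eigenvectors: near 1 their image is small
  relative to g, elsewhere only a constant bound is available.\<close>

lemma hardy2_dominated:
  assumes f: "f holomorphic_on ball 0 1" and g: "g \<in> hardy2" and "0 \<le> A" "0 \<le> B"
    and le: "\<And>z. cmod z < 1 \<Longrightarrow> (cmod (f z))\<^sup>2 \<le> A * (cmod (g z))\<^sup>2 + B"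
  shows "f \<in> hardy2" and "(h2_norm f)\<^sup>2 \<le> A * (h2_norm g)\<^sup>2 + B"
proof -
  define C where "C = sqrt (A * (h2_norm g)\<^sup>2 + B)"
  have C: "0 \<le> C" "C\<^sup>2 = A * (h2_norm g)\<^sup>2 + B" using assms(3,4) by (auto simp: C_def)
  have M: "h2_mean r f \<le> C\<^sup>2" if r: "0 \<le> r" "r < 1" for r
  proof -
    have cf: "continuous_on {0..1} (\<lambda>x. f (rcis r (2 * pi * x)))"
      "continuous_on {0..1} (\<lambda>x. g (rcis r (2 * pi * x)))"
      using f g r by (auto intro!: continuous_on_circle simp: hardy2_holomorphic)
    have "h2_mean r f \<le> integral {0..1} (\<lambda>x. A * (cmod (g (rcis r (2 * pi * x))))\<^sup>2 + B)"
      unfolding h2_mean_def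
      by (intro integral_le integrable_continuous_real continuous_intros cf le) (use r in auto)
    also have "\<dots> = A * h2_mean r g + B"
      unfolding h2_mean_def
      by (subst integral_add) (auto intro!: integrable_continuous_real continuous_intros cf)
    also have "\<dots> \<le> C\<^sup>2"
      unfolding C using h2_mean_le[OF g r] \<open>0 \<le> A\<close> by (simp add: mult_left_mono)
    finally show ?thesis .
  qed
  show "f \<in> hardy2" using hardy2I_mean(1)[OF f C(1) M] .
  have "h2_norm f \<le> C" using hardy2I_mean(2)[OF f C(1) M] .
  with \<open>f \<in> hardy2\<close> show "(h2_norm f)\<^sup>2 \<le> A * (h2_norm g)\<^sup>2 + B"
    unfolding C(2)[symmetric] by (intro power_mono h2_norm_nonneg)
qed

lemma hardy2_dominated_mult:
  assumes f: "f holomorphic_on ball 0 1" and g: "g \<in> hardy2" and "0 \<le> K"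
    and le: "\<And>z. cmod z < 1 \<Longrightarrow> cmod (f z) \<le> K * cmod (g z)"
  shows "f \<in> hardy2" and "h2_norm f \<le> K * h2_norm g"
proof -
  have le': "(cmod (f z))\<^sup>2 \<le> K\<^sup>2 * (cmod (g z))\<^sup>2 + 0" if "cmod z < 1" for z
    using power_mono[OF le[OF that], of 2] by (simp add: power_mult_distrib)
  show "f \<in> hardy2" by (rule hardy2_dominated(1)[OF f g _ _ le']) auto
  have "(h2_norm f)\<^sup>2 \<le> K\<^sup>2 * (h2_norm g)\<^sup>2 + 0" by (rule hardy2_dominated(2)[OF f g _ _ le']) auto
  then have "(h2_norm f)\<^sup>2 \<le> (K * h2_norm g)\<^sup>2" by (simp add: power_mult_distrib)
  then show "h2_norm f \<le> K * h2_norm g"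
    by (rule power2_le_imp_le) (use g \<open>0 \<le> K\<close> in \<open>auto simp: h2_norm_nonneg\<close>)
qed

lemma
  shows hardy2_const: "(\<lambda>_. c) \<in> hardy2"
    and h2_norm_const_le: "h2_norm (\<lambda>_. c) \<le> cmod c"
  using hardy2I_mean[of "\<lambda>_. c" "cmod c"] by (auto simp: h2_mean_def)

lemma hardy2_bounded:
  assumes f: "f holomorphic_on ball 0 1" and "0 \<le> K"
    and le: "\<And>z. cmod z < 1 \<Longrightarrow> cmod (f z) \<le> K"
  shows "f \<in> hardy2" and "h2_norm f \<le> K"
proof -
  have *: "h2_norm (\<lambda>_. of_real K) \<le> K" using h2_norm_const_le[of "of_real K"] \<open>0 \<le> K\<close> by simp
  have le': "cmod (f z) \<le> 1 * cmod (of_real K)" if "cmod z < 1" for z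
    using le[OF that] \<open>0 \<le> K\<close> by simp
  show "f \<in> hardy2" "h2_norm f \<le> K"
    using hardy2_dominated_mult[OF f hardy2_const[of "of_real K"] _ le'] * by simp_all
qed

lemma hardy2_mult:
  assumes "h holomorphic_on ball 0 1" "\<And>z. cmod z < 1 \<Longrightarrow> cmod (h z) \<le> K" "f \<in> hardy2"
  shows "(\<lambda>z. h z * f z) \<in> hardy2" and "h2_norm (\<lambda>z. h z * f z) \<le> K * h2_norm f"
proof -
  have "0 \<le> K" using assms(2)[of 0] norm_ge_zero[of "h 0"] by (simp del: norm_ge_zero)
  moreover have "(\<lambda>z. h z * f z) holomorphic_on ball 0 1"
    using assms by (intro holomorphic_intros) (auto simp: hardy2_holomorphic)
  ultimately show "(\<lambda>z. h z * f z) \<in> hardy2" "h2_norm (\<lambda>z. h z * f z) \<le> K * h2_norm f"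
    using hardy2_dominated_mult[of "\<lambda>z. h z * f z" f K] assms(2,3)
    by (auto simp: norm_mult mult_right_mono)
qed

lemma hardy2_cmult:
  assumes "f \<in> hardy2"
  shows "(\<lambda>z. c * f z) \<in> hardy2" and "h2_norm (\<lambda>z. c * f z) \<le> cmod c * h2_norm f"
  using hardy2_mult[of "\<lambda>_. c" "cmod c" f] assms by auto

lemma h2_norm_cmult:
  assumes "f \<in> hardy2"
  shows "h2_norm (\<lambda>z. c * f z) = cmod c * h2_norm f"
proof (cases "c = 0")
  case True
  then show ?thesis using hardy2_cmult[OF assms, of c] h2_norm_nonneg[of "\<lambda>z. c * f z"] by simp
next
  case False
  have "h2_norm f = h2_norm (\<lambda>z. inverse c * (c * f z))" using False by (simp add: mult.assoc[symmetric])
  also have "\<dots> \<le> cmod (inverse c) * h2_norm (\<lambda>z. c * f z)"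
    by (intro hardy2_cmult assms)
  finally show ?thesis
    using hardy2_cmult(2)[OF assms, of c] False by (auto simp: norm_inverse norm_divide field_simps)
qed

lemma taylor_coeff_add:
  assumes "f holomorphic_on ball 0 1" "g holomorphic_on ball 0 1"
  shows "taylor_coeff (\<lambda>z. f z + g z) n = taylor_coeff f n + taylor_coeff g n"
  by (rule taylor_coeff_unique(2))
     (use assms in \<open>auto simp: algebra_simps intro!: sums_add taylor_coeff_sums\<close>)

text \<open>Minkowski's inequality for finite sections of the coefficient sequences, followed by the
  limit of the sections.\<close>

lemma
  assumes f: "f \<in> hardy2" and g: "g \<in> hardy2"
  shows hardy2_add: "(\<lambda>z. f z + g z) \<in> hardy2"
    and h2_norm_triangle: "h2_norm (\<lambda>z. f z + g z) \<le> h2_norm f + h2_norm g"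
proof -
  let ?h = "\<lambda>z. f z + g z"
  define C where "C = h2_norm f + h2_norm g"
  have hol: "f holomorphic_on ball 0 1" "g holomorphic_on ball 0 1"
    using f g by (auto simp: hardy2_holomorphic)
  then have hh: "?h holomorphic_on ball 0 1" by (intro holomorphic_intros)
  have C0: "0 \<le> C" using f g by (simp add: C_def h2_norm_nonneg)
  have l2: "L2_set (\<lambda>n. cmod (taylor_coeff k n)) {..<N} \<le> h2_norm k" if "k \<in> hardy2" for k N
    unfolding L2_set_def
    by (intro real_le_lsqrt sum_le_of_sums hardy2_sums h2_norm_nonneg that) auto
  have "(\<Sum>n<N. (cmod (taylor_coeff ?h n))\<^sup>2) \<le> C\<^sup>2" for N
  proof -
    have "L2_set (\<lambda>n. cmod (taylor_coeff ?h n)) {..<N} \<le>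
        L2_set (\<lambda>n. cmod (taylor_coeff f n) + cmod (taylor_coeff g n)) {..<N}"
      by (intro L2_set_mono) (auto simp: taylor_coeff_add hol norm_triangle_ineq)
    also have "\<dots> \<le> C"
      using L2_set_triangle_ineq[of "\<lambda>n. cmod (taylor_coeff f n)" "\<lambda>n. cmod (taylor_coeff g n)" "{..<N}"]
        l2[OF f, of N] l2[OF g, of N] unfolding C_def by linarith
    finally have "(L2_set (\<lambda>n. cmod (taylor_coeff ?h n)) {..<N})\<^sup>2 \<le> C\<^sup>2"
      by (intro power_mono) auto
    then show ?thesis by (simp add: L2_set_def sum_nonneg)
  qed
  note part = this
  then have sm: "summable (\<lambda>n. (cmod (taylor_coeff ?h n))\<^sup>2)"
    by (intro summableI_nonneg_bounded[where x = "C\<^sup>2"]) auto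
  then show "?h \<in> hardy2" using hh by (simp add: hardy2_def)
  have "suminf (\<lambda>n. (cmod (taylor_coeff ?h n))\<^sup>2) \<le> C\<^sup>2" using sm part by (rule suminf_le_const)
  then show "h2_norm ?h \<le> h2_norm f + h2_norm g"
    unfolding h2_norm_def[of ?h] C_def[symmetric] using C0 by (simp add: real_le_lsqrt)
qed

lemma
  assumes f: "f \<in> hardy2" and g: "g \<in> hardy2"
  shows hardy2_diff: "(\<lambda>z. f z - g z) \<in> hardy2"
    and h2_norm_triangle_diff: "h2_norm (\<lambda>z. f z - g z) \<le> h2_norm f + h2_norm g"
    and h2_norm_le_diff: "h2_norm f \<le> h2_norm (\<lambda>z. f z - g z) + h2_norm g"
proof -
  have m: "(\<lambda>z. (-1) * g z) \<in> hardy2" "h2_norm (\<lambda>z. (-1) * g z) = h2_norm g"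
    using hardy2_cmult(1)[OF g, of "-1"] h2_norm_cmult[OF g, of "-1"] by simp_all
  show d: "(\<lambda>z. f z - g z) \<in> hardy2"
    using hardy2_add[OF f m(1)] by simp
  show "h2_norm (\<lambda>z. f z - g z) \<le> h2_norm f + h2_norm g"
    using h2_norm_triangle[OF f m(1)] m(2) by simp
  show "h2_norm f \<le> h2_norm (\<lambda>z. f z - g z) + h2_norm g"
    using h2_norm_triangle[OF d g] by simp
qed

lemma h2_norm_minus_commute: "h2_norm (\<lambda>z. f z - g z) = h2_norm (\<lambda>z. g z - f z)" if "f \<in> hardy2" "g \<in> hardy2"
  using h2_norm_cmult[OF hardy2_diff[OF that], of "-1"] by simp

text \<open>Cauchy-Schwarz is applied only to the coefficients from index m on. For m = 0 this
  bounds point evaluations; for large m the tail is small and the head is killed by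
  \<open>sqrt (1 - (cmod z)\<^sup>2)\<close>, so the left-hand side tends to 0 at the
  boundary.\<close>

lemma hardy2_point_bound:
  assumes f: "f \<in> hardy2" and z: "cmod z < 1"
  shows "cmod (f z) * sqrt (1 - (cmod z)\<^sup>2) \<le>
    (\<Sum>n<m. cmod (taylor_coeff f n)) * sqrt (1 - (cmod z)\<^sup>2) + sqrt (\<Sum>n. (cmod (taylor_coeff f (n + m)))\<^sup>2)"
proof -
  let ?a = "taylor_coeff f"
  have hol: "f holomorphic_on ball 0 1" using f by (rule hardy2_holomorphic)
  have S: "summable (\<lambda>n. (cmod (?a (n + m)))\<^sup>2)"
    using f summable_iff_shift[of "\<lambda>n. (cmod (?a n))\<^sup>2" m] by (simp add: hardy2_def)
  define T where "T = (\<Sum>n. (cmod (?a (n + m)))\<^sup>2)"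
  define x where "x = cmod z"
  have x: "0 \<le> x" "x < 1" using z by (auto simp: x_def)
  have x2: "x\<^sup>2 < 1" using x by (simp add: power_less_one_iff abs_square_less_1)
  have "cmod (\<Sum>n<m + N. ?a n * z ^ n) \<le> (\<Sum>n<m. cmod (?a n)) + sqrt T * sqrt (1 / (1 - x\<^sup>2))" for N
  proof -
    have "(\<Sum>n<m + N. ?a n * z ^ n) = (\<Sum>n<m. ?a n * z ^ n) + (\<Sum>n<N. ?a (n + m) * z ^ (n + m))"
      by (simp add: sum.nat_group[symmetric] lessThan_atLeast0 sum.atLeastLessThan_concat[of 0 m "m + N", symmetric]
          sum.shift_bounds_nat_ivl[of _ 0 m N, simplified add.commute[of N m], simplified])
    then have "cmod (\<Sum>n<m + N. ?a n * z ^ n) \<le> cmod (\<Sum>n<m. ?a n * z ^ n) + cmod (\<Sum>n<N. ?a (n + m) * z ^ (n + m))"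
      by (simp add: norm_triangle_ineq)
    also have "cmod (\<Sum>n<m. ?a n * z ^ n) \<le> (\<Sum>n<m. cmod (?a n))"
      by (rule order.trans[OF norm_sum sum_mono])
         (use x in \<open>simp add: norm_mult norm_power x_def[symmetric] mult_left_le power_le_one\<close>)
    also have "cmod (\<Sum>n<N. ?a (n + m) * z ^ (n + m)) \<le> (\<Sum>n<N. \<bar>cmod (?a (n + m))\<bar> * \<bar>x ^ n\<bar>)"
    proof (rule order.trans[OF norm_sum sum_mono])
      fix n
      have "x ^ (n + m) \<le> x ^ n" using x by (simp add: power_decreasing)
      then show "cmod (?a (n + m) * z ^ (n + m)) \<le> \<bar>cmod (?a (n + m))\<bar> * \<bar>x ^ n\<bar>"
        using x by (simp add: norm_mult norm_power x_def[symmetric] mult_left_mono)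
    qed
    also have "\<dots> \<le> L2_set (\<lambda>n. cmod (?a (n + m))) {..<N} * L2_set (\<lambda>n. x ^ n) {..<N}"
      by (rule L2_set_mult_ineq)
    also have "\<dots> \<le> sqrt T * sqrt (1 / (1 - x\<^sup>2))"
    proof (rule mult_mono)
      show "L2_set (\<lambda>n. cmod (?a (n + m))) {..<N} \<le> sqrt T"
        unfolding L2_set_def T_def by (auto intro!: sum_le_suminf S)
      have "(\<lambda>n. (x\<^sup>2) ^ n) sums (1 / (1 - x\<^sup>2))" using x2 by (intro geometric_sums) auto
      then have "(\<Sum>n<N. (x\<^sup>2) ^ n) \<le> 1 / (1 - x\<^sup>2)" unfolding sums_iff
        by (metis finite_lessThan sum_le_suminf zero_le_power2 zero_le_power)
      then show "L2_set (\<lambda>n. x ^ n) {..<N} \<le> sqrt (1 / (1 - x\<^sup>2))"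
        unfolding L2_set_def by (simp add: power_mult[symmetric] mult.commute)
    qed (auto simp: T_def intro!: suminf_nonneg S)
    finally show ?thesis by simp
  qed
  moreover have "(\<lambda>N. \<Sum>n<m + N. ?a n * z ^ n) \<longlonglongrightarrow> f z"
    using taylor_coeff_sums[OF hol z] unfolding sums_def
    by (subst add.commute) (rule LIMSEQ_ignore_initial_segment)
  ultimately have "cmod (f z) \<le> (\<Sum>n<m. cmod (?a n)) + sqrt T * sqrt (1 / (1 - x\<^sup>2))"
    by (intro Lim_bounded[OF tendsto_norm]) auto
  then have "cmod (f z) * sqrt (1 - x\<^sup>2) \<le> ((\<Sum>n<m. cmod (?a n)) + sqrt T * sqrt (1 / (1 - x\<^sup>2))) * sqrt (1 - x\<^sup>2)"
    using x2 by (intro mult_right_mono) auto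
  also have "\<dots> = (\<Sum>n<m. cmod (?a n)) * sqrt (1 - x\<^sup>2) + sqrt T"
    using x2 by (simp add: algebra_simps real_sqrt_divide)
  finally show ?thesis unfolding x_def T_def .
qed

lemma hardy2_eval_bound:
  assumes "f \<in> hardy2" "cmod z < 1"
  shows "cmod (f z) * sqrt (1 - (cmod z)\<^sup>2) \<le> h2_norm f"
  using hardy2_point_bound[OF assms, of 0] by (simp add: h2_norm_def)

section \<open>Composition operators and the Poisson kernel\<close>

text \<open>Cauchy's integral formula in Szego form: as e * cnj e = 1 on the unit circle, e / (e -
  q) equals 1 / (1 - q * cnj e), and the factor e comes from the derivative of the path.\<close>

lemma cauchy_circle_mean:
  assumes "continuous_on (cball 0 1) g" "g holomorphic_on ball 0 1" "cmod q < 1"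
  shows "((\<lambda>x. g (cis (2 * pi * x)) / (1 - q * cnj (cis (2 * pi * x)))) has_integral g q) {0..1}"
proof -
  have "((\<lambda>u. g u / (u - q)) has_contour_integral (2 * of_real pi * \<i> * g q)) (circlepath 0 1)"
    using Cauchy_integral_circlepath[of 0 1 g q] assms by simp
  then have "((\<lambda>x. g (circlepath 0 1 x) / (circlepath 0 1 x - q) * vector_derivative (circlepath 0 1) (at x within {0..1}))
      has_integral (2 * of_real pi * \<i> * g q)) {0..1}"
    by (simp add: has_contour_integral_def)
  then have "((\<lambda>x. inverse (2 * of_real pi * \<i>) * (g (circlepath 0 1 x) / (circlepath 0 1 x - q) *
       vector_derivative (circlepath 0 1) (at x within {0..1})))
      has_integral inverse (2 * of_real pi * \<i>) * (2 * of_real pi * \<i> * g q)) {0..1}"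
    by (rule has_integral_mult_right)
  then have "((\<lambda>x. g (cis (2 * pi * x)) / (1 - q * cnj (cis (2 * pi * x)))) has_integral
     inverse (2 * of_real pi * \<i>) * (2 * of_real pi * \<i> * g q)) {0..1}"
  proof (rule has_integral_eq[rotated])
    fix x :: real assume x: "x \<in> {0..1}"
    define e where "e = cis (2 * pi * x)"
    have c: "circlepath 0 1 x = e" by (simp add: circlepath cis_conv_exp e_def mult_ac)
    have ee: "e * cnj e = 1" by (simp add: e_def cis_cnj cis_mult)
    have "e \<noteq> q" using assms(3) by (auto simp: e_def)
    moreover have "e * (1 - q * cnj e) = e - q" using ee by (simp add: algebra_simps)
    ultimately have "e / (e - q) = 1 / (1 - q * cnj e)" by (auto simp: divide_simps e_def) 
    then have "g e * (e / (e - q)) = g e / (1 - q * cnj e)" by simp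
    moreover have "vector_derivative (circlepath 0 1) (at x within {0..1}) = 2 * of_real pi * \<i> * e"
      using x by (simp add: vector_derivative_circlepath01 e_def cis_conv_exp mult_ac)
    ultimately show "inverse (2 * of_real pi * \<i>) * (g (circlepath 0 1 x) / (circlepath 0 1 x - q) *
       vector_derivative (circlepath 0 1) (at x within {0..1})) =
       g (cis (2 * pi * x)) / (1 - q * cnj (cis (2 * pi * x)))"
      unfolding c e_def[symmetric] by (simp add: field_simps)
  qed
  then show ?thesis by (simp add: field_simps)
qed

lemma circle_mean_value:
  assumes h: "h holomorphic_on ball 0 1" and r: "0 \<le> r" "r < 1"
  shows "((\<lambda>x. h (rcis r (2 * pi * x))) has_integral h 0) {0..1}"
proof -
  have sub: "of_real r * z \<in> ball 0 1" if "z \<in> cball 0 1" for z :: complex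
  proof -
    have "r * cmod z \<le> r" using r that by (simp add: mult_left_le)
    then show ?thesis using r by (simp add: norm_mult)
  qed
  have "continuous_on (cball 0 1) (\<lambda>z. h (of_real r * z))"
    by (rule continuous_on_compose2[OF holomorphic_on_imp_continuous_on[OF h]])
       (use sub in \<open>auto intro!: continuous_intros\<close>)
  moreover have "(\<lambda>z. h (of_real r * z)) holomorphic_on ball 0 1"
    using holomorphic_on_compose_gen[of "\<lambda>z. of_real r * z" "ball 0 1" h "ball 0 1"] h sub
    by (force simp: o_def intro!: holomorphic_intros)
  ultimately show ?thesis
    using cauchy_circle_mean[of "\<lambda>z. h (of_real r * z)" 0] by (simp add: rcis_def)
qed

text \<open>The denominator uses |1 - p * cnj e|, which equals |e - p| on the circle, to match the
  kernel of \<open>cauchy_circle_mean\<close>.\<close>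

definition poisson :: "complex \<Rightarrow> real \<Rightarrow> real" where
  "poisson p x = (1 - (cmod p)\<^sup>2) / (cmod (1 - p * cnj (cis (2 * pi * x))))\<^sup>2"

lemma one_minus_mult_cis_nonzero: "cmod p < 1 \<Longrightarrow> 1 - p * cnj (cis x) \<noteq> 0"
  by (metis complex_mod_cnj mult.right_neutral norm_cis norm_mult norm_one order_less_irrefl right_minus_eq)

lemma poisson_nonneg: "cmod p < 1 \<Longrightarrow> 0 \<le> poisson p x"
  by (auto simp: poisson_def power_le_one intro!: divide_nonneg_nonneg)

text \<open>Harnack's inequality. At the point \<phi> 0 its right-hand side becomes the constant in
  the norm bound for composition with \<phi>.\<close>

lemma poisson_le:
  assumes "cmod p < 1"
  shows "poisson p x \<le> (1 + cmod p) / (1 - cmod p)"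
proof -
  have "1 - cmod p \<le> cmod (1 - p * cnj (cis (2 * pi * x)))"
    using norm_triangle_ineq2[of 1 "p * cnj (cis (2 * pi * x))"] by (simp add: norm_mult)
  then have "(1 - cmod p)\<^sup>2 \<le> (cmod (1 - p * cnj (cis (2 * pi * x))))\<^sup>2"
    using assms by (intro power_mono) auto
  then have "poisson p x \<le> (1 - (cmod p)\<^sup>2) / (1 - cmod p)\<^sup>2"
    unfolding poisson_def using assms
    by (intro divide_left_mono) (auto simp: power_le_one one_minus_mult_cis_nonzero intro!: mult_pos_pos)
  also have "\<dots> = (1 + cmod p) / (1 - cmod p)"
    using assms by (simp add: power2_eq_square divide_simps) (simp add: algebra_simps)
  finally show ?thesis .
qed

lemma continuous_on_poisson [continuous_intros]:
  assumes "continuous_on A f" "continuous_on A g" "\<And>t. t \<in> A \<Longrightarrow> cmod (f t) < 1"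
  shows "continuous_on A (\<lambda>t. poisson (f t) (g t))"
  unfolding poisson_def
  by (intro continuous_intros assms) (use assms(3) one_minus_mult_cis_nonzero in auto)

text \<open>Exhibits the kernel as harmonic in p, so that its composition with a holomorphic
  self-map has the mean value property.\<close>

lemma poisson_eq_Re:
  assumes "cmod p < 1"
  shows "poisson p x = Re ((1 + p * cnj (cis (2 * pi * x))) / (1 - p * cnj (cis (2 * pi * x))))"
proof -
  define q where "q = p * cnj (cis (2 * pi * x))"
  have q: "cmod q = cmod p" by (simp add: q_def norm_mult)
  have "Re ((1 + q) / (1 - q)) = Re ((1 + q) * cnj (1 - q)) / (cmod (1 - q))\<^sup>2"
    by (simp add: Re_divide cmod_power2 algebra_simps)
  also have "Re ((1 + q) * cnj (1 - q)) = 1 - (cmod q)\<^sup>2"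
    unfolding cmod_power2 by (simp add: power2_eq_square algebra_simps)
  finally show ?thesis by (simp add: poisson_def q_def[symmetric] q)
qed

lemma poisson_kernel_formula:
  assumes "cmod p < 1"
  shows "complex_of_real (poisson p x) =
    (1 - cnj p * p) / ((1 - cnj p * cis (2 * pi * x)) * (1 - p * cnj (cis (2 * pi * x))))"
proof -
  have "complex_of_real ((cmod (1 - p * cnj (cis (2 * pi * x))))\<^sup>2) =
     (1 - cnj p * cis (2 * pi * x)) * (1 - p * cnj (cis (2 * pi * x)))"
    by (simp add: complex_norm_square del: of_real_power)
  moreover have "complex_of_real ((cmod p)\<^sup>2) = cnj p * p"
    by (simp add: complex_norm_square mult.commute del: of_real_power)
  ultimately show ?thesis
    unfolding poisson_def of_real_divide of_real_diff of_real_1 by simp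
qed

text \<open>Cauchy's formula at q for g times (1 - cnj p * q) / (1 - cnj p * z), a factor
  holomorphic in z with value 1 at z = q. For q = p the kernel is the Poisson kernel at p, and for q
  close to p it stays comparable to it, so g p and g q can be compared under one positive
  weight.\<close>

lemma weighted_cauchy_mean:
  assumes g: "continuous_on (cball 0 1) g" "g holomorphic_on ball 0 1"
    and p: "cmod p < 1" and q: "cmod q < 1"
  shows "((\<lambda>x. (1 - cnj p * q) / ((1 - cnj p * cis (2 * pi * x)) * (1 - q * cnj (cis (2 * pi * x))))
     * g (cis (2 * pi * x))) has_integral g q) {0..1}"
proof -
  have nz: "1 - cnj p * z \<noteq> 0" if "z \<in> cball 0 1" for z
  proof
    assume "1 - cnj p * z = 0"
    then have "cmod (cnj p * z) = 1" by (metis eq_iff_diff_eq_0 norm_one)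
    moreover have "cmod p * cmod z \<le> cmod p" using that by (simp add: mult_left_le)
    ultimately show False using p by (simp add: norm_mult)
  qed
  have "((\<lambda>x. ((1 - cnj p * q) / (1 - cnj p * cis (2 * pi * x)) * g (cis (2 * pi * x))) / (1 - q * cnj (cis (2 * pi * x))))
     has_integral ((1 - cnj p * q) / (1 - cnj p * q) * g q)) {0..1}"
    by (intro cauchy_circle_mean continuous_intros holomorphic_intros g q) (use nz in auto)
  then show ?thesis using nz[of q] q by simp
qed

lemma integral_poisson: "cmod p < 1 \<Longrightarrow> (poisson p has_integral 1) {0..1}"
  using weighted_cauchy_mean[of "\<lambda>_. 1" p p, THEN has_integral_Re]
  by (simp add: poisson_kernel_formula[symmetric])

text \<open>The bound on the difference of kernels is the Schwarz--Pick estimate in the coordinate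
  centred at \<open>p\<close>: with \<open>X\<close>, \<open>Y\<close> below, \<open>Y / X\<close> has modulus at most \<open>\<delta>\<close> on the circle.\<close>

lemma kernel_diff_le:
  assumes p: "cmod p < 1" and q: "cmod q < 1" and \<delta>: "0 \<le> \<delta>" "\<delta> < 1"
    and le: "cmod (p - q) \<le> \<delta> * cmod (1 - cnj p * q)"
  shows "cmod (of_real (poisson p x) -
      (1 - cnj p * q) / ((1 - cnj p * cis (2 * pi * x)) * (1 - q * cnj (cis (2 * pi * x)))))
     \<le> \<delta> / (1 - \<delta>) * poisson p x"
proof -
  define e where "e = cis (2 * pi * x)"
  have ee: "e * cnj e = 1" by (simp add: e_def cis_cnj cis_mult)
  define X where "X = (1 - cnj p * q) * (1 - p * cnj e)"
  define Y where "Y = (q - p) * (cnj e - cnj p)"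
  have nz: "1 - p * cnj e \<noteq> 0" "1 - q * cnj e \<noteq> 0" "1 - cnj p * e \<noteq> 0"
    using one_minus_mult_cis_nonzero[OF p] one_minus_mult_cis_nonzero[OF q]
      one_minus_mult_cis_nonzero[of "cnj p" "- (2 * pi * x)"] p
    by (auto simp: e_def cis_cnj)
  have XY: "X - Y = (1 - q * cnj e) * (1 - cnj p * p)"
    by (simp add: X_def Y_def algebra_simps)
  have pp: "1 - cnj p * p \<noteq> 0"
  proof
    assume "1 - cnj p * p = 0"
    then have "cmod (cnj p * p) = 1" by (metis eq_iff_diff_eq_0 norm_one)
    then show False using p mult_left_le[of "cmod p" "cmod p"] by (simp add: norm_mult)
  qed
  have d0: "X - Y \<noteq> 0" unfolding XY using pp nz by simp
  have "cnj e - cnj p = cnj e * cnj (1 - p * cnj e)" using ee by (simp add: algebra_simps)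
  then have "cmod (cnj e - cnj p) = cmod (cnj e) * cmod (1 - p * cnj e)"
    by (metis complex_mod_cnj norm_mult)
  then have "cmod (cnj e - cnj p) = cmod (1 - p * cnj e)" by (simp add: e_def)
  then have "cmod Y \<le> \<delta> * cmod X"
    using mult_right_mono[OF le, of "cmod (1 - p * cnj e)"]
    by (simp add: X_def Y_def norm_mult norm_minus_commute mult_ac)
  moreover have "cmod X \<le> cmod (X - Y) + cmod Y"
    using norm_triangle_ineq[of "X - Y" Y] by simp
  ultimately have "(1 - \<delta>) * cmod Y \<le> \<delta> * cmod (X - Y)"
    using \<delta> mult_left_mono[of "cmod X" "cmod (X - Y) + cmod Y" \<delta>] by (simp add: algebra_simps)
  then have ratio: "cmod (Y / (X - Y)) \<le> \<delta> / (1 - \<delta>)"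
    using d0 \<delta> by (simp add: norm_divide divide_simps mult.commute)
  define P where "P = (1 - cnj p * p) / ((1 - cnj p * e) * (1 - p * cnj e))"
  have Peq: "P = of_real (poisson p x)"
    by (simp add: P_def e_def poisson_kernel_formula[OF p])
  \<comment> \<open>The kernel for q is the Poisson kernel at p times X / (X - Y), so the relative
    difference is - Y / (X - Y).\<close>
  have "(1 - cnj p * q) / ((1 - cnj p * e) * (1 - q * cnj e)) = P * (X / (X - Y))"
    unfolding P_def XY unfolding X_def using nz pp by (simp add: divide_simps)
  then have "P - (1 - cnj p * q) / ((1 - cnj p * e) * (1 - q * cnj e)) = P * (1 - X / (X - Y))"
    by (simp add: algebra_simps)
  also have "1 - X / (X - Y) = - (Y / (X - Y))" using d0 by (simp add: divide_simps)
  finally have "cmod (P - (1 - cnj p * q) / ((1 - cnj p * e) * (1 - q * cnj e))) = poisson p x * cmod (Y / (X - Y))"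
    using poisson_nonneg[OF p] by (simp add: norm_mult norm_divide Peq)
  also have "\<dots> \<le> poisson p x * (\<delta> / (1 - \<delta>))"
    by (rule mult_left_mono[OF ratio poisson_nonneg[OF p]])
  finally show ?thesis by (simp add: Peq e_def mult.commute)
qed

text \<open>The Poisson kernel is a probability density, so the squared mean m of |g| is at most the
  mean of |g|^2: integrate the nonnegative \<open>poisson p x * (?g x - m)\<^sup>2\<close>. The
  kernel K enters only through its domination by \<kappa> times the density.\<close>

lemma poisson_jensen:
  assumes p: "cmod p < 1" and g: "continuous_on (cball 0 1) g" and "0 \<le> \<kappa>"
    and A: "((\<lambda>x. K x * g (cis (2 * pi * x))) has_integral A) {0..1}"
    and K: "\<And>x. cmod (K x) \<le> \<kappa> * poisson p x"
  shows "(cmod A)\<^sup>2 \<le> \<kappa>\<^sup>2 * integral {0..1} (\<lambda>x. poisson p x * (cmod (g (cis (2 * pi * x))))\<^sup>2)"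
proof -
  let ?g = "\<lambda>x. cmod (g (cis (2 * pi * x)))"
  have cg: "continuous_on {0..1} (\<lambda>x. g (cis (2 * pi * x)))"
    by (rule continuous_on_compose2[OF g]) (auto intro!: continuous_intros)
  note c = continuous_intros cg
  define m where "m = integral {0..1} (\<lambda>x. poisson p x * ?g x)"
  define s where "s = integral {0..1} (\<lambda>x. poisson p x * (?g x)\<^sup>2)"
  have I1: "((\<lambda>x. poisson p x * ?g x) has_integral m) {0..1}"
    unfolding m_def by (intro integrable_integral integrable_continuous_real c) (use p in auto)
  have I2: "((\<lambda>x. poisson p x * (?g x)\<^sup>2) has_integral s) {0..1}"
    unfolding s_def by (intro integrable_integral integrable_continuous_real c) (use p in auto)
  have "cmod (integral {0..1} (\<lambda>x. K x * g (cis (2 * pi * x)))) \<le> integral {0..1} (\<lambda>x. \<kappa> * (poisson p x * ?g x))"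
  proof (rule integral_norm_bound_integral)
    show "cmod (K x * g (cis (2 * pi * x))) \<le> \<kappa> * (poisson p x * ?g x)" for x
      using mult_right_mono[OF K, of "?g x"] by (simp add: norm_mult mult.assoc)
    show "(\<lambda>x. \<kappa> * (poisson p x * ?g x)) integrable_on {0..1}"
      using has_integral_mult_right[OF I1, of \<kappa>] by (rule has_integral_integrable)
  qed (use A in \<open>auto intro: has_integral_integrable\<close>)
  then have Am: "cmod A \<le> \<kappa> * m"
    using A by (simp add: integral_unique m_def)
  have "((\<lambda>x. poisson p x * (?g x)\<^sup>2 - 2 * m * (poisson p x * ?g x) + m\<^sup>2 * poisson p x)
      has_integral (s - 2 * m * m + m\<^sup>2 * 1)) {0..1}"
    by (intro has_integral_add has_integral_diff has_integral_mult_right I1 I2 integral_poisson p)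
  moreover have "poisson p x * (?g x)\<^sup>2 - 2 * m * (poisson p x * ?g x) + m\<^sup>2 * poisson p x \<ge> 0" for x
  proof -
    have "0 \<le> poisson p x * (?g x - m)\<^sup>2" using poisson_nonneg[OF p] by simp
    then show ?thesis by (simp add: power2_eq_square algebra_simps)
  qed
  ultimately have "s - 2 * m * m + m\<^sup>2 * 1 \<ge> 0"
    by (rule has_integral_nonneg)
  then have "m\<^sup>2 \<le> s" by (simp add: power2_eq_square)
  then have "(\<kappa> * m)\<^sup>2 \<le> \<kappa>\<^sup>2 * s" by (simp add: power_mult_distrib mult_left_mono)
  with power_mono[OF Am, of 2] show ?thesis by (simp add: s_def)
qed

text \<open>Mean value property of the harmonic function z ->
  \<open>poisson (\<phi> z) x\<close>.\<close>

lemma poisson_mean: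
  assumes \<phi>: "\<phi> holomorphic_on ball 0 1" "\<And>z. cmod z < 1 \<Longrightarrow> cmod (\<phi> z) < 1"
    and r: "0 \<le> r" "r < 1"
  shows "((\<lambda>t. poisson (\<phi> (rcis r (2 * pi * t))) x) has_integral poisson (\<phi> 0) x) {0..1}"
proof -
  have "(\<lambda>z. (1 + \<phi> z * cnj (cis (2 * pi * x))) / (1 - \<phi> z * cnj (cis (2 * pi * x)))) holomorphic_on ball 0 1"
    using \<phi> one_minus_mult_cis_nonzero by (intro holomorphic_intros) auto
  from circle_mean_value[OF this r, THEN has_integral_Re] show ?thesis
    using \<phi> r by (simp add: poisson_eq_Re)
qed

text \<open>Littlewood's subordination argument: after exchanging the integrals, averaging
  \<open>poisson (\<phi> z) x\<close> over the circle in z leaves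
  \<open>poisson (\<phi> 0) x\<close>, which Harnack bounds. F is abstract so that the estimate
  covers differences of composition operators too.\<close>

lemma littlewood_mean:
  assumes \<phi>: "\<phi> holomorphic_on ball 0 1" "\<And>z. cmod z < 1 \<Longrightarrow> cmod (\<phi> z) < 1"
    and r: "0 \<le> r" "r < 1" and F: "F holomorphic_on ball 0 1"
    and g: "continuous_on (cball 0 1) g"
    and le: "\<And>z. cmod z < 1 \<Longrightarrow>
       (cmod (F z))\<^sup>2 \<le> \<kappa>\<^sup>2 * integral {0..1} (\<lambda>x. poisson (\<phi> z) x * (cmod (g (cis (2 * pi * x))))\<^sup>2)"
  shows "h2_mean r F \<le> \<kappa>\<^sup>2 * ((1 + cmod (\<phi> 0)) / (1 - cmod (\<phi> 0))) * integral {0..1} (\<lambda>x. (cmod (g (cis (2 * pi * x))))\<^sup>2)"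
proof -
  let ?G = "\<lambda>x. (cmod (g (cis (2 * pi * x))))\<^sup>2"
  let ?\<phi> = "\<lambda>t. \<phi> (rcis r (2 * pi * t))"
  have cg: "continuous_on A (\<lambda>x. g (cis (2 * pi * x)))" for A
    by (rule continuous_on_compose2[OF g]) (auto intro!: continuous_intros)
  have c\<phi>: "continuous_on A ?\<phi>" for A
    by (rule continuous_on_circle[OF \<phi>(1)]) (use r in auto)
  have \<phi>1: "cmod (?\<phi> t) < 1" for t using \<phi>(2) r by simp
  have cF: "continuous_on A (\<lambda>x. F (rcis r (2 * pi * x)))" for A
    by (rule continuous_on_circle[OF F]) (use r in auto)
  have c2: "continuous_on (cbox (0, 0) (1, 1)) (\<lambda>(t, x). poisson (?\<phi> t) x * ?G x)"
    unfolding case_prod_beta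
    by (intro continuous_intros continuous_on_compose2[OF cg[of UNIV]] continuous_on_compose2[OF c\<phi>[of UNIV]] \<phi>1)
       auto
  have ci: "(\<lambda>t. integral {0..1} (\<lambda>x. poisson (?\<phi> t) x * ?G x)) integrable_on {0..1}"
    using integral_continuous_on_param[of "{0..1}" 0 1 "\<lambda>t x. poisson (?\<phi> t) x * ?G x"] c2
    by (auto simp: cbox_Pair_eq intro: integrable_continuous_real)
  have "h2_mean r F \<le> integral {0..1} (\<lambda>t. \<kappa>\<^sup>2 * integral {0..1} (\<lambda>x. poisson (?\<phi> t) x * ?G x))"
    unfolding h2_mean_def
  proof (rule integral_le)
    show "(\<lambda>t. \<kappa>\<^sup>2 * integral {0..1} (\<lambda>x. poisson (?\<phi> t) x * ?G x)) integrable_on {0..1}"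
      using has_integral_mult_right[OF integrable_integral[OF ci]] by (rule has_integral_integrable)
  qed (use le r in \<open>auto intro!: integrable_continuous_real continuous_intros cF\<close>)
  also have "\<dots> = \<kappa>\<^sup>2 * integral {0..1} (\<lambda>t. integral {0..1} (\<lambda>x. poisson (?\<phi> t) x * ?G x))"
    by simp
  also have "integral {0..1} (\<lambda>t. integral {0..1} (\<lambda>x. poisson (?\<phi> t) x * ?G x)) =
      integral {0..1} (\<lambda>x. integral {0..1} (\<lambda>t. poisson (?\<phi> t) x * ?G x))"
    using integral_swap_continuous[OF c2] by simp
  also have "\<dots> = integral {0..1} (\<lambda>x. poisson (\<phi> 0) x * ?G x)"
    using poisson_mean[OF \<phi> r, THEN integral_unique] by simp
  also have "\<dots> \<le> integral {0..1} (\<lambda>x. (1 + cmod (\<phi> 0)) / (1 - cmod (\<phi> 0)) * ?G x)"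
    by (intro integral_le integrable_continuous_real continuous_intros cg mult_right_mono poisson_le \<phi>(2))
       (use \<phi>(2)[of 0] in auto)
  finally show ?thesis
    by (simp add: mult_left_mono mult.assoc)
qed

text \<open>The Poisson representation requires continuity on the closed disk, so it is applied to
  dilates of f, which are then released on each circle. The coefficient b is 0 for one composition
  operator and 1 for a difference of two.\<close>

lemma h2_composition_estimate:
  assumes \<phi>: "\<phi> holomorphic_on ball 0 1" "\<And>z. cmod z < 1 \<Longrightarrow> cmod (\<phi> z) < 1"
    and \<tau>: "\<tau> holomorphic_on ball 0 1" "\<And>z. cmod z < 1 \<Longrightarrow> cmod (\<tau> z) < 1"
    and f: "f \<in> hardy2" and "0 \<le> \<kappa>"
    and le: "\<And>g z. continuous_on (cball 0 1) g \<Longrightarrow> g holomorphic_on ball 0 1 \<Longrightarrow> cmod z < 1 \<Longrightarrow>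
       (cmod (g (\<phi> z) - b * g (\<tau> z)))\<^sup>2 \<le>
         \<kappa>\<^sup>2 * integral {0..1} (\<lambda>x. poisson (\<phi> z) x * (cmod (g (cis (2 * pi * x))))\<^sup>2)"
  shows "(\<lambda>z. f (\<phi> z) - b * f (\<tau> z)) \<in> hardy2"
    and "h2_norm (\<lambda>z. f (\<phi> z) - b * f (\<tau> z)) \<le> \<kappa> * sqrt ((1 + cmod (\<phi> 0)) / (1 - cmod (\<phi> 0))) * h2_norm f"
proof -
  let ?F = "\<lambda>z. f (\<phi> z) - b * f (\<tau> z)"
  let ?H = "(1 + cmod (\<phi> 0)) / (1 - cmod (\<phi> 0))"
  define C where "C = \<kappa> * sqrt ?H * h2_norm f"
  have H: "0 \<le> ?H" using \<phi>(2)[of 0] by simp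
  have hf: "f holomorphic_on ball 0 1" using f by (rule hardy2_holomorphic)
  have comp: "(\<lambda>z. f (of_real s * \<eta> z)) holomorphic_on ball 0 1"
    if "\<eta> holomorphic_on ball 0 1" "\<And>z. cmod z < 1 \<Longrightarrow> cmod (\<eta> z) < 1" "0 \<le> s" "s \<le> 1" for \<eta> s
  proof -
    have "s * cmod (\<eta> z) < 1" if "cmod z < 1" for z
      using mult_right_mono[of s 1 "cmod (\<eta> z)"] \<open>\<And>z. cmod z < 1 \<Longrightarrow> cmod (\<eta> z) < 1\<close>[OF that] \<open>s \<le> 1\<close> by simp
    then show ?thesis
      using holomorphic_on_compose_gen[of "\<lambda>z. of_real s * \<eta> z" "ball 0 1" f "ball 0 1"] hf that
      by (force simp: o_def norm_mult intro!: holomorphic_intros)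
  qed
  have holF: "?F holomorphic_on ball 0 1"
    using comp[OF \<phi>, of 1] comp[OF \<tau>, of 1] by (auto intro!: holomorphic_intros)
  have C0: "0 \<le> C" using \<open>0 \<le> \<kappa>\<close> H f by (simp add: C_def h2_norm_nonneg)
  have C2: "C\<^sup>2 = \<kappa>\<^sup>2 * ?H * (h2_norm f)\<^sup>2"
    unfolding C_def power_mult_distrib using H by simp
  have mean: "h2_mean r ?F \<le> C\<^sup>2" if r: "0 \<le> r" "r < 1" for r
  proof -
    define s where "s k = 1 - 1 / (real k + 2)" for k :: nat
    have s: "0 \<le> s k" "s k < 1" for k by (auto simp: s_def divide_simps)
    have slim: "s \<longlonglongrightarrow> 1" unfolding s_def by real_asymp
    let ?\<phi> = "\<lambda>t. \<phi> (rcis r (2 * pi * t))" and ?\<tau> = "\<lambda>t. \<tau> (rcis r (2 * pi * t))"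
    let ?Fs = "\<lambda>k z. f (of_real (s k) * \<phi> z) - b * f (of_real (s k) * \<tau> z)"
    have inD: "cmod (?\<phi> t) < 1" "cmod (?\<tau> t) < 1" for t using \<phi>(2) \<tau>(2) r by simp_all
    have cc: "continuous_on {0..1} ?\<phi>" "continuous_on {0..1} ?\<tau>"
      using continuous_on_circle[OF \<phi>(1)] continuous_on_circle[OF \<tau>(1)] r by auto
    \<comment> \<open>The images of the circle of radius r lie in a smaller disk of radius c. There
      f and all its dilates are bounded by one constant B, which supplies the dominating
      function.\<close>
    have "\<exists>c<1. \<forall>t\<in>{0..1}. cmod (h t) \<le> c" if "continuous_on {0..1} h" "\<And>t. cmod (h t) < 1" for h :: "real \<Rightarrow> complex"
      using continuous_attains_sup[of "{0..1::real}" "\<lambda>t. cmod (h t)"] that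
      by (auto intro!: continuous_intros)
    from this[OF cc(1) inD(1)] this[OF cc(2) inD(2)] obtain c1 c2
      where c12: "c1 < 1" "\<forall>t\<in>{0..1}. cmod (?\<phi> t) \<le> c1" "c2 < 1" "\<forall>t\<in>{0..1}. cmod (?\<tau> t) \<le> c2"
      by blast
    define c where "c = max c1 c2"
    have c: "c < 1" "\<And>t. t \<in> {0..1} \<Longrightarrow> cmod (?\<phi> t) \<le> c" "\<And>t. t \<in> {0..1} \<Longrightarrow> cmod (?\<tau> t) \<le> c"
      using c12 by (auto simp: c_def intro: le_max_iff_disj[THEN iffD2])
    have "compact (f ` cball 0 c)"
      using c(1) by (intro compact_continuous_image continuous_on_subset[OF holomorphic_on_imp_continuous_on[OF hf]]) auto
    then obtain B where B: "\<And>z. cmod z \<le> c \<Longrightarrow> cmod (f z) \<le> B"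
      using compact_imp_bounded by (force simp: bounded_iff)
    have sB: "cmod (f (of_real (s k) * z)) \<le> B" if "cmod z \<le> c" for k z
    proof (rule B)
      have "s k * cmod z \<le> cmod z" using s[of k] by (simp add: mult_left_le_one_le)
      then show "cmod (of_real (s k) * z) \<le> c" using that s[of k] by (simp add: norm_mult)
    qed
    have hFs: "?Fs k holomorphic_on ball 0 1" for k
      using comp[OF \<phi>, of "s k"] comp[OF \<tau>, of "s k"] s[of k] by (auto intro!: holomorphic_intros)
    have "(\<lambda>k. h2_mean r (?Fs k)) \<longlonglongrightarrow> h2_mean r ?F"
      unfolding h2_mean_def
    proof (rule dominated_convergence(2)[where h = "\<lambda>_. (B + cmod b * B)\<^sup>2"])
      show "(\<lambda>x. (cmod (?Fs k (rcis r (2 * pi * x))))\<^sup>2) integrable_on {0..1}" for k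
        by (intro integrable_continuous_real continuous_intros continuous_on_circle[OF hFs]) (use r in auto)
      show "norm ((cmod (?Fs k (rcis r (2 * pi * x))))\<^sup>2) \<le> (B + cmod b * B)\<^sup>2" if "x \<in> {0..1}" for k x
      proof -
        have "cmod (?Fs k (rcis r (2 * pi * x))) \<le> B + cmod b * B"
          using norm_triangle_ineq4[of "f (of_real (s k) * ?\<phi> x)" "b * f (of_real (s k) * ?\<tau> x)"]
            sB[OF c(2)[OF that], of k] mult_left_mono[OF sB[OF c(3)[OF that], of k], of "cmod b"]
          by (simp add: norm_mult)
        then show ?thesis by (simp add: power_mono)
      qed
      show "(\<lambda>k. (cmod (?Fs k (rcis r (2 * pi * x))))\<^sup>2) \<longlonglongrightarrow> (cmod (?F (rcis r (2 * pi * x))))\<^sup>2" for x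
      proof -
        have "(\<lambda>k. f (of_real (s k) * z)) \<longlonglongrightarrow> f z" if "cmod z < 1" for z
        proof -
          have "isCont f z"
            using holomorphic_on_imp_continuous_on[OF hf] that
            by (auto simp: continuous_on_eq_continuous_at)
          moreover have "(\<lambda>k. of_real (s k) * z) \<longlonglongrightarrow> z"
            using tendsto_mult[OF tendsto_of_real[OF slim, where 'a = complex] tendsto_const[of z]] by simp
          ultimately show ?thesis by (rule isCont_tendsto_compose)
        qed
        with inD show ?thesis by (intro tendsto_intros) auto
      qed
    qed (auto intro: integrable_const_ivl)
    moreover have "h2_mean r (?Fs k) \<le> C\<^sup>2" for k
    proof -
      let ?g = "\<lambda>z. f (of_real (s k) * z)"
      have sub: "of_real (s k) * z \<in> ball 0 1" if "z \<in> cball 0 1" for z :: complex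
      proof -
        have "s k * cmod z \<le> s k" using s[of k] that by (simp add: mult_left_le)
        then show ?thesis using s[of k] by (simp add: norm_mult)
      qed
      have cg: "continuous_on (cball 0 1) ?g"
        by (rule continuous_on_compose2[OF holomorphic_on_imp_continuous_on[OF hf]])
           (use sub in \<open>auto intro!: continuous_intros\<close>)
      have hg: "?g holomorphic_on ball 0 1"
        using comp[of "\<lambda>z. z" "s k"] s[of k] by auto
      have "h2_mean r (?Fs k) \<le> \<kappa>\<^sup>2 * ?H * integral {0..1} (\<lambda>x. (cmod (?g (cis (2 * pi * x))))\<^sup>2)"
        by (rule littlewood_mean[OF \<phi> r hFs cg le[OF cg hg]])
      also have "integral {0..1} (\<lambda>x. (cmod (?g (cis (2 * pi * x))))\<^sup>2) = h2_mean (s k) f"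
        by (simp add: h2_mean_def rcis_def)
      also have "\<kappa>\<^sup>2 * ?H * h2_mean (s k) f \<le> \<kappa>\<^sup>2 * ?H * (h2_norm f)\<^sup>2"
        by (intro mult_left_mono h2_mean_le f s mult_nonneg_nonneg[OF _ H]) auto
      finally show ?thesis unfolding C2 .
    qed
    ultimately show ?thesis by (intro LIMSEQ_le_const2) auto
  qed
  show "?F \<in> hardy2" by (rule hardy2I_mean(1)[OF holF C0 mean])
  show "h2_norm ?F \<le> \<kappa> * sqrt ?H * h2_norm f"
    using hardy2I_mean(2)[OF holF C0 mean] by (simp add: C_def)
qed

lemma
  assumes \<phi>: "\<phi> holomorphic_on ball 0 1" "\<And>z. cmod z < 1 \<Longrightarrow> cmod (\<phi> z) < 1" and f: "f \<in> hardy2"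
  shows hardy2_comp: "(\<lambda>z. f (\<phi> z)) \<in> hardy2"
    and h2_norm_comp: "h2_norm (\<lambda>z. f (\<phi> z)) \<le> sqrt ((1 + cmod (\<phi> 0)) / (1 - cmod (\<phi> 0))) * h2_norm f"
proof -
  have le: "(cmod (g (\<phi> z) - 0 * g (\<phi> z)))\<^sup>2 \<le>
         1\<^sup>2 * integral {0..1} (\<lambda>x. poisson (\<phi> z) x * (cmod (g (cis (2 * pi * x))))\<^sup>2)"
    if g: "continuous_on (cball 0 1) g" "g holomorphic_on ball 0 1" and z: "cmod z < 1" for g z
  proof -
    note \<phi>z = \<phi>(2)[OF z]
    have "((\<lambda>x. of_real (poisson (\<phi> z) x) * g (cis (2 * pi * x))) has_integral g (\<phi> z)) {0..1}"
      using weighted_cauchy_mean[OF g \<phi>z \<phi>z] unfolding poisson_kernel_formula[OF \<phi>z] .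
    from poisson_jensen[where \<kappa> = 1, OF \<phi>z g(1) _ this] show ?thesis
      using poisson_nonneg[OF \<phi>z] by simp
  qed
  have "(\<lambda>z. f (\<phi> z) - 0 * f (\<phi> z)) \<in> hardy2"
    by (rule h2_composition_estimate(1)[OF \<phi> \<phi> f zero_le_one le])
  then show "(\<lambda>z. f (\<phi> z)) \<in> hardy2" by simp
  have "h2_norm (\<lambda>z. f (\<phi> z) - 0 * f (\<phi> z)) \<le> 1 * sqrt ((1 + cmod (\<phi> 0)) / (1 - cmod (\<phi> 0))) * h2_norm f"
    by (rule h2_composition_estimate(2)[OF \<phi> \<phi> f zero_le_one le])
  then show "h2_norm (\<lambda>z. f (\<phi> z)) \<le> sqrt ((1 + cmod (\<phi> 0)) / (1 - cmod (\<phi> 0))) * h2_norm f" by simp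
qed

text \<open>Symbols that are uniformly close in the pseudohyperbolic metric have composition
  operators close in norm, even where both symbols approach the boundary: by
  \<open>kernel_diff_le\<close> the kernels differ by at most \<delta> / (1 - \<delta>) times the
  Poisson kernel.\<close>

lemma h2_norm_comp_diff:
  assumes \<phi>: "\<phi> holomorphic_on ball 0 1" "\<And>z. cmod z < 1 \<Longrightarrow> cmod (\<phi> z) < 1"
    and \<tau>: "\<tau> holomorphic_on ball 0 1" "\<And>z. cmod z < 1 \<Longrightarrow> cmod (\<tau> z) < 1"
    and f: "f \<in> hardy2" and \<delta>: "0 \<le> \<delta>" "\<delta> < 1"
    and close: "\<And>z. cmod z < 1 \<Longrightarrow> cmod (\<phi> z - \<tau> z) \<le> \<delta> * cmod (1 - cnj (\<phi> z) * \<tau> z)"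
  shows "h2_norm (\<lambda>z. f (\<phi> z) - f (\<tau> z)) \<le>
    \<delta> / (1 - \<delta>) * sqrt ((1 + cmod (\<phi> 0)) / (1 - cmod (\<phi> 0))) * h2_norm f"
proof -
  have le: "(cmod (g (\<phi> z) - 1 * g (\<tau> z)))\<^sup>2 \<le>
         (\<delta> / (1 - \<delta>))\<^sup>2 * integral {0..1} (\<lambda>x. poisson (\<phi> z) x * (cmod (g (cis (2 * pi * x))))\<^sup>2)"
    if g: "continuous_on (cball 0 1) g" "g holomorphic_on ball 0 1" and z: "cmod z < 1" for g z
  proof -
    note \<phi>z = \<phi>(2)[OF z] and \<tau>z = \<tau>(2)[OF z]
    let ?K = "\<lambda>x. of_real (poisson (\<phi> z) x) - (1 - cnj (\<phi> z) * \<tau> z) /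
        ((1 - cnj (\<phi> z) * cis (2 * pi * x)) * (1 - \<tau> z * cnj (cis (2 * pi * x))))"
    have "((\<lambda>x. ?K x * g (cis (2 * pi * x))) has_integral g (\<phi> z) - g (\<tau> z)) {0..1}"
      using has_integral_diff[OF weighted_cauchy_mean[OF g \<phi>z \<phi>z] weighted_cauchy_mean[OF g \<phi>z \<tau>z]]
      unfolding poisson_kernel_formula[OF \<phi>z] left_diff_distrib[symmetric] .
    from poisson_jensen[where \<kappa> = "\<delta> / (1 - \<delta>)", OF \<phi>z g(1) _ this] show ?thesis
      using kernel_diff_le[OF \<phi>z \<tau>z \<delta> close[OF z]] \<delta> by simp
  qed
  have \<kappa>: "0 \<le> \<delta> / (1 - \<delta>)" using \<delta> by simp
  have "h2_norm (\<lambda>z. f (\<phi> z) - 1 * f (\<tau> z)) \<le>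
      \<delta> / (1 - \<delta>) * sqrt ((1 + cmod (\<phi> 0)) / (1 - cmod (\<phi> 0))) * h2_norm f"
    by (rule h2_composition_estimate(2)[OF \<phi> \<tau> f \<kappa> le])
  then show ?thesis by simp
qed

section \<open>Weighted parabolic translations\<close>

text \<open>At z = 1 division by zero gives 0 and both sides are false, so the equivalence is
  total.\<close>

lemma disk_iff_halfplane: "cmod z < 1 \<longleftrightarrow> 1 / 2 < Re (1 / (1 - z))"
proof (cases "z = 1")
  case False
  then have pos: "(cmod (1 - z))\<^sup>2 > 0" by simp
  have "Re (1 / (1 - z)) = Re (1 - z) / (cmod (1 - z))\<^sup>2"
    by (simp add: Re_divide cmod_power2)
  moreover have "(cmod (1 - z))\<^sup>2 = 1 - 2 * Re z + (cmod z)\<^sup>2"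
    unfolding cmod_power2 by (simp add: power2_eq_square algebra_simps)
  moreover have "1 / 2 < Re (1 - z) / (cmod (1 - z))\<^sup>2 \<longleftrightarrow> (cmod (1 - z))\<^sup>2 < 2 * Re (1 - z)"
    using pos by (simp add: pos_less_divide_eq mult.commute)
  ultimately have "1 / 2 < Re (1 / (1 - z)) \<longleftrightarrow> (cmod z)\<^sup>2 < 1\<^sup>2"
    by simp
  also have "\<dots> \<longleftrightarrow> cmod z < 1"
    using power2_less_imp_less[of "cmod z" 1] power_strict_mono[of "cmod z" 1 2] by auto
  finally show ?thesis by simp
qed auto

text \<open>The disk form of the translation u -> u + \<alpha> in the coordinate u = 1 / (1 -
  z).\<close>

definition parabolic :: "complex \<Rightarrow> complex \<Rightarrow> complex" where
  "parabolic \<alpha> z = 1 - (1 - z) / (1 + \<alpha> * (1 - z))"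

lemma disk_parabolic_denom:
  assumes "cmod z < 1" "-1/2 < Re \<alpha>"
  shows "1 + \<alpha> * (1 - z) \<noteq> 0"
proof
  assume "1 + \<alpha> * (1 - z) = 0"
  moreover have "z \<noteq> 1" using assms(1) by auto
  ultimately have "1 / (1 - z) = - \<alpha>" by (simp add: divide_simps add_eq_0_iff)
  then show False using assms by (simp add: disk_iff_halfplane)
qed

lemma halfplane_parabolic:
  assumes "cmod z < 1"
  shows "1 / (1 - parabolic \<alpha> z) = 1 / (1 - z) + \<alpha>"
proof -
  have "1 - z \<noteq> 0" using assms by auto
  then show ?thesis by (simp add: parabolic_def add_divide_distrib)
qed

lemma parabolic_disk: "cmod z < 1 \<Longrightarrow> 0 \<le> Re \<alpha> \<Longrightarrow> cmod (parabolic \<alpha> z) < 1"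
  by (simp add: disk_iff_halfplane[of "parabolic \<alpha> z"] halfplane_parabolic) (simp add: disk_iff_halfplane)

lemma holomorphic_parabolic: "0 \<le> Re \<alpha> \<Longrightarrow> parabolic \<alpha> holomorphic_on ball 0 1"
  unfolding parabolic_def using disk_parabolic_denom[of _ \<alpha>] by (intro holomorphic_intros) auto

text \<open>In the coordinate u this is u / (u + y). Up to the factor 1 / (1 + y) it is the Szego
  kernel 1 / (1 - q z) with q = y / (1 + y), and Re y > -1/2 is exactly |q| < 1.\<close>

definition hkern :: "complex \<Rightarrow> complex \<Rightarrow> complex" where
  "hkern y z = 1 / (1 + y * (1 - z))"

text \<open>Multiply u / (u + \<alpha>) by (u + \<alpha>) / (u + \<alpha> + y). With the weight
  \<open>hkern \<alpha>\<close> the translation shifts the parameter of every kernel by \<alpha>,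
  which on the Laplace side is multiplication by an exponential.\<close>

lemma hkern_parabolic:
  assumes "cmod z < 1" "-1/2 < Re y" "0 \<le> Re \<alpha>"
  shows "hkern \<alpha> z * hkern y (parabolic \<alpha> z) = hkern (y + \<alpha>) z"
proof -
  have "1 + \<alpha> * (1 - z) \<noteq> 0" "1 + (y + \<alpha>) * (1 - z) \<noteq> 0"
    using disk_parabolic_denom[of z \<alpha>] disk_parabolic_denom[of z "y + \<alpha>"] assms by auto
  then show ?thesis by (simp add: hkern_def parabolic_def divide_simps) (simp add: algebra_simps)
qed

lemma cmod_less_cmod_one_plus: "-1/2 < Re y \<Longrightarrow> cmod y < cmod (1 + y)"
  by (rule power2_less_imp_less, unfold cmod_power2) (auto simp: power2_eq_square algebra_simps)

lemma hkern_sums: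
  assumes y: "-1/2 < Re y" and z: "cmod z < 1"
  shows "(\<lambda>n. 1 / (1 + y) * (y / (1 + y)) ^ n * z ^ n) sums hkern y z"
proof -
  let ?q = "y / (1 + y) * z"
  have y1: "1 + y \<noteq> 0" using cmod_less_cmod_one_plus[OF y] by auto
  have "cmod (y / (1 + y)) \<le> 1" using cmod_less_cmod_one_plus[OF y] by (simp add: norm_divide divide_le_eq)
  then have "cmod (y / (1 + y)) * cmod z \<le> cmod z" by (simp add: mult_left_le_one_le)
  then have "cmod ?q < 1" using z by (simp add: norm_mult norm_divide)
  from sums_mult[OF geometric_sums[OF this], of "1 / (1 + y)"]
  have "(\<lambda>n. 1 / (1 + y) * (y / (1 + y)) ^ n * z ^ n) sums (1 / (1 + y) * (1 / (1 - ?q)))"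
    by (simp only: power_mult_distrib mult.assoc)
  also have "1 / (1 + y) * (1 / (1 - ?q)) = hkern y z"
    using y1 by (simp add: hkern_def divide_simps) (simp add: algebra_simps)
  finally show ?thesis .
qed

text \<open>The Gram matrix of the kernels has entries 1 / (1 + y i + cnj (y j)), by summing a
  geometric series. The family is indexed by an arbitrary set, so that parameters may
  repeat.\<close>

lemma
  fixes c y :: "'i \<Rightarrow> complex"
  assumes fin: "finite I" and y: "\<And>i. i \<in> I \<Longrightarrow> -1/2 < Re (y i)"
  shows hardy2_hkern_sum: "(\<lambda>z. \<Sum>i\<in>I. c i * hkern (y i) z) \<in> hardy2"
    and h2_norm_hkern_sum: "(h2_norm (\<lambda>z. \<Sum>i\<in>I. c i * hkern (y i) z))\<^sup>2 =
      Re (\<Sum>i\<in>I. \<Sum>j\<in>I. c i * cnj (c j) / (1 + y i + cnj (y j)))"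
proof -
  let ?f = "\<lambda>z. \<Sum>i\<in>I. c i * hkern (y i) z"
  let ?b = "\<lambda>n. \<Sum>i\<in>I. c i * (1 / (1 + y i) * (y i / (1 + y i)) ^ n)"
  have s: "(\<lambda>n. ?b n * z ^ n) sums ?f z" if "cmod z < 1" for z
  proof -
    have "(\<lambda>n. \<Sum>i\<in>I. c i * (1 / (1 + y i) * (y i / (1 + y i)) ^ n * z ^ n)) sums ?f z"
      by (intro sums_sum sums_mult hkern_sums y that)
    then show ?thesis by (simp add: sum_distrib_right mult.assoc)
  qed
  have tc: "?f holomorphic_on ball 0 1" "taylor_coeff ?f n = ?b n" for n
    by (rule taylor_coeff_unique[of ?b ?f], rule s, assumption)+
  have g: "(\<lambda>n. c i * (1 / (1 + y i) * (y i / (1 + y i)) ^ n) * cnj (c j * (1 / (1 + y j) * (y j / (1 + y j)) ^ n)))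
      sums (c i * cnj (c j) / (1 + y i + cnj (y j)))" if "i \<in> I" "j \<in> I" for i j
  proof -
    let ?q = "y i / (1 + y i) * cnj (y j / (1 + y j))"
    have nz: "1 + y i \<noteq> 0" "1 + y j \<noteq> 0"
      using cmod_less_cmod_one_plus[OF y[OF that(1)]] cmod_less_cmod_one_plus[OF y[OF that(2)]] by auto
    then have nz': "1 + cnj (y j) \<noteq> 0" by (metis complex_cnj_add complex_cnj_one complex_cnj_zero_iff)
    have l: "cmod (y k / (1 + y k)) < 1" if "k \<in> I" for k
      using cmod_less_cmod_one_plus[OF y[OF that]] by (auto simp: norm_divide divide_less_eq)
    have "cmod ?q < 1 * 1" unfolding norm_mult complex_mod_cnj
      using that by (intro mult_strict_mono l) auto
    then have "(\<lambda>n. c i * cnj (c j) / ((1 + y i) * (1 + cnj (y j))) * ?q ^ n) sums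
        (c i * cnj (c j) / ((1 + y i) * (1 + cnj (y j))) * (1 / (1 - ?q)))"
      by (intro sums_mult geometric_sums) simp
    moreover have "(1 + y i) * (1 + cnj (y j)) * (1 - ?q) = 1 + y i + cnj (y j)"
    proof -
      have "?q = y i * cnj (y j) / ((1 + y i) * (1 + cnj (y j)))" by simp
      then have "(1 + y i) * (1 + cnj (y j)) * (1 - ?q) = (1 + y i) * (1 + cnj (y j)) - y i * cnj (y j)"
        using nz nz' by (simp add: right_diff_distrib)
      also have "\<dots> = 1 + y i + cnj (y j)" by (simp add: algebra_simps)
      finally show ?thesis .
    qed
    then have "c i * cnj (c j) / ((1 + y i) * (1 + cnj (y j))) * (1 / (1 - ?q)) = c i * cnj (c j) / (1 + y i + cnj (y j))"
      by (metis (no_types, lifting) mult.right_neutral times_divide_times_eq)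
    moreover have "c i * cnj (c j) / ((1 + y i) * (1 + cnj (y j))) * ?q ^ n =
        c i * (1 / (1 + y i) * (y i / (1 + y i)) ^ n) * cnj (c j * (1 / (1 + y j) * (y j / (1 + y j)) ^ n))" for n
      by (simp add: power_mult_distrib power_divide mult_ac)
    ultimately show ?thesis
      by (simp only:)
  qed
  have "(\<lambda>n. \<Sum>i\<in>I. \<Sum>j\<in>I. c i * (1 / (1 + y i) * (y i / (1 + y i)) ^ n) * cnj (c j * (1 / (1 + y j) * (y j / (1 + y j)) ^ n)))
     sums (\<Sum>i\<in>I. \<Sum>j\<in>I. c i * cnj (c j) / (1 + y i + cnj (y j)))"
    by (intro sums_sum g)
  also have "(\<lambda>n. \<Sum>i\<in>I. \<Sum>j\<in>I. c i * (1 / (1 + y i) * (y i / (1 + y i)) ^ n) * cnj (c j * (1 / (1 + y j) * (y j / (1 + y j)) ^ n)))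
     = (\<lambda>n. complex_of_real ((cmod (taylor_coeff ?f n))\<^sup>2))"
    unfolding tc(2) complex_norm_square cnj_sum sum_product ..
  finally have "(\<lambda>n. (cmod (taylor_coeff ?f n))\<^sup>2) sums Re (\<Sum>i\<in>I. \<Sum>j\<in>I. c i * cnj (c j) / (1 + y i + cnj (y j)))"
    by (drule_tac sums_Re) simp
  then show "?f \<in> hardy2" "(h2_norm ?f)\<^sup>2 = Re (\<Sum>i\<in>I. \<Sum>j\<in>I. c i * cnj (c j) / (1 + y i + cnj (y j)))"
    using tc(1) hardy2_sums[of ?f] by (auto simp: hardy2_def sums_iff)
qed

section \<open>The Laplace transform as an isometry on kernel sums\<close>

lemma has_integral_exp_complex:
  fixes b :: complex
  assumes "b \<noteq> 0" "0 \<le> T"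
  shows "((\<lambda>s. exp (- b * of_real s)) has_integral (1 - exp (- b * of_real T)) / b) {0..T}"
proof -
  have "((\<lambda>s. exp (- b * of_real s)) has_integral - exp (- b * of_real T) / b - (- exp (- b * of_real 0) / b)) {0..T}"
  proof (rule fundamental_theorem_of_calculus[OF assms(2)])
    fix x :: real
    have "((\<lambda>z. - exp (- b * z) / b) has_field_derivative exp (- b * of_real x)) (at (of_real x))"
      using assms by (auto intro!: derivative_eq_intros)
    then show "((\<lambda>s. - exp (- b * of_real s) / b) has_vector_derivative exp (- b * of_real x)) (at x within {0..T})"
      by (rule has_vector_derivative_real_field)
  qed
  then show ?thesis by (simp add: diff_divide_distrib)
qed

text \<open>The Laplace transform \<open>F \<mapsto> u \<integral> F(s) e\<^sup>-\<^sup>s\<^sup>u ds\<close>, where \<open>u = 1 / (1 - z)\<close>, is an isometry from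
  the weight \<open>e\<^sup>-\<^sup>s\<close> on the half line to the Hardy space, and sends \<open>e\<^sup>-\<^sup>y\<^sup>s\<close> to \<open>hkern y\<close>.\<close>

lemma h2_norm_hkern_sum_laplace:
  fixes c y :: "'i \<Rightarrow> complex"
  assumes fin: "finite I" and y: "\<And>i. i \<in> I \<Longrightarrow> -1/2 < Re (y i)"
  shows "((\<lambda>T. integral {0..T} (\<lambda>s. (cmod (\<Sum>i\<in>I. c i * exp (- y i * of_real s)))\<^sup>2 * exp (- s))) \<longlongrightarrow>
     (h2_norm (\<lambda>z. \<Sum>i\<in>I. c i * hkern (y i) z))\<^sup>2) at_top"
proof -
  let ?F = "\<lambda>s. (cmod (\<Sum>i\<in>I. c i * exp (- y i * of_real s)))\<^sup>2 * exp (- s)"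
  let ?b = "\<lambda>i j. 1 + y i + cnj (y j)"
  let ?R = "\<lambda>T. \<Sum>i\<in>I. \<Sum>j\<in>I. c i * cnj (c j) * ((1 - exp (- ?b i j * of_real T)) / ?b i j)"
  have b: "0 < Re (?b i j)" if "i \<in> I" "j \<in> I" for i j
    using y[OF that(1)] y[OF that(2)] by simp
  have int: "(?F has_integral Re (?R T)) {0..T}" if "0 \<le> T" for T
  proof -
    have "((\<lambda>s. \<Sum>i\<in>I. \<Sum>j\<in>I. c i * cnj (c j) * exp (- ?b i j * of_real s)) has_integral ?R T) {0..T}"
    proof (intro has_integral_sum fin has_integral_mult_right has_integral_exp_complex that)
      show "?b i j \<noteq> 0" if "i \<in> I" "j \<in> I" for i j
        using b[OF that] by (metis less_irrefl zero_complex.simps(1))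
    qed
    also have "(\<lambda>s. \<Sum>i\<in>I. \<Sum>j\<in>I. c i * cnj (c j) * exp (- ?b i j * of_real s)) = (\<lambda>s. complex_of_real (?F s))"
    proof
      fix s
      have "c i * cnj (c j) * exp (- ?b i j * of_real s) =
          (c i * exp (- y i * of_real s)) * cnj (c j * exp (- y j * of_real s)) * exp (- of_real s)" for i j
        by (simp add: exp_cnj algebra_simps flip: exp_add) 
      moreover have "complex_of_real (?F s) =
          (\<Sum>i\<in>I. \<Sum>j\<in>I. (c i * exp (- y i * of_real s)) * cnj (c j * exp (- y j * of_real s)) * exp (- of_real s))"
        unfolding of_real_mult complex_norm_square cnj_sum sum_product sum_distrib_right
        by (simp add: sum_distrib_left sum_distrib_right mult.assoc flip: exp_of_real)
      ultimately show "(\<Sum>i\<in>I. \<Sum>j\<in>I. c i * cnj (c j) * exp (- ?b i j * of_real s)) = complex_of_real (?F s)"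
        by (simp only:)
    qed
    finally have "((\<lambda>s. Re (complex_of_real (?F s))) has_integral Re (?R T)) {0..T}"
      by (rule has_integral_Re)
    then show ?thesis by simp
  qed
  \<comment> \<open>Since Re (?b i j) > 0 the boundary terms vanish as T grows, and the Gram matrix
    of \<open>h2_norm_hkern_sum\<close> remains.\<close>
  have "((\<lambda>T. Re (?R T)) \<longlongrightarrow> Re (\<Sum>i\<in>I. \<Sum>j\<in>I. c i * cnj (c j) * ((1 - 0) / ?b i j))) at_top"
  proof (intro tendsto_intros)
    show "?b i j \<noteq> 0" if "i \<in> I" "j \<in> I" for i j
        using b[OF that] by (metis less_irrefl zero_complex.simps(1))
    show "((\<lambda>T. exp (- ?b i j * complex_of_real T)) \<longlongrightarrow> 0) at_top" if "i \<in> I" "j \<in> I" for i j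
    proof (rule tendsto_norm_zero_cancel)
      define r where "r = Re (?b i j)"
      have "r > 0" using b[OF that] by (simp add: r_def)
      then have "((\<lambda>T. exp (- r * T)) \<longlongrightarrow> 0) at_top" by real_asymp
      then show "((\<lambda>T. cmod (exp (- ?b i j * complex_of_real T))) \<longlongrightarrow> 0) at_top"
        by (simp add: norm_exp_eq_Re r_def algebra_simps)
    qed
  qed
  then have "((\<lambda>T. Re (?R T)) \<longlongrightarrow> (h2_norm (\<lambda>z. \<Sum>i\<in>I. c i * hkern (y i) z))\<^sup>2) at_top"
    using h2_norm_hkern_sum[where c = c, OF fin y] by simp
  then show ?thesis
  proof (rule Lim_transform_eventually)
    show "\<forall>\<^sub>F T in at_top. Re (?R T) = integral {0..T} ?F"
      using eventually_ge_at_top[of 0] by eventually_elim (rule integral_unique[OF int, symmetric])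
  qed
qed

text \<open>A multiplication operator on the half line is bounded below by any lower bound for its
  multiplier. The integrands are compared on \<open>{0..T}\<close> and T tends to infinity
  afterwards.\<close>

lemma hkern_sum_mult_bound:
  fixes c y c' y' :: "_ \<Rightarrow> complex"
  assumes fin: "finite I" "finite J" and y: "\<And>i. i \<in> I \<Longrightarrow> -1/2 < Re (y i)" "\<And>j. j \<in> J \<Longrightarrow> -1/2 < Re (y' j)"
    and "0 \<le> d"
    and m: "\<And>s. 0 \<le> s \<Longrightarrow> (\<Sum>j\<in>J. c' j * exp (- y' j * of_real s)) = m s * (\<Sum>i\<in>I. c i * exp (- y i * of_real s))"
    and d: "\<And>s::real. 0 \<le> s \<Longrightarrow> d \<le> cmod (m s)"
  shows "d * h2_norm (\<lambda>z. \<Sum>i\<in>I. c i * hkern (y i) z) \<le> h2_norm (\<lambda>z. \<Sum>j\<in>J. c' j * hkern (y' j) z)"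
proof -
  let ?f = "\<lambda>z. \<Sum>i\<in>I. c i * hkern (y i) z" and ?g = "\<lambda>z. \<Sum>j\<in>J. c' j * hkern (y' j) z"
  let ?F = "\<lambda>s. (cmod (\<Sum>i\<in>I. c i * exp (- y i * of_real s)))\<^sup>2 * exp (- s)"
  let ?G = "\<lambda>s. (cmod (\<Sum>j\<in>J. c' j * exp (- y' j * of_real s)))\<^sup>2 * exp (- s)"
  have "d\<^sup>2 * (h2_norm ?f)\<^sup>2 \<le> (h2_norm ?g)\<^sup>2"
  proof (rule tendsto_le[OF trivial_limit_at_top_linorder])
    show "((\<lambda>T. d\<^sup>2 * integral {0..T} ?F) \<longlongrightarrow> d\<^sup>2 * (h2_norm ?f)\<^sup>2) at_top"
      by (intro tendsto_intros h2_norm_hkern_sum_laplace fin y)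
    show "((\<lambda>T. integral {0..T} ?G) \<longlongrightarrow> (h2_norm ?g)\<^sup>2) at_top"
      by (intro h2_norm_hkern_sum_laplace fin y)
    have "d\<^sup>2 * integral {0..T} ?F \<le> integral {0..T} ?G" for T
    proof -
      have "integral {0..T} (\<lambda>s. d\<^sup>2 * ?F s) \<le> integral {0..T} ?G"
      proof (rule integral_le)
        fix s assume "s \<in> {0..T}"
        then have s: "0 \<le> s" by simp
        have "d\<^sup>2 \<le> (cmod (m s))\<^sup>2" using d[OF s] \<open>0 \<le> d\<close> by (rule power_mono)
        then have "d\<^sup>2 * ?F s \<le> (cmod (m s))\<^sup>2 * ?F s" by (intro mult_right_mono) auto
        then show "d\<^sup>2 * ?F s \<le> ?G s"
          unfolding m[OF s] by (simp add: norm_mult power_mult_distrib mult.assoc)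
      qed (auto intro!: integrable_continuous_real continuous_intros)
      then show ?thesis by simp
    qed
    then show "\<forall>\<^sub>F T in at_top. d\<^sup>2 * integral {0..T} ?F \<le> integral {0..T} ?G" by simp
  qed
  then have "(d * h2_norm ?f)\<^sup>2 \<le> (h2_norm ?g)\<^sup>2" by (simp add: power_mult_distrib)
  then show ?thesis
    by (rule power2_le_imp_le) (intro h2_norm_nonneg hardy2_hkern_sum fin y)
qed

section \<open>Density of the kernels in the Hardy space\<close>

definition hkern_span :: "(complex \<Rightarrow> complex) set" where
  "hkern_span = {f. \<exists>I c. finite I \<and> (\<forall>y\<in>I. -1/2 < Re y) \<and> f = (\<lambda>z. \<Sum>y\<in>I. c y * hkern y z)}"

definition hkern_closure :: "(complex \<Rightarrow> complex) set" where
  "hkern_closure = {f \<in> hardy2. \<forall>\<epsilon>>0. \<exists>g\<in>hkern_span. h2_norm (\<lambda>z. f z - g z) < \<epsilon>}"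

lemma hkern_span_hardy2: "f \<in> hkern_span \<Longrightarrow> f \<in> hardy2"
  by (auto simp: hkern_span_def intro: hardy2_hkern_sum)

lemma h2_norm_zero [simp]: "h2_norm (\<lambda>_. 0) = 0"
  using h2_norm_const_le[of 0] h2_norm_nonneg[OF hardy2_const[of 0]] by simp

lemma hkern_span_subset_closure: "f \<in> hkern_span \<Longrightarrow> f \<in> hkern_closure"
  by (auto simp: hkern_closure_def hkern_span_hardy2 intro!: bexI[of _ f])

lemma hkern_span_hkern: "-1/2 < Re y \<Longrightarrow> hkern y \<in> hkern_span"
  unfolding hkern_span_def
  by (rule CollectI, rule exI[of _ "{y}"], rule exI[of _ "\<lambda>_. 1"]) auto

lemma hkern_span_cmult: "f \<in> hkern_span \<Longrightarrow> (\<lambda>z. a * f z) \<in> hkern_span"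
proof -
  assume "f \<in> hkern_span"
  then obtain I c where "finite I" "\<forall>y\<in>I. -1/2 < Re y" "f = (\<lambda>z. \<Sum>y\<in>I. c y * hkern y z)"
    by (auto simp: hkern_span_def)
  then show ?thesis
    unfolding hkern_span_def
    by (intro CollectI exI[of _ I] exI[of _ "\<lambda>y. a * c y"]) (auto simp: sum_distrib_left mult.assoc)
qed

lemma hkern_span_add:
  assumes "f \<in> hkern_span" "g \<in> hkern_span"
  shows "(\<lambda>z. f z + g z) \<in> hkern_span"
proof -
  obtain I c where f: "finite I" "\<forall>y\<in>I. -1/2 < Re y" "f = (\<lambda>z. \<Sum>y\<in>I. c y * hkern y z)"
    using assms(1) by (auto simp: hkern_span_def)
  obtain J b where g: "finite J" "\<forall>y\<in>J. -1/2 < Re y" "g = (\<lambda>z. \<Sum>y\<in>J. b y * hkern y z)"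
    using assms(2) by (auto simp: hkern_span_def)
  let ?c = "\<lambda>y. if y \<in> I then c y else 0" and ?b = "\<lambda>y. if y \<in> J then b y else 0"
  have "f z = (\<Sum>y\<in>I \<union> J. ?c y * hkern y z)" for z
    unfolding f(3) by (rule sum.mono_neutral_cong_left) (use f g in auto)
  moreover have "g z = (\<Sum>y\<in>I \<union> J. ?b y * hkern y z)" for z
    unfolding g(3) by (rule sum.mono_neutral_cong_left) (use f g in auto)
  ultimately have "(\<lambda>z. f z + g z) = (\<lambda>z. \<Sum>y\<in>I \<union> J. (?c y + ?b y) * hkern y z)"
    by (simp add: sum.distrib distrib_right)
  then show ?thesis
    unfolding hkern_span_def using f(1,2) g(1,2)
    by (intro CollectI exI[of _ "I \<union> J"] exI[of _ "\<lambda>y. ?c y + ?b y"]) auto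
qed

lemma hkern_closure_closed:
  assumes "f \<in> hardy2" and appr: "\<And>\<epsilon>. 0 < \<epsilon> \<Longrightarrow> \<exists>g\<in>hkern_closure. h2_norm (\<lambda>z. f z - g z) < \<epsilon>"
  shows "f \<in> hkern_closure"
  unfolding hkern_closure_def
proof (intro CollectI conjI allI impI)
  fix \<epsilon> :: real assume "0 < \<epsilon>"
  then obtain g where g: "g \<in> hkern_closure" "h2_norm (\<lambda>z. f z - g z) < \<epsilon> / 2" using appr[of "\<epsilon> / 2"] by auto
  moreover have "0 < \<epsilon> / 2" using \<open>0 < \<epsilon>\<close> by simp
  ultimately obtain h where h: "h \<in> hkern_span" "h2_norm (\<lambda>z. g z - h z) < \<epsilon> / 2"
    unfolding hkern_closure_def by blast
  have "(\<lambda>z. f z - g z) \<in> hardy2" "(\<lambda>z. g z - h z) \<in> hardy2"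
    using assms(1) g(1) h(1) by (auto simp: hkern_closure_def hkern_span_hardy2 intro!: hardy2_diff)
  from h2_norm_triangle[OF this] g(2) h(2) have "h2_norm (\<lambda>z. f z - h z) < \<epsilon>" by simp
  with h(1) show "\<exists>g\<in>hkern_span. h2_norm (\<lambda>z. f z - g z) < \<epsilon>" by blast
qed fact

lemma hkern_closure_add:
  assumes "f \<in> hkern_closure" "g \<in> hkern_closure"
  shows "(\<lambda>z. f z + g z) \<in> hkern_closure"
  unfolding hkern_closure_def
proof (intro CollectI conjI allI impI)
  have fg: "f \<in> hardy2" "g \<in> hardy2" using assms by (auto simp: hkern_closure_def)
  then show "(\<lambda>z. f z + g z) \<in> hardy2" by (rule hardy2_add)
  fix \<epsilon> :: real assume "0 < \<epsilon>"
  then have "0 < \<epsilon> / 2" by simp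
  with assms obtain f' g' where f': "f' \<in> hkern_span" "h2_norm (\<lambda>z. f z - f' z) < \<epsilon> / 2"
    and g': "g' \<in> hkern_span" "h2_norm (\<lambda>z. g z - g' z) < \<epsilon> / 2"
    unfolding hkern_closure_def by blast
  have "h2_norm (\<lambda>z. (f z - f' z) + (g z - g' z)) < \<epsilon>"
    using h2_norm_triangle[OF hardy2_diff[OF fg(1) hkern_span_hardy2[OF f'(1)]] hardy2_diff[OF fg(2) hkern_span_hardy2[OF g'(1)]]]
      f'(2) g'(2) by simp
  then have "h2_norm (\<lambda>z. (f z + g z) - (f' z + g' z)) < \<epsilon>" by (simp add: algebra_simps)
  with hkern_span_add[OF f'(1) g'(1)] show "\<exists>h\<in>hkern_span. h2_norm (\<lambda>z. f z + g z - h z) < \<epsilon>"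
    by (intro bexI[of _ "\<lambda>z. f' z + g' z"])
qed

lemma hkern_closure_cmult:
  assumes "f \<in> hkern_closure"
  shows "(\<lambda>z. a * f z) \<in> hkern_closure"
  unfolding hkern_closure_def
proof (intro CollectI conjI allI impI)
  have f: "f \<in> hardy2" using assms by (auto simp: hkern_closure_def)
  then show "(\<lambda>z. a * f z) \<in> hardy2" by (rule hardy2_cmult)
  fix \<epsilon> :: real assume "0 < \<epsilon>"
  then have "0 < \<epsilon> / (cmod a + 1)" by (simp add: add_nonneg_pos)
  with assms obtain g where g: "g \<in> hkern_span" "h2_norm (\<lambda>z. f z - g z) < \<epsilon> / (cmod a + 1)"
    unfolding hkern_closure_def by blast
  have d: "(\<lambda>z. f z - g z) \<in> hardy2" by (intro hardy2_diff f hkern_span_hardy2 g)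
  have "h2_norm (\<lambda>z. a * f z - a * g z) = cmod a * h2_norm (\<lambda>z. f z - g z)"
    using h2_norm_cmult[OF d, of a] by (simp add: right_diff_distrib)
  also have "\<dots> \<le> (cmod a + 1) * h2_norm (\<lambda>z. f z - g z)"
    using h2_norm_nonneg[OF d] by (simp add: mult_right_mono)
  also have "\<dots> < \<epsilon>" using g(2) by (simp add: pos_less_divide_eq add_nonneg_pos mult.commute)
  finally show "\<exists>h\<in>hkern_span. h2_norm (\<lambda>z. a * f z - h z) < \<epsilon>"
    using hkern_span_cmult[OF g(1), of a] by (intro bexI[of _ "\<lambda>z. a * g z"])
qed

lemma cmod_one_minus_le: "cmod z < 1 \<Longrightarrow> cmod (1 - z) \<le> 2"
  using norm_triangle_ineq4[of 1 z] by simp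

text \<open>For \<open>y \<noteq> 0\<close> the product \<open>(1 - z) hkern y z\<close> is a divided difference of the kernels, hence in
  their span; \<open>y = 0\<close> is reached as a limit.\<close>

lemma one_minus_hkern_in_closure:
  assumes y: "-1/2 < Re y"
  shows "(\<lambda>z. (1 - z) * hkern y z) \<in> hkern_closure"
proof -
  have ne: "(\<lambda>z. (1 - z) * hkern y z) \<in> hkern_closure" if y: "-1/2 < Re y" and "y \<noteq> 0" for y
  proof (rule hkern_closure_closed)
    have "hkern y \<in> hardy2" using y by (intro hkern_span_hardy2 hkern_span_hkern)
    then show w: "(\<lambda>z. (1 - z) * hkern y z) \<in> hardy2"
      by (intro hardy2_mult[where K = 2] cmod_one_minus_le) (auto intro!: holomorphic_intros)
    let ?g = "\<lambda>z. inverse y * (hkern 0 z + (-1) * hkern y z)"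
    have g: "?g \<in> hkern_span"
      by (intro hkern_span_cmult hkern_span_add hkern_span_hkern y) auto
    have "(1 - z) * hkern y z = ?g z" if "cmod z < 1" for z
      using disk_parabolic_denom[OF that y] \<open>y \<noteq> 0\<close>
      by (simp add: hkern_def divide_simps)
    then have "eq_on_disk (\<lambda>z. (1 - z) * hkern y z - ?g z) (\<lambda>_. 0)" by (simp add: eq_on_disk_def)
    then have "h2_norm (\<lambda>z. (1 - z) * hkern y z - ?g z) = 0"
      using h2_norm_eq_on_disk by fastforce
    with hkern_span_subset_closure[OF g]
    show "\<exists>g\<in>hkern_closure. h2_norm (\<lambda>z. (1 - z) * hkern y z - g z) < \<epsilon>" if "0 < \<epsilon>" for \<epsilon>
      using that by (intro bexI[of _ ?g]) auto
  qed
  show ?thesis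
  proof (cases "y = 0")
    case False
    with ne y show ?thesis by blast
  next
    case True
    have h: "hkern 0 = (\<lambda>_. 1)" by (simp add: hkern_def fun_eq_iff)
    have w: "(\<lambda>z. 1 - z) \<in> hardy2"
      by (rule hardy2_bounded[where K = 2]) (auto intro!: holomorphic_intros cmod_one_minus_le)
    have "(\<lambda>z. 1 - z) \<in> hkern_closure"
    proof (rule hkern_closure_closed[OF w])
      fix \<epsilon> :: real assume "0 < \<epsilon>"
      \<comment> \<open>With t <= 1/4 the denominator 1 + t (1 - z) has modulus at least 1/2, so the
        error is at most t * 4 * 2 = 8 t, which is at most half of \<epsilon>.\<close>
      define t where "t = min (1/4) (\<epsilon> / 16)"
      have t: "0 < t" "t \<le> 1/4" "t < \<epsilon> / 8" using \<open>0 < \<epsilon>\<close> by (auto simp: t_def)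
      let ?g = "\<lambda>z. (1 - z) * hkern (of_real t) z"
      have g: "?g \<in> hkern_closure" using t by (intro ne) auto
      then have gh: "?g \<in> hardy2" by (simp add: hkern_closure_def)
      have bd: "cmod (1 - z - ?g z) \<le> 8 * t" if z: "cmod z < 1" for z
      proof -
        let ?w = "1 - z"
        have "t * cmod ?w \<le> 1/4 * 2" using t cmod_one_minus_le[OF z] by (intro mult_mono) auto
        then have "1/2 \<le> 1 - cmod (of_real t * ?w)" using t by (simp add: norm_mult)
        also have "\<dots> \<le> cmod (1 + of_real t * ?w)"
          using norm_diff_ineq[of 1 "of_real t * ?w"] by simp
        finally have den: "1/2 \<le> cmod (1 + of_real t * ?w)" .
        then have nz: "1 + of_real t * ?w \<noteq> 0" by auto
        have "1 - z - ?g z = of_real t * ?w\<^sup>2 / (1 + of_real t * ?w)"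
          using nz by (simp add: hkern_def field_simps power2_eq_square)
        then have "cmod (1 - z - ?g z) = t * (cmod ?w)\<^sup>2 / cmod (1 + of_real t * ?w)"
          using t by (simp add: norm_divide norm_mult norm_power)
        also have "\<dots> \<le> t * 2\<^sup>2 / (1/2)"
          using t den cmod_one_minus_le[OF z] by (intro frac_le mult_left_mono power_mono) auto
        finally show ?thesis by simp
      qed
      have "h2_norm (\<lambda>z. 1 - z - ?g z) \<le> 8 * t"
        using t by (intro hardy2_bounded bd holomorphic_on_diff hardy2_holomorphic[OF w] hardy2_holomorphic[OF gh]) auto
      with t have "h2_norm (\<lambda>z. 1 - z - ?g z) < \<epsilon>" by linarith
      with g show "\<exists>g\<in>hkern_closure. h2_norm (\<lambda>z. 1 - z - g z) < \<epsilon>"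
        by (intro bexI[of _ ?g])
    qed
    then show ?thesis by (simp add: True h)
  qed
qed

text \<open>Invariance under multiplication by 1 - z, hence by z, produces all monomials from the
  constant \<open>hkern 0\<close>.\<close>

lemma hkern_closure_one_minus:
  assumes "f \<in> hkern_closure"
  shows "(\<lambda>z. (1 - z) * f z) \<in> hkern_closure"
proof -
  have m: "(\<lambda>z. (1 - z) * g z) \<in> hardy2" "h2_norm (\<lambda>z. (1 - z) * g z) \<le> 2 * h2_norm g"
    if "g \<in> hardy2" for g
    using that by (auto intro!: hardy2_mult cmod_one_minus_le holomorphic_intros)
  have sp: "(\<lambda>z. (1 - z) * g z) \<in> hkern_closure" if g: "g \<in> hkern_span" for g
  proof -
    obtain I c where I: "finite I" "\<forall>y\<in>I. -1/2 < Re y" and g: "g = (\<lambda>z. \<Sum>y\<in>I. c y * hkern y z)"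
      using g by (auto simp: hkern_span_def)
    have "(\<lambda>z. \<Sum>y\<in>I. c y * ((1 - z) * hkern y z)) \<in> hkern_closure"
      using I
    proof (induction I)
      case empty
      have "(\<lambda>z. 0 * hkern 0 z) \<in> hkern_closure"
        by (intro hkern_closure_cmult hkern_span_subset_closure hkern_span_hkern) auto
      then show ?case by simp
    next
      case (insert y I)
      then show ?case
        by (auto intro!: hkern_closure_add hkern_closure_cmult one_minus_hkern_in_closure)
    qed
    then show ?thesis by (simp add: g sum_distrib_left mult_ac)
  qed
  have f: "f \<in> hardy2" using assms by (simp add: hkern_closure_def)
  show ?thesis
  proof (rule hkern_closure_closed[OF m(1)[OF f]])
    fix \<epsilon> :: real assume "0 < \<epsilon>"
    then have "0 < \<epsilon> / 2" by simp
    with assms obtain g where g: "g \<in> hkern_span" "h2_norm (\<lambda>z. f z - g z) < \<epsilon> / 2"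
      unfolding hkern_closure_def by blast
    have "h2_norm (\<lambda>z. (1 - z) * (f z - g z)) \<le> 2 * h2_norm (\<lambda>z. f z - g z)"
      by (intro m hardy2_diff f hkern_span_hardy2 g)
    with g(2) have "h2_norm (\<lambda>z. (1 - z) * f z - (1 - z) * g z) < \<epsilon>" by (simp add: right_diff_distrib)
    with sp[OF g(1)] show "\<exists>g\<in>hkern_closure. h2_norm (\<lambda>z. (1 - z) * f z - g z) < \<epsilon>"
      by (intro bexI[of _ "\<lambda>z. (1 - z) * g z"])
  qed
qed

lemma hkern_closure_power: "(\<lambda>z. z ^ n) \<in> hkern_closure"
proof (induction n)
  case 0
  have "hkern 0 \<in> hkern_closure" by (intro hkern_span_subset_closure hkern_span_hkern) simp
  moreover have "hkern 0 = (\<lambda>_. 1)" by (simp add: hkern_def fun_eq_iff)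
  ultimately show ?case by simp
next
  case (Suc n)
  have "(\<lambda>z. z ^ n + (-1) * ((1 - z) * z ^ n)) \<in> hkern_closure"
    by (intro hkern_closure_add hkern_closure_cmult hkern_closure_one_minus Suc)
  then show ?case by (simp add: left_diff_distrib)
qed

text \<open>The monomials lie in the closure, and the squared norm of a Taylor remainder is the tail
  of the coefficient series.\<close>

lemma hkern_closure_eq: "hkern_closure = hardy2"
proof (intro equalityI subsetI)
  fix f assume f: "f \<in> hardy2"
  show "f \<in> hkern_closure"
  proof (rule hkern_closure_closed[OF f])
    fix \<epsilon> :: real assume "0 < \<epsilon>"
    let ?a = "taylor_coeff f"
    have sm: "summable (\<lambda>n. (cmod (?a n))\<^sup>2)" using f by (simp add: hardy2_def)
    obtain m where m: "norm (\<Sum>i. (cmod (?a (i + m)))\<^sup>2) < \<epsilon>\<^sup>2"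
      using suminf_exist_split[OF _ sm, of "\<epsilon>\<^sup>2"] \<open>0 < \<epsilon>\<close> by auto
    let ?p = "\<lambda>z. \<Sum>n<m. ?a n * z ^ n"
    have p: "?p \<in> hkern_closure"
    proof (induction m)
      case 0
      show ?case using hkern_closure_cmult[OF hkern_closure_power[of 0], of 0] by simp
    qed (auto intro!: hkern_closure_add hkern_closure_cmult hkern_closure_power)
    have "(\<lambda>n. (if n < m then 0 else ?a n) * z ^ n) sums (f z - ?p z)" if "cmod z < 1" for z
    proof -
      have "(\<lambda>n. ?a n * z ^ n - (if n \<in> {..<m} then ?a n * z ^ n else 0)) sums (f z - ?p z)"
        by (intro sums_diff taylor_coeff_sums hardy2_holomorphic f that sums_If_finite_set) auto
      moreover have "(\<lambda>n. ?a n * z ^ n - (if n \<in> {..<m} then ?a n * z ^ n else 0)) =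
          (\<lambda>n. (if n < m then 0 else ?a n) * z ^ n)" by auto
      ultimately show ?thesis by simp
    qed
    note tc = taylor_coeff_unique(2)[of "\<lambda>n. if n < m then 0 else ?a n", OF this]
    have "(h2_norm (\<lambda>z. f z - ?p z))\<^sup>2 = (\<Sum>n. (cmod (if n < m then 0 else ?a n))\<^sup>2)"
      using hardy2_sums[OF hardy2_diff[OF f, of ?p]] p by (simp add: sums_iff tc hkern_closure_def)
    also have "\<dots> = (\<Sum>n. (cmod (if n + m < m then 0 else ?a (n + m)))\<^sup>2) + (\<Sum>n<m. (cmod (if n < m then 0 else ?a n))\<^sup>2)"
    proof (rule suminf_split_initial_segment)
      show "summable (\<lambda>n. (cmod (if n < m then 0 else ?a n))\<^sup>2)"
        by (rule summable_comparison_test'[OF sm, of 0]) auto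
    qed
    also have "\<dots> = (\<Sum>i. (cmod (?a (i + m)))\<^sup>2)" by simp
    also have "\<dots> < \<epsilon>\<^sup>2" using m by simp
    finally have "h2_norm (\<lambda>z. f z - ?p z) < \<epsilon>"
      using \<open>0 < \<epsilon>\<close> by (auto intro: power2_less_imp_less)
    with p show "\<exists>g\<in>hkern_closure. h2_norm (\<lambda>z. f z - g z) < \<epsilon>"
      by (intro bexI[of _ ?p])
  qed
qed (auto simp: hkern_closure_def)

section \<open>Lower bound for the weighted translation\<close>

lemma cmod_hkern_le:
  assumes "cmod \<alpha> \<le> 1/4" "cmod z < 1"
  shows "cmod (hkern \<alpha> z) \<le> 2"
proof -
  have "cmod \<alpha> * cmod (1 - z) \<le> 1/4 * 2" using assms by (intro mult_mono cmod_one_minus_le) auto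
  then have "1/2 \<le> cmod (1 + \<alpha> * (1 - z))"
    using norm_diff_ineq[of 1 "\<alpha> * (1 - z)"] by (simp add: norm_mult)
  then have "1 / cmod (1 + \<alpha> * (1 - z)) \<le> 1 / (1/2)" by (intro divide_left_mono) (auto intro: mult_pos_pos)
  then show ?thesis by (simp add: hkern_def norm_divide)
qed

lemma holomorphic_hkern: "-1/2 < Re y \<Longrightarrow> hkern y holomorphic_on ball 0 1"
  by (intro hardy2_holomorphic hkern_span_hardy2 hkern_span_hkern)

lemma sum_Times_bool: "(\<Sum>j\<in>I \<times> (UNIV :: bool set). h j) = (\<Sum>i\<in>I. h (i, True) + h (i, False))"
  using sum.cartesian_product[of "\<lambda>i b. h (i, b)" "UNIV :: bool set" I] by (simp add: UNIV_bool add.commute)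

text \<open>On kernel sums the operator becomes multiplication by
  \<open>k * exp (- \<alpha> * of_real s) - \<mu>\<close> on the half line, so d is a lower bound
  there. Density of the sums and boundedness of the operator extend it to the whole space.\<close>

lemma weighted_parabolic_lower_bound:
  assumes \<alpha>: "0 \<le> Re \<alpha>" "cmod \<alpha> \<le> 1/4" and "0 \<le> d"
    and d: "\<And>s::real. 0 \<le> s \<Longrightarrow> d \<le> cmod (k * exp (- \<alpha> * of_real s) - \<mu>)"
    and f: "f \<in> hardy2"
  shows "d * h2_norm f \<le> h2_norm (\<lambda>z. k * (hkern \<alpha> z * f (parabolic \<alpha> z)) - \<mu> * f z)"
proof -
  let ?X = "\<lambda>f z. k * (hkern \<alpha> z * f (parabolic \<alpha> z)) - \<mu> * f z"
  define Q where "Q = sqrt ((1 + cmod (parabolic \<alpha> 0)) / (1 - cmod (parabolic \<alpha> 0)))"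
  define B where "B = cmod k * (2 * Q) + cmod \<mu>"
  have Q: "0 \<le> Q" using parabolic_disk[of 0 \<alpha>] \<alpha> by (simp add: Q_def)
  have B: "0 \<le> B" using Q by (simp add: B_def)
  have X: "?X h \<in> hardy2" "h2_norm (?X h) \<le> B * h2_norm h" if h: "h \<in> hardy2" for h
  proof -
    note c = hardy2_comp[OF holomorphic_parabolic[OF \<alpha>(1)] parabolic_disk[OF _ \<alpha>(1)] h]
      h2_norm_comp[OF holomorphic_parabolic[OF \<alpha>(1)] parabolic_disk[OF _ \<alpha>(1)] h]
    have m: "(\<lambda>z. hkern \<alpha> z * h (parabolic \<alpha> z)) \<in> hardy2"
      "h2_norm (\<lambda>z. hkern \<alpha> z * h (parabolic \<alpha> z)) \<le> 2 * h2_norm (\<lambda>z. h (parabolic \<alpha> z))"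
      using \<alpha> by (auto intro!: hardy2_mult holomorphic_hkern cmod_hkern_le c)
    show "?X h \<in> hardy2" by (intro hardy2_diff hardy2_cmult m h)
    have "h2_norm (?X h) \<le> h2_norm (\<lambda>z. k * (hkern \<alpha> z * h (parabolic \<alpha> z))) + h2_norm (\<lambda>z. \<mu> * h z)"
      by (intro h2_norm_triangle_diff hardy2_cmult m h)
    also have "\<dots> = cmod k * h2_norm (\<lambda>z. hkern \<alpha> z * h (parabolic \<alpha> z)) + cmod \<mu> * h2_norm h"
      by (simp add: h2_norm_cmult m h)
    also have "\<dots> \<le> cmod k * (2 * (Q * h2_norm h)) + cmod \<mu> * h2_norm h"
      using m(2) c(2) by (intro add_right_mono mult_left_mono) (auto simp: Q_def)
    finally show "h2_norm (?X h) \<le> B * h2_norm h" by (simp add: B_def algebra_simps)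
  qed
  have span: "d * h2_norm g \<le> h2_norm (?X g)" if g: "g \<in> hkern_span" for g
  proof -
    obtain I c where I: "finite I" "\<forall>y\<in>I. -1/2 < Re y" and g: "g = (\<lambda>z. \<Sum>y\<in>I. c y * hkern y z)"
      using g by (auto simp: hkern_span_def)
    \<comment> \<open>Each kernel yields two: \<open>True\<close> marks the translated one with
      parameter y + \<alpha>, \<open>False\<close> the one from - \<mu>. Indexing by pairs avoids
      merging terms when y + \<alpha> is itself a parameter in I.\<close>
    let ?c' = "\<lambda>(y, b). if b then k * c y else - \<mu> * c y" and ?y' = "\<lambda>(y, b). if b then y + \<alpha> else y"
    have "eq_on_disk (?X g) (\<lambda>z. \<Sum>j\<in>I \<times> UNIV. ?c' j * hkern (?y' j) z)"
      unfolding eq_on_disk_def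
    proof
      fix z :: complex assume "z \<in> ball 0 1"
      then have z: "cmod z < 1" by simp
      have "k * (hkern \<alpha> z * g (parabolic \<alpha> z)) = (\<Sum>y\<in>I. k * c y * (hkern \<alpha> z * hkern y (parabolic \<alpha> z)))"
        by (simp add: g sum_distrib_left mult_ac)
      also have "\<dots> = (\<Sum>y\<in>I. k * c y * hkern (y + \<alpha>) z)"
        by (intro sum.cong refl) (use hkern_parabolic[OF z _ \<alpha>(1)] I(2) in auto)
      finally show "?X g z = (\<Sum>j\<in>I \<times> UNIV. ?c' j * hkern (?y' j) z)"
        unfolding sum_Times_bool by (simp add: g sum.distrib sum_distrib_left sum_negf sum_subtractf mult.assoc)
    qed
    moreover have "d * h2_norm (\<lambda>z. \<Sum>y\<in>I. c y * hkern y z) \<le> h2_norm (\<lambda>z. \<Sum>j\<in>I \<times> UNIV. ?c' j * hkern (?y' j) z)"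
    proof (rule hkern_sum_mult_bound[where m = "\<lambda>s. k * exp (- \<alpha> * of_real s) - \<mu>"])
      show "-1/2 < Re (?y' j)" if "j \<in> I \<times> UNIV" for j
        using that I(2) \<alpha>(1) by (auto split: prod.splits)
      show "(\<Sum>j\<in>I \<times> UNIV. ?c' j * exp (- ?y' j * of_real s)) =
          (k * exp (- \<alpha> * of_real s) - \<mu>) * (\<Sum>y\<in>I. c y * exp (- y * of_real s))" for s
        unfolding sum_Times_bool sum_distrib_left
        by (intro sum.cong refl) (simp add: algebra_simps flip: exp_add)
    qed (use I d \<open>0 \<le> d\<close> in auto)
    ultimately show ?thesis by (simp add: h2_norm_eq_on_disk g)
  qed
  have "d * h2_norm f \<le> h2_norm (?X f) + \<epsilon>" if "0 < \<epsilon>" for \<epsilon>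
  proof -
    \<comment> \<open>Replacing f by g costs d * ?e on the left and B * ?e on the right; the summand
      1 keeps the denominator positive.\<close>
    have "0 < \<epsilon> / (d + B + 1)" using \<open>0 < \<epsilon>\<close> \<open>0 \<le> d\<close> B by simp
    moreover have "f \<in> hkern_closure" using f by (simp add: hkern_closure_eq)
    ultimately obtain g where g: "g \<in> hkern_span" "h2_norm (\<lambda>z. f z - g z) < \<epsilon> / (d + B + 1)"
      unfolding hkern_closure_def by blast
    note gh = hkern_span_hardy2[OF g(1)]
    note fg = hardy2_diff[OF f gh]
    let ?e = "h2_norm (\<lambda>z. f z - g z)"
    have e: "0 \<le> ?e" by (rule h2_norm_nonneg[OF fg])
    have "d * h2_norm f \<le> d * (?e + h2_norm g)"
      using h2_norm_le_diff[OF f gh] \<open>0 \<le> d\<close> by (rule mult_left_mono)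
    also have "\<dots> \<le> d * ?e + h2_norm (?X g)" using span[OF g(1)] by (simp add: distrib_left)
    also have "h2_norm (?X g) \<le> h2_norm (\<lambda>z. ?X g z - ?X f z) + h2_norm (?X f)"
      by (intro h2_norm_le_diff X gh f)
    also have "h2_norm (\<lambda>z. ?X g z - ?X f z) = h2_norm (\<lambda>z. ?X f z - ?X g z)"
      by (intro h2_norm_minus_commute X gh f)
    also have "(\<lambda>z. ?X f z - ?X g z) = ?X (\<lambda>z. f z - g z)"
      by (simp add: fun_eq_iff algebra_simps)
    also have "h2_norm (?X (\<lambda>z. f z - g z)) \<le> B * ?e" by (rule X(2)[OF fg])
    finally have "d * h2_norm f \<le> (d + B) * ?e + h2_norm (?X f)" by (simp add: algebra_simps)
    moreover have "(d + B) * ?e \<le> (d + B + 1) * ?e" using e by (simp add: mult_right_mono)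
    moreover have "(d + B + 1) * ?e < \<epsilon>" using g(2) \<open>0 \<le> d\<close> B by (simp add: field_simps)
    ultimately show ?thesis by linarith
  qed
  then show ?thesis by (rule field_le_epsilon)
qed

section \<open>Quadratic maps near the fixed point\<close>

definition quad_map :: "complex \<Rightarrow> complex \<Rightarrow> complex" where
  "quad_map a z = a * z\<^sup>2 + (1 - 2 * a) * z + a"

lemma one_minus_quad_map: "1 - quad_map a z = (1 - z) * (1 - a * (1 - z))"
  by (simp add: quad_map_def power2_eq_square algebra_simps)

text \<open>Above all |a| < 1/2, which keeps 1 - a (1 - z) away from 0 on the disk because |1 - z|
  <= 2.\<close>

lemma quad_map_param_less:
  assumes "2 * (cmod a)\<^sup>2 < Re a"
  shows "cmod a < 1 / 2" "0 < Re a" "0 < cmod a"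
proof -
  have "0 \<le> 2 * (cmod a)\<^sup>2" by simp
  then show "0 < Re a" using assms by linarith
  then show pos: "0 < cmod a" by auto
  have "2 * (cmod a)\<^sup>2 < cmod a" using assms complex_Re_le_cmod[of a] by linarith
  then have "cmod a * (2 * cmod a) < cmod a * 1" by (simp add: power2_eq_square algebra_simps)
  then show "cmod a < 1 / 2" using mult_less_cancel_left_pos[OF pos, of "2 * cmod a" 1] by simp
qed

lemma cmod_quad_denom:
  assumes "cmod z < 1"
  shows "1 - 2 * cmod a \<le> cmod (1 - a * (1 - z))" "cmod (1 - a * (1 - z)) \<le> 1 + 2 * cmod a"
proof -
  have "cmod (a * (1 - z)) \<le> 2 * cmod a"
    using mult_left_mono[OF cmod_one_minus_le[OF assms], of "cmod a"] by (simp add: norm_mult mult.commute)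
  then show "1 - 2 * cmod a \<le> cmod (1 - a * (1 - z))" "cmod (1 - a * (1 - z)) \<le> 1 + 2 * cmod a"
    using norm_triangle_ineq2[of 1 "a * (1 - z)"] norm_triangle_ineq4[of 1 "a * (1 - z)"] by auto
qed

text \<open>Partial fractions of 1 / (w (1 - a w)) with w = 1 - z; the second summand is a +
  O(w).\<close>

lemma halfplane_quad_map:
  assumes a: "2 * (cmod a)\<^sup>2 < Re a" and z: "cmod z < 1"
  shows "1 / (1 - quad_map a z) = 1 / (1 - z) + a / (1 - a * (1 - z))"
proof -
  have "1 - z \<noteq> 0" using z by auto
  moreover have "1 - a * (1 - z) \<noteq> 0"
    using cmod_quad_denom(1)[OF z, of a] quad_map_param_less[OF a] by auto
  ultimately show ?thesis
    unfolding one_minus_quad_map by (simp add: divide_simps) 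
qed

text \<open>A lower bound for Re (a / (1 - a w)) over w = 1 - z: the numerator comes from Re w <= 2,
  the denominator from |1 - a w| <= 1 + 2|a|.\<close>

definition quad_gain :: "complex \<Rightarrow> real" where
  "quad_gain a = (Re a - 2 * (cmod a)\<^sup>2) / (1 + 2 * cmod a)\<^sup>2"

lemma quad_gain_pos: "2 * (cmod a)\<^sup>2 < Re a \<Longrightarrow> 0 < quad_gain a"
  unfolding quad_gain_def using norm_ge_zero[of a] by (intro divide_pos_pos zero_less_power) linarith+

text \<open>The gain does not depend on z. Hence a number of iterations independent of the starting
  point suffices to enter a given horodisk.\<close>

lemma Re_halfplane_quad_map_ge:
  assumes a: "2 * (cmod a)\<^sup>2 < Re a" and z: "cmod z < 1"
  shows "Re (1 / (1 - z)) + quad_gain a \<le> Re (1 / (1 - quad_map a z))"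
proof -
  let ?q = "1 - a * (1 - z)"
  note q = cmod_quad_denom[OF z, of a]
  have q0: "0 < cmod ?q" using q(1) quad_map_param_less[OF a] by linarith
  have "Re (1 - z) \<le> 2" using complex_Re_le_cmod[of "1 - z"] cmod_one_minus_le[OF z] by linarith
  then have "(cmod a)\<^sup>2 * Re (1 - z) \<le> (cmod a)\<^sup>2 * 2" by (intro mult_left_mono) auto
  moreover have "Re (a * cnj ?q) = Re a - (cmod a)\<^sup>2 * Re (1 - z)"
    unfolding cmod_power2 by (simp add: power2_eq_square algebra_simps)
  ultimately have num: "Re a - 2 * (cmod a)\<^sup>2 \<le> Re (a * cnj ?q)" by linarith
  have "quad_gain a \<le> Re (a * cnj ?q) / (cmod ?q)\<^sup>2"
    unfolding quad_gain_def using num a q q0 by (intro frac_le power_mono) auto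
  also have "\<dots> = Re (a / ?q)"
    unfolding complex_div_cnj[of a] of_real_power[symmetric] Re_divide_of_real ..
  finally show ?thesis by (simp add: halfplane_quad_map[OF a z])
qed

lemma quad_map_disk:
  assumes "2 * (cmod a)\<^sup>2 < Re a" "cmod z < 1"
  shows "cmod (quad_map a z) < 1"
  using Re_halfplane_quad_map_ge[OF assms] quad_gain_pos[OF assms(1)] assms(2)
  by (simp add: disk_iff_halfplane)

lemma holomorphic_quad_map: "quad_map a holomorphic_on A"
  unfolding quad_map_def by (intro holomorphic_intros)

text \<open>With u = 1 / (1 - p) and v = 1 / (1 - q) the pseudohyperbolic distance is |u - v| / |cnj
  u + v - 1|, and the real part of cnj u + v - 1 is Re u + Re v - 1.\<close>

lemma pseudohyperbolic_le:
  assumes p: "cmod p < 1" and q: "cmod q < 1" and "0 \<le> \<delta>"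
    and le: "cmod (1 / (1 - p) - 1 / (1 - q)) \<le> \<delta> * (Re (1 / (1 - p)) + Re (1 / (1 - q)) - 1)"
  shows "cmod (p - q) \<le> \<delta> * cmod (1 - cnj p * q)"
proof -
  have nz: "1 - p \<noteq> 0" "1 - q \<noteq> 0" "1 - cnj p \<noteq> 0" using p q by auto
  have 1: "p - q = (1 / (1 - p) - 1 / (1 - q)) * ((1 - p) * (1 - q))"
  proof -
    have "1 / (1 - p) - 1 / (1 - q) = (p - q) / ((1 - p) * (1 - q))" using nz by (simp add: diff_frac_eq)
    then show ?thesis using nz by simp
  qed
  have 2: "1 - cnj p * q = (1 / (1 - cnj p) + 1 / (1 - q) - 1) * ((1 - cnj p) * (1 - q))"
    using nz by (simp add: divide_simps) (simp add: algebra_simps)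
  have cp: "cmod (1 - cnj p) = cmod (1 - p)"
    by (metis complex_cnj_diff complex_cnj_one complex_mod_cnj)
  have "Re (1 / (1 - cnj p)) = Re (1 / (1 - p))"
    by (metis complex_cnj_diff complex_cnj_divide complex_cnj_one cnj.simps(1))
  then have "Re (1 / (1 - p)) + Re (1 / (1 - q)) - 1 \<le> cmod (1 / (1 - cnj p) + 1 / (1 - q) - 1)"
    using complex_Re_le_cmod[of "1 / (1 - cnj p) + 1 / (1 - q) - 1"] by simp
  then have "cmod (1 / (1 - p) - 1 / (1 - q)) \<le> \<delta> * cmod (1 / (1 - cnj p) + 1 / (1 - q) - 1)"
    using le mult_left_mono[OF _ \<open>0 \<le> \<delta>\<close>] by (meson order_trans)
  then have "cmod (1 / (1 - p) - 1 / (1 - q)) * (cmod (1 - p) * cmod (1 - q)) \<le>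
      \<delta> * cmod (1 / (1 - cnj p) + 1 / (1 - q) - 1) * (cmod (1 - p) * cmod (1 - q))"
    by (intro mult_right_mono) auto
  then show ?thesis unfolding 1 2 by (simp only: norm_mult cp mult.assoc)
qed

text \<open>In the half plane the two images differ by
  \<open>a\<^sup>2 * (1 - z) / (1 - a * (1 - z))\<close>, at most 4|a|^2 in modulus, while the
  translation alone contributes Re a to Re u + Re v - 1. The quotient is homogeneous of degree 1 in
  a, so it becomes small when a is replaced by a \<rho>.\<close>

lemma quad_map_parabolic_close:
  assumes a: "2 * (cmod a)\<^sup>2 < Re a" "cmod a \<le> 1 / 4" and z: "cmod z < 1"
  shows "cmod (quad_map a z - parabolic a z) \<le>
     4 * (cmod a)\<^sup>2 / Re a * cmod (1 - cnj (quad_map a z) * parabolic a z)"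
proof (rule pseudohyperbolic_le)
  have ra: "0 < Re a" using quad_map_param_less[OF a(1)] by simp
  show "cmod (quad_map a z) < 1" by (rule quad_map_disk[OF a(1) z])
  show "cmod (parabolic a z) < 1" using ra z by (intro parabolic_disk) auto
  show "0 \<le> 4 * (cmod a)\<^sup>2 / Re a" using ra by simp
  let ?q = "1 - a * (1 - z)"
  have q: "1/2 \<le> cmod ?q" using cmod_quad_denom(1)[OF z, of a] a(2) by linarith
  then have "?q \<noteq> 0" by auto
  then have "1 / (1 - quad_map a z) - 1 / (1 - parabolic a z) = a\<^sup>2 * (1 - z) / ?q"
    unfolding halfplane_quad_map[OF a(1) z] halfplane_parabolic[OF z]
    by (simp add: field_simps power2_eq_square)
  then have "cmod (1 / (1 - quad_map a z) - 1 / (1 - parabolic a z)) = (cmod a)\<^sup>2 * cmod (1 - z) / cmod ?q"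
    by (simp add: norm_mult norm_divide norm_power)
  also have "\<dots> \<le> (cmod a)\<^sup>2 * 2 / (1/2)"
    using q cmod_one_minus_le[OF z] by (intro frac_le mult_left_mono) auto
  also have "\<dots> = 4 * (cmod a)\<^sup>2 / Re a * Re a" using ra by simp
  also have "\<dots> \<le> 4 * (cmod a)\<^sup>2 / Re a * (Re (1 / (1 - quad_map a z)) + Re (1 / (1 - parabolic a z)) - 1)"
  proof (rule mult_left_mono)
    have "1/2 < Re (1 / (1 - z))" using z by (simp add: disk_iff_halfplane)
    then show "Re a \<le> Re (1 / (1 - quad_map a z)) + Re (1 / (1 - parabolic a z)) - 1"
      using Re_halfplane_quad_map_ge[OF a(1) z] quad_gain_pos[OF a(1)]
      unfolding halfplane_parabolic[OF z] by simp
  qed (use ra in simp)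
  finally show "cmod (1 / (1 - quad_map a z) - 1 / (1 - parabolic a z)) \<le>
    4 * (cmod a)\<^sup>2 / Re a * (Re (1 / (1 - quad_map a z)) + Re (1 / (1 - parabolic a z)) - 1)" .
qed

section \<open>Lower bound on a small horodisk\<close>

definition horo_dilation :: "real \<Rightarrow> complex \<Rightarrow> complex" where
  "horo_dilation \<rho> z = 1 - of_real \<rho> * (1 - z)"

lemma horo_dilation_disk:
  assumes "0 < \<rho>" "\<rho> \<le> 1" "cmod z < 1"
  shows "cmod (horo_dilation \<rho> z) < 1"
proof -
  have "horo_dilation \<rho> z = of_real (1 - \<rho>) + of_real \<rho> * z"
    by (simp add: horo_dilation_def algebra_simps)
  then have "cmod (horo_dilation \<rho> z) \<le> \<bar>1 - \<rho>\<bar> + \<rho> * cmod z"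
    using norm_triangle_ineq[of "of_real (1 - \<rho>)" "of_real \<rho> * z"] assms by (simp add: norm_mult del: of_real_diff)
  also have "\<dots> < 1" using assms by simp
  finally show ?thesis .
qed

lemma holomorphic_horo_dilation: "horo_dilation \<rho> holomorphic_on A"
  unfolding horo_dilation_def by (intro holomorphic_intros)

text \<open>In the coordinate \<open>1 / (1 - z)\<close> the dilation is multiplication by \<open>1 / \<rho>\<close>. Restricting to
  the small horodisk that is its image rescales the parameter of the quadratic map to \<open>a \<rho>\<close>.\<close>

lemma quad_map_horo_dilation: "quad_map a (horo_dilation \<rho> z) = horo_dilation \<rho> (quad_map (a * of_real \<rho>) z)"
  by (simp add: quad_map_def horo_dilation_def power2_eq_square algebra_simps)

lemma comp_const_le_2: "cmod p \<le> 1/2 \<Longrightarrow> sqrt ((1 + cmod p) / (1 - cmod p)) \<le> 2"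
  by (intro real_le_lsqrt) (auto simp: divide_simps)

text \<open>Three replacements lead from the operator to the weighted translation, and
  \<open>small\<close> sums their costs: 2 \<eta> for \<psi> by k, 16|k||a|^2 / Re a for the
  quadratic map by the translation, and 8|k||a| for inserting the weight \<open>hkern a\<close>. The
  factors 2 bound the composition operators, whose symbols map 0 into the disk of radius
  1/2.\<close>

lemma quad_weighted_near_lower_bound:
  assumes a: "2 * (cmod a)\<^sup>2 < Re a" "cmod a \<le> 1 / 4" and \<delta>: "4 * (cmod a)\<^sup>2 / Re a \<le> 1/2"
    and \<psi>: "\<psi> holomorphic_on ball 0 1" "\<And>z. cmod z < 1 \<Longrightarrow> cmod (\<psi> z - k) \<le> \<eta>"
    and small: "2 * \<eta> + cmod k * (16 * (cmod a)\<^sup>2 / Re a + 8 * cmod a) \<le> d / 2" and "0 \<le> d"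
    and d: "\<And>s::real. 0 \<le> s \<Longrightarrow> d \<le> cmod (k * exp (- a * of_real s) - \<mu>)"
    and f: "f \<in> hardy2"
  shows "d / 2 * h2_norm f \<le> h2_norm (\<lambda>z. \<psi> z * f (quad_map a z) - \<mu> * f z)"
proof -
  define \<delta> where "\<delta> = 4 * (cmod a)\<^sup>2 / Re a"
  have ra: "0 < Re a" using quad_map_param_less[OF a(1)] by simp
  have d01: "0 \<le> \<delta>" "\<delta> < 1" "\<delta> \<le> 1/2" using ra \<delta> by (auto simp: \<delta>_def)
  let ?\<phi> = "quad_map a" and ?\<tau> = "parabolic a"
  have \<phi>: "?\<phi> holomorphic_on ball 0 1" "\<And>z. cmod z < 1 \<Longrightarrow> cmod (?\<phi> z) < 1"
    by (auto intro: holomorphic_quad_map quad_map_disk a)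
  have \<tau>: "?\<tau> holomorphic_on ball 0 1" "\<And>z. cmod z < 1 \<Longrightarrow> cmod (?\<tau> z) < 1"
    using ra by (auto intro: holomorphic_parabolic parabolic_disk)
  have \<phi>0: "cmod (?\<phi> 0) \<le> 1/2" using a(2) by (simp add: quad_map_def)
  have \<tau>0: "cmod (?\<tau> 0) \<le> 1/2"
  proof -
    have "3/4 \<le> cmod (1 + a)" using norm_diff_ineq[of 1 a] a(2) by simp
    moreover from this have "?\<tau> 0 = a / (1 + a)" by (auto simp: parabolic_def divide_simps)
    ultimately show ?thesis using a(2) by (simp add: norm_divide divide_le_eq)
  qed
  have nf: "0 \<le> h2_norm f" by (rule h2_norm_nonneg[OF f])
  note f\<phi> = hardy2_comp[OF \<phi> f] and f\<tau> = hardy2_comp[OF \<tau> f]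
  have n\<phi>: "h2_norm (\<lambda>z. f (?\<phi> z)) \<le> 2 * h2_norm f"
    using h2_norm_comp[OF \<phi> f] mult_right_mono[OF comp_const_le_2[OF \<phi>0] nf] by linarith
  have n\<tau>: "h2_norm (\<lambda>z. f (?\<tau> z)) \<le> 2 * h2_norm f"
    using h2_norm_comp[OF \<tau> f] mult_right_mono[OF comp_const_le_2[OF \<tau>0] nf] by linarith
  have ndiff: "h2_norm (\<lambda>z. f (?\<phi> z) - f (?\<tau> z)) \<le> 4 * \<delta> * h2_norm f"
  proof -
    have "h2_norm (\<lambda>z. f (?\<phi> z) - f (?\<tau> z)) \<le> \<delta> / (1 - \<delta>) * sqrt ((1 + cmod (?\<phi> 0)) / (1 - cmod (?\<phi> 0))) * h2_norm f"
      unfolding \<delta>_def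
      by (rule h2_norm_comp_diff[OF \<phi> \<tau> f d01(1,2)[unfolded \<delta>_def] quad_map_parabolic_close[OF a]])
    also have "\<dots> \<le> (2 * \<delta>) * 2 * h2_norm f"
    proof (intro mult_right_mono[OF _ nf] mult_mono comp_const_le_2 \<phi>0)
      \<comment> \<open>Here \<delta> <= 1/2 enters, through 1 <= 2 (1 - \<delta>).\<close>
      show "\<delta> / (1 - \<delta>) \<le> 2 * \<delta>" using d01 mult_left_mono[of 1 "2 * (1 - \<delta>)" \<delta>] by (simp add: divide_le_eq mult_ac)
      show "0 \<le> sqrt ((1 + cmod (?\<phi> 0)) / (1 - cmod (?\<phi> 0)))" using \<phi>0 by simp
    qed (use d01 in auto)
    finally show ?thesis by simp
  qed
  have hk: "cmod (1 - hkern a z) \<le> 4 * cmod a" if z: "cmod z < 1" for z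
  proof -
    have "1 + a * (1 - z) \<noteq> 0" using ra by (intro disk_parabolic_denom z) auto
    then have "1 - hkern a z = hkern a z * (a * (1 - z))" by (simp add: hkern_def field_simps)
    then have "cmod (1 - hkern a z) = cmod (hkern a z) * (cmod a * cmod (1 - z))" by (simp add: norm_mult)
    also have "\<dots> \<le> 2 * (cmod a * 2)"
      using z a(2) by (intro mult_mono cmod_hkern_le cmod_one_minus_le mult_left_mono) auto
    finally show ?thesis by simp
  qed
  have holh: "hkern a holomorphic_on ball 0 1" using ra by (intro holomorphic_hkern) auto
  let ?X = "\<lambda>z. k * (hkern a z * f (?\<tau> z)) - \<mu> * f z"
  let ?Y = "\<lambda>z. \<psi> z * f (?\<phi> z) - \<mu> * f z"
  let ?e1 = "\<lambda>z. (\<psi> z - k) * f (?\<phi> z)" and ?e2 = "\<lambda>z. k * (f (?\<phi> z) - f (?\<tau> z))"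
    and ?e3 = "\<lambda>z. k * ((1 - hkern a z) * f (?\<tau> z))"
  have e1: "?e1 \<in> hardy2" "h2_norm ?e1 \<le> \<eta> * h2_norm (\<lambda>z. f (?\<phi> z))"
  proof -
    have h: "(\<lambda>z. \<psi> z - k) holomorphic_on ball 0 1" using \<psi>(1) by (intro holomorphic_intros)
    show "?e1 \<in> hardy2" by (rule hardy2_mult(1)[OF h \<psi>(2) f\<phi>])
    show "h2_norm ?e1 \<le> \<eta> * h2_norm (\<lambda>z. f (?\<phi> z))" by (rule hardy2_mult(2)[OF h \<psi>(2) f\<phi>])
  qed
  have e3': "(\<lambda>z. (1 - hkern a z) * f (?\<tau> z)) \<in> hardy2"
      "h2_norm (\<lambda>z. (1 - hkern a z) * f (?\<tau> z)) \<le> 4 * cmod a * h2_norm (\<lambda>z. f (?\<tau> z))"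
  proof -
    have h: "(\<lambda>z. 1 - hkern a z) holomorphic_on ball 0 1" using holh by (intro holomorphic_intros)
    show "(\<lambda>z. (1 - hkern a z) * f (?\<tau> z)) \<in> hardy2" by (rule hardy2_mult(1)[OF h hk f\<tau>])
    show "h2_norm (\<lambda>z. (1 - hkern a z) * f (?\<tau> z)) \<le> 4 * cmod a * h2_norm (\<lambda>z. f (?\<tau> z))"
      by (rule hardy2_mult(2)[OF h hk f\<tau>])
  qed
  have e2: "?e2 \<in> hardy2" "h2_norm ?e2 = cmod k * h2_norm (\<lambda>z. f (?\<phi> z) - f (?\<tau> z))"
    using hardy2_cmult(1)[OF hardy2_diff[OF f\<phi> f\<tau>]] h2_norm_cmult[OF hardy2_diff[OF f\<phi> f\<tau>]] by blast+
  have e3: "?e3 \<in> hardy2" "h2_norm ?e3 = cmod k * h2_norm (\<lambda>z. (1 - hkern a z) * f (?\<tau> z))"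
    using hardy2_cmult(1)[OF e3'(1)] h2_norm_cmult[OF e3'(1)] by blast+
  have "0 \<le> \<eta>" using \<psi>(2)[of 0] norm_ge_zero[of "\<psi> 0 - k"] by (simp del: norm_ge_zero)
  have "(\<lambda>z. hkern a z * f (?\<tau> z)) \<in> hardy2"
    by (rule hardy2_mult(1)[OF holh _ f\<tau>]) (rule cmod_hkern_le[OF a(2)])
  then have XH: "?X \<in> hardy2" by (intro hardy2_diff hardy2_cmult f)
  have "?Y = (\<lambda>z. ?X z + (?e1 z + (?e2 z + ?e3 z)))" by (simp add: fun_eq_iff algebra_simps)
  moreover have "(\<lambda>z. ?X z + (?e1 z + (?e2 z + ?e3 z))) \<in> hardy2"
    by (intro hardy2_add XH e1 e2 e3)
  ultimately have YH: "?Y \<in> hardy2" by simp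
  have sm: "h2_norm (\<lambda>z. ?X z - ?Y z) \<le> d / 2 * h2_norm f"
  proof -
    have "h2_norm (\<lambda>z. ?X z - ?Y z) = h2_norm (\<lambda>z. ?Y z - ?X z)"
      by (rule h2_norm_minus_commute[OF XH YH])
    also have "(\<lambda>z. ?Y z - ?X z) = (\<lambda>z. ?e1 z + (?e2 z + ?e3 z))" by (simp add: fun_eq_iff algebra_simps)
    also have "h2_norm \<dots> \<le> h2_norm ?e1 + (h2_norm ?e2 + h2_norm ?e3)"
      using h2_norm_triangle[OF e1(1) hardy2_add[OF e2(1) e3(1)]] h2_norm_triangle[OF e2(1) e3(1)] by linarith
    also have "\<dots> \<le> \<eta> * (2 * h2_norm f) + (cmod k * (4 * \<delta> * h2_norm f) + cmod k * (4 * cmod a * (2 * h2_norm f)))"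
    proof (intro add_mono)
      show "h2_norm ?e1 \<le> \<eta> * (2 * h2_norm f)"
        using e1(2) mult_left_mono[OF n\<phi> \<open>0 \<le> \<eta>\<close>] by linarith
      show "h2_norm ?e2 \<le> cmod k * (4 * \<delta> * h2_norm f)"
        unfolding e2(2) by (intro mult_left_mono ndiff) auto
      have "4 * cmod a * h2_norm (\<lambda>z. f (?\<tau> z)) \<le> 4 * cmod a * (2 * h2_norm f)"
        by (intro mult_left_mono n\<tau>) auto
      with e3'(2) have "h2_norm (\<lambda>z. (1 - hkern a z) * f (?\<tau> z)) \<le> 4 * cmod a * (2 * h2_norm f)"
        by (rule order_trans)
      then show "h2_norm ?e3 \<le> cmod k * (4 * cmod a * (2 * h2_norm f))"
        unfolding e3(2) by (rule mult_left_mono) simp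
    qed
    also have "\<dots> = (2 * \<eta> + cmod k * (16 * (cmod a)\<^sup>2 / Re a + 8 * cmod a)) * h2_norm f"
      by (simp add: \<delta>_def algebra_simps)
    also have "\<dots> \<le> d / 2 * h2_norm f" using small nf by (rule mult_right_mono)
    finally show ?thesis .
  qed
  have "d * h2_norm f \<le> h2_norm ?X"
    using ra a(2) \<open>0 \<le> d\<close> d f by (intro weighted_parabolic_lower_bound) auto
  also have "\<dots> \<le> h2_norm (\<lambda>z. ?X z - ?Y z) + h2_norm ?Y" by (rule h2_norm_le_diff[OF XH YH])
  finally show ?thesis using sm by linarith
qed

text \<open>With a \<rho> in place of a, both |a|^2 / Re a and |a| scale linearly in \<rho>, and the
  image of the disk under the dilation shrinks to 1, where \<psi> is continuous. The weight error
  d/8 uses half of the budget d/2 and leaves d/4 for the other two errors.\<close>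

lemma exists_horo_scale:
  assumes a: "2 * (cmod a)\<^sup>2 < Re a" and "0 < d"
    and cont: "continuous (at 1 within insert 1 (ball 0 1)) \<psi>"
  obtains \<rho> where "0 < \<rho>" "\<rho> \<le> 1" "2 * (cmod (a * of_real \<rho>))\<^sup>2 < Re (a * of_real \<rho>)" "cmod (a * of_real \<rho>) \<le> 1/4"
    "4 * (cmod (a * of_real \<rho>))\<^sup>2 / Re (a * of_real \<rho>) \<le> 1/2"
    "\<And>z. cmod z < 1 \<Longrightarrow> cmod (\<psi> (horo_dilation \<rho> z) - \<psi> 1) \<le> d / 8"
    "2 * (d / 8) + cmod (\<psi> 1) * (16 * (cmod (a * of_real \<rho>))\<^sup>2 / Re (a * of_real \<rho>) + 8 * cmod (a * of_real \<rho>)) \<le> d / 2"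
proof -
  have ra: "0 < Re a" using quad_map_param_less[OF a] by simp
  obtain e where e: "0 < e" "\<And>z. z \<in> insert 1 (ball 0 1) \<Longrightarrow> dist z 1 < e \<Longrightarrow> dist (\<psi> z) (\<psi> 1) < d / 8"
    using cont \<open>0 < d\<close> unfolding continuous_within_eps_delta by (meson divide_pos_pos zero_less_numeral)
  define c where "c = 16 * (cmod a)\<^sup>2 / Re a"
  have ev: "\<forall>\<^sub>F \<rho> in at_right 0. cmod (\<psi> 1) * (c * \<rho> + 8 * (cmod a * \<rho>)) < d / 4"
  proof (rule order_tendstoD(2))
    show "((\<lambda>\<rho>. cmod (\<psi> 1) * (c * \<rho> + 8 * (cmod a * \<rho>))) \<longlongrightarrow> 0) (at_right 0)"
      by (rule tendsto_eq_intros | simp)+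
  qed (use \<open>0 < d\<close> in simp)
  have ev2: "\<forall>\<^sub>F \<rho> in at_right 0. c * \<rho> < 2"
  proof (rule order_tendstoD(2))
    show "((\<lambda>\<rho>. c * \<rho>) \<longlongrightarrow> 0) (at_right 0)" by (rule tendsto_eq_intros | simp)+
  qed simp
  \<comment> \<open>The bound 1/2 together with |a| < 1/2 gives |a \<rho>| <= 1/4; the bound e/2
    compensates |1 - z| <= 2.\<close>
  have "\<forall>\<^sub>F \<rho> in at_right 0. 0 < \<rho> \<and> \<rho> < min (1/2) (e / 2)"
    using eventually_at_right_real[of 0 "min (1/2) (e/2)"] e(1) by (auto elim: eventually_mono)
  with ev ev2 have "\<forall>\<^sub>F \<rho> in at_right 0. cmod (\<psi> 1) * (c * \<rho> + 8 * (cmod a * \<rho>)) < d / 4 \<and> c * \<rho> < 2 \<and>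
      0 < \<rho> \<and> \<rho> < min (1/2) (e / 2)"
    by (auto intro: eventually_conj)
  then obtain \<rho> where \<rho>: "cmod (\<psi> 1) * (c * \<rho> + 8 * (cmod a * \<rho>)) < d / 4" "c * \<rho> < 2"
      "0 < \<rho>" "\<rho> < 1/2" "\<rho> < e / 2"
    using eventually_happens'[OF trivial_limit_at_right_real] by (auto simp: min_less_iff_conj)
  have n: "cmod (a * of_real \<rho>) = cmod a * \<rho>" using \<rho> by (simp add: norm_mult)
  have r: "Re (a * of_real \<rho>) = Re a * \<rho>" by simp
  have q: "(cmod (a * of_real \<rho>))\<^sup>2 / Re (a * of_real \<rho>) = (cmod a)\<^sup>2 / Re a * \<rho>"
    unfolding n r using \<rho> ra by (simp add: power2_eq_square)
  have q': "c * \<rho> = 16 * (cmod (a * of_real \<rho>))\<^sup>2 / Re (a * of_real \<rho>)"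
    using q by (simp add: c_def)
  show thesis
  proof (rule that[of \<rho>])
    have "2 * (cmod a)\<^sup>2 * \<rho> \<le> 2 * (cmod a)\<^sup>2 * 1" using \<rho> by (intro mult_left_mono) auto
    then have "(2 * (cmod a)\<^sup>2 * \<rho>) * \<rho> < Re a * \<rho>" using a \<rho> by (intro mult_strict_right_mono) auto
    then show "2 * (cmod (a * of_real \<rho>))\<^sup>2 < Re (a * of_real \<rho>)"
      unfolding n r by (simp add: power2_eq_square mult_ac)
    show "cmod (a * of_real \<rho>) \<le> 1/4"
      unfolding n using quad_map_param_less(1)[OF a] \<rho> mult_mono[of "cmod a" "1/2" \<rho> "1/2"] by simp
    show "4 * (cmod (a * of_real \<rho>))\<^sup>2 / Re (a * of_real \<rho>) \<le> 1/2"
      using \<rho>(2) q' by simp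
    show "2 * (d / 8) + cmod (\<psi> 1) * (16 * (cmod (a * of_real \<rho>))\<^sup>2 / Re (a * of_real \<rho>) + 8 * cmod (a * of_real \<rho>)) \<le> d / 2"
      using \<rho>(1) unfolding q'[symmetric] unfolding n by simp
    show "cmod (\<psi> (horo_dilation \<rho> z) - \<psi> 1) \<le> d / 8" if z: "cmod z < 1" for z
    proof -
      have "dist (horo_dilation \<rho> z) 1 = \<rho> * cmod (1 - z)"
        using \<rho> by (simp add: dist_norm horo_dilation_def norm_mult norm_minus_commute)
      also have "\<dots> \<le> \<rho> * 2" using \<rho> cmod_one_minus_le[OF z] by (intro mult_left_mono) auto
      finally have "dist (horo_dilation \<rho> z) 1 < e" using \<rho> by simp
      moreover have "horo_dilation \<rho> z \<in> insert 1 (ball 0 1)" using horo_dilation_disk[of \<rho> z] \<rho> z by auto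
      ultimately show ?thesis using e(2) by (force simp: dist_norm)
    qed
  qed (use \<rho> in auto)
qed

section \<open>Iterates and the lower bound on the whole disk\<close>

lemma quad_map_iterate:
  assumes a: "2 * (cmod a)\<^sup>2 < Re a"
  shows "(quad_map a ^^ n) holomorphic_on ball 0 1"
    and "cmod z < 1 \<Longrightarrow> cmod ((quad_map a ^^ n) z) < 1"
    and "cmod z < 1 \<Longrightarrow> Re (1 / (1 - z)) + n * quad_gain a \<le> Re (1 / (1 - (quad_map a ^^ n) z))"
proof -
  have *: "cmod ((quad_map a ^^ n) z) < 1 \<and> Re (1 / (1 - z)) + n * quad_gain a \<le> Re (1 / (1 - (quad_map a ^^ n) z))"
    if z: "cmod z < 1" for z n
  proof (induction n)
    case (Suc n)
    then show ?case
      using Re_halfplane_quad_map_ge[OF a, of "(quad_map a ^^ n) z"] quad_map_disk[OF a, of "(quad_map a ^^ n) z"]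
      by (simp add: algebra_simps)
  qed (use z in auto)
  then show "cmod z < 1 \<Longrightarrow> cmod ((quad_map a ^^ n) z) < 1"
    "cmod z < 1 \<Longrightarrow> Re (1 / (1 - z)) + n * quad_gain a \<le> Re (1 / (1 - (quad_map a ^^ n) z))" by auto
  show "(quad_map a ^^ n) holomorphic_on ball 0 1"
  proof (induction n)
    case (Suc n)
    have "(quad_map a \<circ> (quad_map a ^^ n)) holomorphic_on ball 0 1"
      by (rule holomorphic_on_compose[OF Suc holomorphic_quad_map])
    then show ?case by (simp add: o_def)
  qed (simp add: id_def)
qed

text \<open>The weight of the n-th power is the product of \<psi> along the orbit; only its
  holomorphy and a bound are recorded.\<close>

lemma wcomp_iterate:
  assumes \<phi>: "\<phi> holomorphic_on ball 0 1" "\<And>z. cmod z < 1 \<Longrightarrow> cmod (\<phi> z) < 1"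
    and \<psi>: "\<psi> holomorphic_on ball 0 1" "\<And>z. cmod z < 1 \<Longrightarrow> cmod (\<psi> z) \<le> K"
  shows "\<exists>\<Psi> L. \<Psi> holomorphic_on ball 0 1 \<and> (\<forall>z. cmod z < 1 \<longrightarrow> cmod (\<Psi> z) \<le> L) \<and>
     (\<forall>f z. (wcomp \<psi> \<phi> ^^ n) f z = \<Psi> z * f ((\<phi> ^^ n) z))"
proof (induction n)
  case 0
  show ?case by (rule exI[of _ "\<lambda>_. 1"], rule exI[of _ 1]) auto
next
  case (Suc n)
  then obtain \<Psi> L where \<Psi>: "\<Psi> holomorphic_on ball 0 1" "\<And>z. cmod z < 1 \<Longrightarrow> cmod (\<Psi> z) \<le> L"
    and eq: "\<And>f z. (wcomp \<psi> \<phi> ^^ n) f z = \<Psi> z * f ((\<phi> ^^ n) z)" by blast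
  have "(\<Psi> \<circ> \<phi>) holomorphic_on ball 0 1"
    by (rule holomorphic_on_compose_gen[OF \<phi>(1) \<Psi>(1)]) (use \<phi>(2) in auto)
  then have "(\<lambda>z. \<psi> z * \<Psi> (\<phi> z)) holomorphic_on ball 0 1"
    using \<psi>(1) by (auto simp: o_def intro!: holomorphic_intros)
  moreover have "cmod (\<psi> z * \<Psi> (\<phi> z)) \<le> K * L" if "cmod z < 1" for z
    unfolding norm_mult using \<psi>(2)[OF that] \<Psi>(2)[OF \<phi>(2)[OF that]]
    by (intro mult_mono) (auto intro: order_trans[OF norm_ge_zero])
  moreover have "(wcomp \<psi> \<phi> ^^ Suc n) f z = \<psi> z * \<Psi> (\<phi> z) * f ((\<phi> ^^ Suc n) z)" for f z
  proof -
    have "(\<phi> ^^ Suc n) z = (\<phi> ^^ n) (\<phi> z)" by (simp add: funpow_swap1)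
    then show ?thesis by (simp add: wcomp_def eq)
  qed
  ultimately show ?case by blast
qed

lemma wcomp_diff_cmult: "wcomp \<psi> \<phi> (\<lambda>z. f z - c * g z) = (\<lambda>z. wcomp \<psi> \<phi> f z - c * wcomp \<psi> \<phi> g z)"
  by (simp add: wcomp_def fun_eq_iff algebra_simps)

lemma wcomp_bounded:
  assumes \<phi>: "\<phi> holomorphic_on ball 0 1" "\<And>z. cmod z < 1 \<Longrightarrow> cmod (\<phi> z) < 1"
    and \<psi>: "\<psi> \<in> hinfty"
  obtains B where "0 \<le> B" "\<And>f. f \<in> hardy2 \<Longrightarrow> wcomp \<psi> \<phi> f \<in> hardy2"
    "\<And>f. f \<in> hardy2 \<Longrightarrow> h2_norm (wcomp \<psi> \<phi> f) \<le> B * h2_norm f"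
proof -
  obtain K where K: "\<psi> holomorphic_on ball 0 1" "\<And>z. cmod z < 1 \<Longrightarrow> cmod (\<psi> z) \<le> K"
    using \<psi> by (force simp: hinfty_def bounded_iff)
  have K0: "0 \<le> K" using K(2)[of 0] norm_ge_zero[of "\<psi> 0"] by (simp del: norm_ge_zero)
  let ?Q = "sqrt ((1 + cmod (\<phi> 0)) / (1 - cmod (\<phi> 0)))"
  have Q0: "0 \<le> ?Q" using \<phi>(2)[of 0] by simp
  show thesis
  proof (rule that[of "K * ?Q"])
    fix f assume f: "f \<in> hardy2"
    show "wcomp \<psi> \<phi> f \<in> hardy2" unfolding wcomp_def by (rule hardy2_mult(1)[OF K hardy2_comp[OF \<phi> f]])
    have "h2_norm (wcomp \<psi> \<phi> f) \<le> K * h2_norm (\<lambda>z. f (\<phi> z))" unfolding wcomp_def by (rule hardy2_mult(2)[OF K hardy2_comp[OF \<phi> f]])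
    also have "\<dots> \<le> K * (?Q * h2_norm f)" by (intro mult_left_mono h2_norm_comp[OF \<phi> f] K0)
    finally show "h2_norm (wcomp \<psi> \<phi> f) \<le> K * ?Q * h2_norm f" by (simp add: mult.assoc)
  qed (use K0 Q0 in simp)
qed

text \<open>The identity \<mu> T^n f = T^(n+1) f - T^n (T f - \<mu> f) trades one power of T for a
  multiple of the norm of T f - \<mu> f. Since \<mu> enters only through |\<mu>| >= l, the constant
  C is the same for all such \<mu>, as the method of continuity requires.\<close>

lemma norm_le_iterate:
  assumes T: "\<And>f. f \<in> hardy2 \<Longrightarrow> T f \<in> hardy2" "\<And>f. f \<in> hardy2 \<Longrightarrow> h2_norm (T f) \<le> B * h2_norm f"
    and lin: "\<And>f g c. T (\<lambda>z. f z - c * g z) = (\<lambda>z. T f z - c * T g z)"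
    and "0 \<le> B" "0 < l"
  shows "\<exists>C\<ge>0. \<forall>\<mu> f. l \<le> cmod \<mu> \<longrightarrow> f \<in> hardy2 \<longrightarrow>
     h2_norm f \<le> (1 / l) ^ n * h2_norm ((T ^^ n) f) + C * h2_norm (\<lambda>z. T f z - \<mu> * f z)"
proof (induction n)
  case 0
  show ?case by (rule exI[of _ 0]) auto
next
  case (Suc n)
  have iter: "(T ^^ n) f \<in> hardy2 \<and> h2_norm ((T ^^ n) f) \<le> B ^ n * h2_norm f" if "f \<in> hardy2" for f n
  proof (induction n)
    case (Suc n)
    then have "h2_norm (T ((T ^^ n) f)) \<le> B * (B ^ n * h2_norm f)"
      using T(2)[of "(T ^^ n) f"] \<open>0 \<le> B\<close> by (meson mult_left_mono order_trans)
    then show ?case using Suc T(1) by (simp add: mult.assoc)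
  qed (use that in auto)
  have itlin: "(T ^^ n) (\<lambda>z. f z - c * g z) = (\<lambda>z. (T ^^ n) f z - c * (T ^^ n) g z)" for f g c n
    by (induction n) (auto simp: lin)
  obtain C where C: "0 \<le> C" "\<And>\<mu> f. l \<le> cmod \<mu> \<Longrightarrow> f \<in> hardy2 \<Longrightarrow>
     h2_norm f \<le> (1 / l) ^ n * h2_norm ((T ^^ n) f) + C * h2_norm (\<lambda>z. T f z - \<mu> * f z)"
    using Suc by blast
  have "h2_norm f \<le> (1 / l) ^ Suc n * h2_norm ((T ^^ Suc n) f) +
      (C + (1 / l) ^ Suc n * B ^ n) * h2_norm (\<lambda>z. T f z - \<mu> * f z)"
    if \<mu>: "l \<le> cmod \<mu>" and f: "f \<in> hardy2" for \<mu> f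
  proof -
    let ?g = "\<lambda>z. T f z - \<mu> * f z"
    have g: "?g \<in> hardy2" by (intro hardy2_diff hardy2_cmult T f)
    have h: "(T ^^ n) f \<in> hardy2" "(T ^^ Suc n) f \<in> hardy2" using iter[OF f] T(1) by auto
    have "(T ^^ n) ?g = (\<lambda>z. (T ^^ Suc n) f z - \<mu> * (T ^^ n) f z)"
      unfolding itlin by (simp add: funpow_swap1)
    then have eq: "(\<lambda>z. \<mu> * (T ^^ n) f z) = (\<lambda>z. (T ^^ Suc n) f z - (T ^^ n) ?g z)" by (simp add: fun_eq_iff)
    have "l * h2_norm ((T ^^ n) f) \<le> cmod \<mu> * h2_norm ((T ^^ n) f)"
      using \<mu> h2_norm_nonneg[OF h(1)] by (rule mult_right_mono)
    also have "\<dots> = h2_norm (\<lambda>z. (T ^^ Suc n) f z - (T ^^ n) ?g z)"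
      unfolding h2_norm_cmult[OF h(1), symmetric] eq ..
    also have "\<dots> \<le> h2_norm ((T ^^ Suc n) f) + h2_norm ((T ^^ n) ?g)"
      using h(2) iter[OF g] by (intro h2_norm_triangle_diff) auto
    also have "\<dots> \<le> h2_norm ((T ^^ Suc n) f) + B ^ n * h2_norm ?g" using iter[OF g] by simp
    finally have "h2_norm ((T ^^ n) f) \<le> 1 / l * (h2_norm ((T ^^ Suc n) f) + B ^ n * h2_norm ?g)"
      using \<open>0 < l\<close> by (simp add: field_simps)
    then have "(1 / l) ^ n * h2_norm ((T ^^ n) f) \<le> (1 / l) ^ n * (1 / l * (h2_norm ((T ^^ Suc n) f) + B ^ n * h2_norm ?g))"
      using \<open>0 < l\<close> by (intro mult_left_mono) auto
    with C(2)[OF \<mu> f] show ?thesis by (simp add: algebra_simps)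
  qed
  then show ?case using C(1) \<open>0 \<le> B\<close> \<open>0 < l\<close> by (intro exI[of _ "C + (1 / l) ^ Suc n * B ^ n"]) auto
qed

text \<open>The lower bound on the horodisk transfers to the disk, because the \<open>n\<close>-th power of the
  operator only sees the values of a function on \<open>\<phi>\<^sup>n(D)\<close>, which lies in the horodisk.\<close>

lemma wcomp_quad_lower_bound:
  assumes a: "2 * (cmod a)\<^sup>2 < Re a" and \<psi>: "\<psi> \<in> hinfty"
    and cont: "continuous (at 1 within insert 1 (ball 0 1)) \<psi>" and "0 < d" "0 < l"
  shows "\<exists>C>0. \<forall>\<mu>. \<forall>f\<in>hardy2. l \<le> cmod \<mu> \<longrightarrow> (\<forall>s::real. 0 \<le> s \<longrightarrow> d \<le> cmod (\<psi> 1 * exp (- a * of_real s) - \<mu>)) \<longrightarrow>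
     h2_norm f \<le> C * h2_norm (\<lambda>z. wcomp \<psi> (quad_map a) f z - \<mu> * f z)"
proof -
  let ?W = "wcomp \<psi> (quad_map a)"
  have \<phi>: "quad_map a holomorphic_on ball 0 1" "\<And>z. cmod z < 1 \<Longrightarrow> cmod (quad_map a z) < 1"
    by (auto intro: holomorphic_quad_map quad_map_disk a)
  obtain K where K: "\<psi> holomorphic_on ball 0 1" "\<And>z. cmod z < 1 \<Longrightarrow> cmod (\<psi> z) \<le> K"
    using \<psi> by (force simp: hinfty_def bounded_iff)
  obtain B where B: "0 \<le> B" "\<And>f. f \<in> hardy2 \<Longrightarrow> ?W f \<in> hardy2"
    "\<And>f. f \<in> hardy2 \<Longrightarrow> h2_norm (?W f) \<le> B * h2_norm f"
    using wcomp_bounded[OF \<phi> \<psi>] by blast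
  obtain \<rho> where \<rho>: "0 < \<rho>" "\<rho> \<le> 1" "2 * (cmod (a * of_real \<rho>))\<^sup>2 < Re (a * of_real \<rho>)" "cmod (a * of_real \<rho>) \<le> 1/4"
    "4 * (cmod (a * of_real \<rho>))\<^sup>2 / Re (a * of_real \<rho>) \<le> 1/2"
    "\<And>z. cmod z < 1 \<Longrightarrow> cmod (\<psi> (horo_dilation \<rho> z) - \<psi> 1) \<le> d / 8"
    "2 * (d / 8) + cmod (\<psi> 1) * (16 * (cmod (a * of_real \<rho>))\<^sup>2 / Re (a * of_real \<rho>) + 8 * cmod (a * of_real \<rho>)) \<le> d / 2"
    using exists_horo_scale[OF a \<open>0 < d\<close> cont] by blast
  have \<kappa>: "horo_dilation \<rho> holomorphic_on ball 0 1" "\<And>z. cmod z < 1 \<Longrightarrow> cmod (horo_dilation \<rho> z) < 1"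
    by (auto intro: holomorphic_horo_dilation horo_dilation_disk \<rho>)
  \<comment> \<open>The image of the disk under \<open>horo_dilation \<rho>\<close> is the horodisk
    Re u > 1 / (2 \<rho>); after n steps every orbit lies inside it.\<close>
  obtain n :: nat where n: "1 / (2 * \<rho>) < n * quad_gain a"
    using reals_Archimedean3[OF quad_gain_pos[OF a]] by blast
  \<comment> \<open>The n-th iterate followed by the inverse of the dilation. It is a self-map of
    the disk, so composition with it is bounded and carries the norm on the horodisk to the norm of
    the n-th power.\<close>
  define \<eta> where "\<eta> z = 1 - (1 - (quad_map a ^^ n) z) / of_real \<rho>" for z
  have h\<eta>: "\<eta> holomorphic_on ball 0 1"
    unfolding \<eta>_def using \<rho>(1) by (intro holomorphic_intros quad_map_iterate(1)[OF a]) auto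
  have \<eta>1: "cmod (\<eta> z) < 1" if z: "cmod z < 1" for z
  proof -
    have "1 / (1 - \<eta> z) = of_real \<rho> * (1 / (1 - (quad_map a ^^ n) z))" by (simp add: \<eta>_def)
    then have "Re (1 / (1 - \<eta> z)) = \<rho> * Re (1 / (1 - (quad_map a ^^ n) z))"
      by (simp only: Re_complex_of_real times_complex.sel Im_complex_of_real)
    moreover have "1 / (2 * \<rho>) < Re (1 / (1 - (quad_map a ^^ n) z))"
      using quad_map_iterate(3)[OF a z, of n] n z by (simp add: disk_iff_halfplane)
    then have "\<rho> * (1 / (2 * \<rho>)) < \<rho> * Re (1 / (1 - (quad_map a ^^ n) z))"
      using \<rho>(1) by (rule mult_strict_left_mono)
    ultimately show ?thesis using \<rho>(1) by (simp add: disk_iff_halfplane)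
  qed
  have \<kappa>\<eta>: "horo_dilation \<rho> (\<eta> z) = (quad_map a ^^ n) z" for z
    using \<rho>(1) by (simp add: horo_dilation_def \<eta>_def)
  obtain \<Psi> L where \<Psi>: "\<Psi> holomorphic_on ball 0 1" "\<And>z. cmod z < 1 \<Longrightarrow> cmod (\<Psi> z) \<le> L"
    and Wn: "\<And>f z. (?W ^^ n) f z = \<Psi> z * f ((quad_map a ^^ n) z)"
    using wcomp_iterate[OF \<phi> K, of n] by blast
  obtain C where C: "0 \<le> C" "\<And>\<mu> f. l \<le> cmod \<mu> \<Longrightarrow> f \<in> hardy2 \<Longrightarrow>
     h2_norm f \<le> (1 / l) ^ n * h2_norm ((?W ^^ n) f) + C * h2_norm (\<lambda>z. ?W f z - \<mu> * f z)"
    using norm_le_iterate[of ?W B l n] B \<open>0 < l\<close> wcomp_diff_cmult by blast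
  define Q1 where "Q1 = sqrt ((1 + cmod (\<eta> 0)) / (1 - cmod (\<eta> 0)))"
  define Q2 where "Q2 = sqrt ((1 + cmod (horo_dilation \<rho> 0)) / (1 - cmod (horo_dilation \<rho> 0)))"
  have Q: "0 \<le> Q1" "0 \<le> Q2" using \<eta>1[of 0] \<kappa>(2)[of 0] by (auto simp: Q1_def Q2_def)
  have L: "0 \<le> L" using \<Psi>(2)[of 0] norm_ge_zero[of "\<Psi> 0"] by (simp del: norm_ge_zero)
  let ?C = "(1 / l) ^ n * (L * (Q1 * (2 / d * Q2))) + C + 1"
  have main: "h2_norm f \<le> ?C * h2_norm (\<lambda>z. ?W f z - \<mu> * f z)"
    if f: "f \<in> hardy2" and \<mu>: "l \<le> cmod \<mu>"
      and dd: "\<And>s::real. 0 \<le> s \<Longrightarrow> d \<le> cmod (\<psi> 1 * exp (- a * of_real s) - \<mu>)" for \<mu> f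
  proof -
    let ?g = "\<lambda>z. ?W f z - \<mu> * f z"
    have g: "?g \<in> hardy2" by (intro hardy2_diff hardy2_cmult B f)
    let ?f\<kappa> = "\<lambda>z. f (horo_dilation \<rho> z)"
    have f\<kappa>: "?f\<kappa> \<in> hardy2" by (rule hardy2_comp[OF \<kappa> f])
    have "(\<psi> \<circ> horo_dilation \<rho>) holomorphic_on ball 0 1"
      by (rule holomorphic_on_compose_gen[OF \<kappa>(1) K(1)]) (use \<kappa>(2) in auto)
    then have h\<psi>: "(\<lambda>z. \<psi> (horo_dilation \<rho> z)) holomorphic_on ball 0 1" by (simp add: o_def)
    \<comment> \<open>Replacing a by a \<rho> only reparametrises the spiral, so the distance d
      stays the same at every scale.\<close>
    have dd': "d \<le> cmod (\<psi> 1 * exp (- (a * of_real \<rho>) * of_real s) - \<mu>)" if "0 \<le> s" for s :: real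
      using dd[of "\<rho> * s"] that \<rho>(1) by (simp add: mult.assoc)
    have "d / 2 * h2_norm ?f\<kappa> \<le>
        h2_norm (\<lambda>z. \<psi> (horo_dilation \<rho> z) * ?f\<kappa> (quad_map (a * of_real \<rho>) z) - \<mu> * ?f\<kappa> z)"
      by (rule quad_weighted_near_lower_bound[OF \<rho>(3,4,5) h\<psi> \<rho>(6,7) less_imp_le[OF \<open>0 < d\<close>] dd' f\<kappa>])
    also have "\<dots> = h2_norm (\<lambda>z. ?g (horo_dilation \<rho> z))"
      by (simp add: wcomp_def quad_map_horo_dilation)
    also have "\<dots> \<le> Q2 * h2_norm ?g" unfolding Q2_def by (rule h2_norm_comp[OF \<kappa> g])
    finally have 1: "h2_norm ?f\<kappa> \<le> 2 / d * Q2 * h2_norm ?g" using \<open>0 < d\<close> by (simp add: field_simps)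
    have "h2_norm ((?W ^^ n) f) = h2_norm (\<lambda>z. \<Psi> z * ?f\<kappa> (\<eta> z))"
    proof -
      have "(?W ^^ n) f = (\<lambda>z. \<Psi> z * ?f\<kappa> (\<eta> z))" by (simp add: fun_eq_iff Wn \<kappa>\<eta>)
      then show ?thesis by simp
    qed
    also have "\<dots> \<le> L * h2_norm (\<lambda>z. ?f\<kappa> (\<eta> z))"
      by (rule hardy2_mult(2)[OF \<Psi> hardy2_comp[OF h\<eta> \<eta>1 f\<kappa>]])
    also have "\<dots> \<le> L * (Q1 * h2_norm ?f\<kappa>)"
      unfolding Q1_def by (intro mult_left_mono h2_norm_comp[OF h\<eta> \<eta>1 f\<kappa>] L)
    also have "\<dots> \<le> L * (Q1 * (2 / d * Q2 * h2_norm ?g))"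
      by (intro mult_left_mono 1 L Q)
    finally have "(1 / l) ^ n * h2_norm ((?W ^^ n) f) \<le> (1 / l) ^ n * (L * (Q1 * (2 / d * Q2 * h2_norm ?g)))"
      using \<open>0 < l\<close> by (intro mult_left_mono) auto
    with C(2)[OF \<mu> f] h2_norm_nonneg[OF g] show ?thesis by (simp add: algebra_simps)
  qed
  have "0 \<le> (1 / l) ^ n * (L * (Q1 * (2 / d * Q2)))" using L Q \<open>0 < l\<close> \<open>0 < d\<close> by auto
  then have "0 < ?C" using C(1) by linarith
  with main show ?thesis by blast
qed

section \<open>Bounded operators on the Hardy space\<close>

lemma eq_on_disk_if_norm_diff_le_0:
  assumes "f \<in> hardy2" "g \<in> hardy2" "h2_norm (\<lambda>z. f z - g z) \<le> 0"
  shows "eq_on_disk f g"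
  unfolding eq_on_disk_def
proof
  fix z :: complex assume "z \<in> ball 0 1"
  then have z: "cmod z < 1" by simp
  then have "0 < sqrt (1 - (cmod z)\<^sup>2)" by (simp add: abs_square_less_1)
  moreover have "cmod (f z - g z) * sqrt (1 - (cmod z)\<^sup>2) \<le> 0"
    using hardy2_eval_bound[OF hardy2_diff[OF assms(1,2)] z] assms(3) by linarith
  ultimately show "f z = g z" by (simp add: mult_le_0_iff)
qed

text \<open>The evaluation bound makes the sequence converge locally uniformly, so the limit is
  holomorphic; the limit is then taken in the circle means, which transfers the rate e to the norm
  distance.\<close>

lemma hardy2_complete:
  assumes x: "\<And>n. x n \<in> hardy2" and e: "e \<longlonglongrightarrow> 0"
    and cauchy: "\<And>n m. n \<le> m \<Longrightarrow> h2_norm (\<lambda>z. x n z - x m z) \<le> e n"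
  obtains F where "F \<in> hardy2" "\<And>n. h2_norm (\<lambda>z. x n z - F z) \<le> e n"
proof -
  have e0: "0 \<le> e n" for n
    using cauchy[of n n] by simp
  have ptw: "cmod (x n z - x m z) \<le> e n / sqrt (1 - r\<^sup>2)" if "n \<le> m" "cmod z \<le> r" "r < 1" for n m z r
  proof -
    have r: "0 \<le> r" using that(2) norm_ge_zero[of z] by linarith
    then have r2: "r\<^sup>2 < 1" using that(3) by (simp add: abs_square_less_1)
    have "(cmod z)\<^sup>2 \<le> r\<^sup>2" using that by (simp add: power_mono)
    then have "sqrt (1 - r\<^sup>2) \<le> sqrt (1 - (cmod z)\<^sup>2)" by simp
    then have "cmod (x n z - x m z) * sqrt (1 - r\<^sup>2) \<le> cmod (x n z - x m z) * sqrt (1 - (cmod z)\<^sup>2)"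
      by (intro mult_left_mono) auto
    also have "\<dots> \<le> e n"
      using hardy2_eval_bound[OF hardy2_diff[OF x[of n] x[of m]], of z] cauchy[OF that(1)] that by simp
    finally show ?thesis using r2 by (simp add: pos_le_divide_eq)
  qed
  have conv: "\<exists>l. (\<lambda>n. x n z) \<longlonglongrightarrow> l" if z: "cmod z < 1" for z
  proof -
    have lim: "(\<lambda>n. e n / sqrt (1 - (cmod z)\<^sup>2)) \<longlonglongrightarrow> 0"
      using tendsto_mult[OF e tendsto_const[of "inverse (sqrt (1 - (cmod z)\<^sup>2))"]] by (simp add: divide_inverse)
    have "Cauchy (\<lambda>n. x n z)"
    proof (rule CauchyI')
      fix \<epsilon> :: real assume "0 < \<epsilon>"
      from order_tendstoD(2)[OF lim this] obtain M where M: "\<And>n. M \<le> n \<Longrightarrow> e n / sqrt (1 - (cmod z)\<^sup>2) < \<epsilon>"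
        by (auto simp: eventually_sequentially)
      have "dist (x m z) (x n z) < \<epsilon>" if "M \<le> m" "m < n" for m n
        using ptw[OF less_imp_le[OF that(2)] order_refl z] M[OF that(1)] by (simp add: dist_norm)
      then show "\<exists>M. \<forall>m\<ge>M. \<forall>n>m. dist (x m z) (x n z) < \<epsilon>" by blast
    qed
    then show ?thesis by (simp add: Cauchy_convergent_iff convergent_def)
  qed
  define F where "F z = lim (\<lambda>n. x n z)" for z
  have F: "(\<lambda>n. x n z) \<longlonglongrightarrow> F z" if "cmod z < 1" for z
    using conv[OF that] unfolding F_def by (metis limI)
  have unif: "cmod (x n z - F z) \<le> e n / sqrt (1 - r\<^sup>2)" if "cmod z \<le> r" "r < 1" for n z r
  proof (rule Lim_bounded[OF tendsto_norm[OF tendsto_diff[OF tendsto_const F]]])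
    show "cmod z < 1" using that by simp
    show "\<forall>m\<ge>n. cmod (x n z - x m z) \<le> e n / sqrt (1 - r\<^sup>2)" using ptw that by blast
  qed
  have hF: "F holomorphic_on ball 0 1"
  proof (rule holomorphic_uniform_sequence)
    show "x n holomorphic_on ball 0 1" for n by (rule hardy2_holomorphic[OF x])
    fix z :: complex assume "z \<in> ball 0 1"
    then obtain d where d: "0 < d" "cball z d \<subseteq> ball 0 1"
      using open_contains_cball[of "ball (0::complex) 1"] by blast
    define r where "r = cmod z + d"
    have "cball z d \<subseteq> ball 0 1 \<longleftrightarrow> cmod z + d < 1 \<or> d < 0"
      using cball_subset_ball_iff[of z d 0 1] by (simp add: dist_norm)
    with d have r: "r < 1" by (auto simp: r_def)
    have "uniform_limit (cball z d) x F sequentially"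
    proof (rule uniform_limitI)
      fix \<epsilon> :: real assume "0 < \<epsilon>"
      have "(\<lambda>n. e n / sqrt (1 - r\<^sup>2)) \<longlonglongrightarrow> 0"
        using tendsto_mult[OF e tendsto_const[of "inverse (sqrt (1 - r\<^sup>2))"]] by (simp add: divide_inverse)
      from order_tendstoD(2)[OF this \<open>0 < \<epsilon>\<close>]
      show "\<forall>\<^sub>F n in sequentially. \<forall>w\<in>cball z d. dist (x n w) (F w) < \<epsilon>"
      proof eventually_elim
        case (elim n)
        have "cmod w \<le> r" if "w \<in> cball z d" for w
          using that norm_triangle_ineq[of z "w - z"] by (simp add: r_def dist_norm norm_minus_commute)
        then have "dist (x n w) (F w) \<le> e n / sqrt (1 - r\<^sup>2)" if "w \<in> cball z d" for w
          using unif[OF _ r, of w n] that by (simp add: dist_norm)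
        with elim show ?case by (meson order_le_less_trans)
      qed
    qed
    with d show "\<exists>d>0. cball z d \<subseteq> ball 0 1 \<and> uniform_limit (cball z d) x F sequentially" by blast
  qed simp
  have hd: "(\<lambda>z. x n z - F z) holomorphic_on ball 0 1" for n
    by (intro holomorphic_intros hF hardy2_holomorphic[OF x])
  have mean: "h2_mean r (\<lambda>z. x n z - F z) \<le> (e n)\<^sup>2" if r: "0 \<le> r" "r < 1" for n r
  proof -
    let ?c = "e n / sqrt (1 - r\<^sup>2)"
    have in1: "cmod (rcis r (2 * pi * t)) \<le> r" for t using r by simp
    have "(\<lambda>m. h2_mean r (\<lambda>z. x n z - x (m + n) z)) \<longlonglongrightarrow> h2_mean r (\<lambda>z. x n z - F z)"
      unfolding h2_mean_def
    proof (rule dominated_convergence(2)[where h = "\<lambda>_. ?c\<^sup>2"])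
      show "(\<lambda>t. (cmod (x n (rcis r (2 * pi * t)) - x (m + n) (rcis r (2 * pi * t))))\<^sup>2) integrable_on {0..1}" for m
        by (intro integrable_continuous_real continuous_intros continuous_on_circle hardy2_holomorphic x) (use r in auto)
      show "norm ((cmod (x n (rcis r (2 * pi * t)) - x (m + n) (rcis r (2 * pi * t))))\<^sup>2) \<le> ?c\<^sup>2" for m t
        using power_mono[OF ptw[OF _ in1 r(2), of n "m + n" t], of 2] by simp
      show "(\<lambda>m. (cmod (x n (rcis r (2 * pi * t)) - x (m + n) (rcis r (2 * pi * t))))\<^sup>2)
          \<longlonglongrightarrow> (cmod (x n (rcis r (2 * pi * t)) - F (rcis r (2 * pi * t))))\<^sup>2" for t
        by (intro tendsto_intros LIMSEQ_ignore_initial_segment F) (use r in auto)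
    qed (auto intro: integrable_const_ivl)
    moreover have "h2_mean r (\<lambda>z. x n z - x (m + n) z) \<le> (e n)\<^sup>2" for m
    proof -
      have "h2_mean r (\<lambda>z. x n z - x (m + n) z) \<le> (h2_norm (\<lambda>z. x n z - x (m + n) z))\<^sup>2"
        by (intro h2_mean_le hardy2_diff x r)
      also have "\<dots> \<le> (e n)\<^sup>2"
        by (intro power_mono cauchy h2_norm_nonneg hardy2_diff x) simp
      finally show ?thesis .
    qed
    ultimately show ?thesis by (intro LIMSEQ_le_const2) auto
  qed
  have xF: "(\<lambda>z. x n z - F z) \<in> hardy2" "h2_norm (\<lambda>z. x n z - F z) \<le> e n" for n
    using hardy2I_mean[OF hd e0 mean] by auto
  have "(\<lambda>z. x 0 z - (x 0 z - F z)) \<in> hardy2" by (intro hardy2_diff x xF)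
  then have "F \<in> hardy2" by simp
  with xF(2) that show thesis by blast
qed

text \<open>Banach's fixed point theorem. The fixed point equation holds only on the disk because
  vectors are represented by functions on the whole plane.\<close>

lemma hardy2_contraction_fixpoint:
  assumes \<Phi>: "\<And>f. f \<in> hardy2 \<Longrightarrow> \<Phi> f \<in> hardy2" and q: "0 \<le> q" "q < 1"
    and contr: "\<And>f g. f \<in> hardy2 \<Longrightarrow> g \<in> hardy2 \<Longrightarrow>
       h2_norm (\<lambda>z. \<Phi> f z - \<Phi> g z) \<le> q * h2_norm (\<lambda>z. f z - g z)"
  obtains f where "f \<in> hardy2" "eq_on_disk (\<Phi> f) f"
proof -
  define x where "x n = (\<Phi> ^^ n) (\<lambda>_. 0)" for n
  have xS: "x (Suc n) = \<Phi> (x n)" for n by (simp add: x_def)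
  have x: "x n \<in> hardy2" for n
    by (induction n) (auto simp: xS \<Phi> x_def hardy2_const)
  define B where "B = h2_norm (\<lambda>z. x 0 z - x 1 z)"
  have B: "0 \<le> B" unfolding B_def by (intro h2_norm_nonneg hardy2_diff x)
  have step: "h2_norm (\<lambda>z. x n z - x (Suc n) z) \<le> q ^ n * B" for n
  proof (induction n)
    case (Suc n)
    have "h2_norm (\<lambda>z. x (Suc n) z - x (Suc (Suc n)) z) \<le> q * h2_norm (\<lambda>z. x n z - x (Suc n) z)"
      using contr[OF x[of n] x[of "Suc n"]] by (simp only: xS[symmetric])
    also have "\<dots> \<le> q * (q ^ n * B)" using Suc q(1) by (rule mult_left_mono)
    finally show ?case by (simp add: mult.assoc)
  qed (simp add: B_def)
  \<comment> \<open>The tail from n on of the geometric series that bounds the successive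
    distances.\<close>
  define e where "e n = q ^ n * (B / (1 - q))" for n
  have eS: "q ^ n * B + e (Suc n) = e n" for n
    using q by (simp add: e_def field_simps)
  have cauchy: "h2_norm (\<lambda>z. x n z - x (n + k) z) \<le> e n" for n k
  proof (induction k arbitrary: n)
    case 0
    then show ?case using q B by (simp add: e_def)
  next
    case (Suc k)
    have "h2_norm (\<lambda>z. (x n z - x (Suc n) z) + (x (Suc n) z - x (Suc n + k) z)) \<le>
        h2_norm (\<lambda>z. x n z - x (Suc n) z) + h2_norm (\<lambda>z. x (Suc n) z - x (Suc n + k) z)"
      by (intro h2_norm_triangle hardy2_diff x)
    also have "\<dots> \<le> q ^ n * B + e (Suc n)" by (intro add_mono step Suc)
    finally show ?case by (simp add: eS)
  qed
  have e: "e \<longlonglongrightarrow> 0"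
    using tendsto_mult[OF LIMSEQ_power_zero[of q] tendsto_const[of "B / (1 - q)"]] q by (simp add: e_def[abs_def])
  have cauchy': "h2_norm (\<lambda>z. x n z - x m z) \<le> e n" if "n \<le> m" for n m
    using cauchy[of n "m - n"] that by simp
  obtain F where F: "F \<in> hardy2" "\<And>n. h2_norm (\<lambda>z. x n z - F z) \<le> e n"
    using hardy2_complete[OF x e cauchy'] by blast
  have "h2_norm (\<lambda>z. \<Phi> F z - F z) \<le> q * e n + e (Suc n)" for n
  proof -
    have "h2_norm (\<lambda>z. (\<Phi> F z - \<Phi> (x n) z) + (x (Suc n) z - F z)) \<le>
        h2_norm (\<lambda>z. \<Phi> F z - \<Phi> (x n) z) + h2_norm (\<lambda>z. x (Suc n) z - F z)"
      by (intro h2_norm_triangle hardy2_diff x \<Phi> F)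
    also have "h2_norm (\<lambda>z. \<Phi> F z - \<Phi> (x n) z) \<le> q * h2_norm (\<lambda>z. F z - x n z)"
      by (rule contr[OF F(1) x])
    also have "h2_norm (\<lambda>z. F z - x n z) = h2_norm (\<lambda>z. x n z - F z)"
      by (rule h2_norm_minus_commute[OF F(1) x])
    also have "q * \<dots> \<le> q * e n" using F(2) q(1) by (rule mult_left_mono)
    also have "h2_norm (\<lambda>z. x (Suc n) z - F z) \<le> e (Suc n)" by (rule F(2))
    finally show ?thesis by (simp add: xS)
  qed
  moreover have "(\<lambda>n. q * e n + e (Suc n)) \<longlonglongrightarrow> q * 0 + 0"
    by (intro tendsto_intros e LIMSEQ_Suc)
  ultimately have "h2_norm (\<lambda>z. \<Phi> F z - F z) \<le> 0"
    by (intro LIMSEQ_le_const[where X = "\<lambda>n. q * e n + e (Suc n)"]) auto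
  then have "eq_on_disk (\<Phi> F) F" by (intro eq_on_disk_if_norm_diff_le_0 \<Phi> F)
  with F(1) that show thesis by blast
qed

text \<open>Invertibility is split into surjectivity and a lower bound because they have different
  sources: the lower bound is an estimate at each parameter, while surjectivity is transported
  between parameters.\<close>

definition h2_surj :: "((complex \<Rightarrow> complex) \<Rightarrow> (complex \<Rightarrow> complex)) \<Rightarrow> complex \<Rightarrow> bool" where
  "h2_surj T \<mu> \<longleftrightarrow> (\<forall>g\<in>hardy2. \<exists>f\<in>hardy2. eq_on_disk (\<lambda>z. T f z - \<mu> * f z) g)"

definition h2_lower_bound :: "((complex \<Rightarrow> complex) \<Rightarrow> (complex \<Rightarrow> complex)) \<Rightarrow> complex \<Rightarrow> real \<Rightarrow> bool" where
  "h2_lower_bound T \<mu> C \<longleftrightarrow> (\<forall>f\<in>hardy2. h2_norm f \<le> C * h2_norm (\<lambda>z. T f z - \<mu> * f z))"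

text \<open>Linearity is one identity for f - c g, stated between functions and not merely on the
  disk; weighted composition satisfies it by computation.\<close>

locale hardy2_operator =
  fixes T :: "(complex \<Rightarrow> complex) \<Rightarrow> (complex \<Rightarrow> complex)" and B :: real
  assumes T: "f \<in> hardy2 \<Longrightarrow> T f \<in> hardy2"
    and bounded: "f \<in> hardy2 \<Longrightarrow> h2_norm (T f) \<le> B * h2_norm f"
    and diff: "T (\<lambda>z. f z - c * g z) = (\<lambda>z. T f z - c * T g z)"
begin

lemma diff1: "T (\<lambda>z. f z - g z) = (\<lambda>z. T f z - T g z)"
  using diff[of f 1 g] by simp

lemma shift_hardy2: "f \<in> hardy2 \<Longrightarrow> (\<lambda>z. T f z - \<mu> * f z) \<in> hardy2"
  by (intro hardy2_diff hardy2_cmult T)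

lemma shift_diff: "(\<lambda>z. (T f z - \<mu> * f z) - (T g z - \<mu> * g z)) = (\<lambda>z. T (\<lambda>z. f z - g z) z - \<mu> * (f z - g z))"
  by (simp add: diff1 fun_eq_iff algebra_simps)

lemma lower_bound_diff:
  assumes "h2_lower_bound T \<mu> C" "f \<in> hardy2" "g \<in> hardy2"
  shows "h2_norm (\<lambda>z. f z - g z) \<le> C * h2_norm (\<lambda>z. (T f z - \<mu> * f z) - (T g z - \<mu> * g z))"
  using assms(1) hardy2_diff[OF assms(2,3)] unfolding h2_lower_bound_def shift_diff by blast

text \<open>The Neumann series as a fixed point: f = (T f - g) / \<mu> contracts with factor B /
  |\<mu>|.\<close>

lemma surj_large:
  assumes "0 \<le> B" "B < cmod \<mu>"
  shows "h2_surj T \<mu>"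
  unfolding h2_surj_def
proof
  fix g assume g: "g \<in> hardy2"
  have \<mu>: "\<mu> \<noteq> 0" using assms by auto
  let ?\<Phi> = "\<lambda>f z. inverse \<mu> * (T f z - g z)"
  have \<Phi>: "?\<Phi> f \<in> hardy2" if "f \<in> hardy2" for f
    by (intro hardy2_cmult hardy2_diff T g that)
  have contr: "h2_norm (\<lambda>z. ?\<Phi> f z - ?\<Phi> h z) \<le> B / cmod \<mu> * h2_norm (\<lambda>z. f z - h z)"
    if "f \<in> hardy2" "h \<in> hardy2" for f h
  proof -
    have d: "(\<lambda>z. f z - h z) \<in> hardy2" by (intro hardy2_diff that)
    have "(\<lambda>z. ?\<Phi> f z - ?\<Phi> h z) = (\<lambda>z. inverse \<mu> * T (\<lambda>z. f z - h z) z)"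
      by (simp add: diff1 fun_eq_iff algebra_simps)
    then have "h2_norm (\<lambda>z. ?\<Phi> f z - ?\<Phi> h z) = cmod (inverse \<mu>) * h2_norm (T (\<lambda>z. f z - h z))"
      by (simp add: h2_norm_cmult T d)
    also have "\<dots> \<le> cmod (inverse \<mu>) * (B * h2_norm (\<lambda>z. f z - h z))"
      by (intro mult_left_mono bounded d) auto
    finally show ?thesis by (simp add: norm_inverse norm_divide field_simps)
  qed
  have q: "0 \<le> B / cmod \<mu>" "B / cmod \<mu> < 1" using assms \<mu> by (auto simp: divide_less_eq)
  from hardy2_contraction_fixpoint[of ?\<Phi>, OF \<Phi> q contr]
  obtain f where f: "f \<in> hardy2" "eq_on_disk (?\<Phi> f) f" by blast
  have "T f z - \<mu> * f z = g z" if "z \<in> ball 0 1" for z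
  proof -
    have "f z = inverse \<mu> * (T f z - g z)" using f(2) that by (simp add: eq_on_disk_def)
    then have "\<mu> * f z = T f z - g z" using \<mu> by simp
    then show ?thesis by simp
  qed
  then have "eq_on_disk (\<lambda>z. T f z - \<mu> * f z) g" by (simp add: eq_on_disk_def)
  with f(1) show "\<exists>f\<in>hardy2. eq_on_disk (\<lambda>z. T f z - \<mu> * f z) g" by blast
qed

text \<open>With S a choice of preimages under T - \<mu>, the equation T f - \<nu> f = g becomes f =
  S (g + (\<nu> - \<mu>) f). The lower bound makes S Lipschitz with constant C, so the right-hand
  side contracts when C |\<nu> - \<mu>| < 1.\<close>

lemma surj_step:
  assumes surj: "h2_surj T \<mu>" and low: "h2_lower_bound T \<mu> C" and "0 \<le> C" "C * cmod (\<nu> - \<mu>) < 1"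
  shows "h2_surj T \<nu>"
  unfolding h2_surj_def
proof
  fix g assume g: "g \<in> hardy2"
  obtain S where S: "\<And>h. h \<in> hardy2 \<Longrightarrow> S h \<in> hardy2" "\<And>h. h \<in> hardy2 \<Longrightarrow> eq_on_disk (\<lambda>z. T (S h) z - \<mu> * S h z) h"
    using surj unfolding h2_surj_def by metis
  let ?R = "\<lambda>f z. g z + (\<nu> - \<mu>) * f z"
  let ?\<Phi> = "\<lambda>f. S (?R f)"
  have R: "?R f \<in> hardy2" if "f \<in> hardy2" for f
    by (intro hardy2_add hardy2_cmult g that)
  have SR: "T (?\<Phi> f) z = ?R f z + \<mu> * ?\<Phi> f z" if "f \<in> hardy2" "z \<in> ball 0 1" for f z
  proof -
    have "T (?\<Phi> f) z - \<mu> * ?\<Phi> f z = ?R f z"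
      using S(2)[OF R[OF that(1)]] that(2) unfolding eq_on_disk_def by blast
    then show ?thesis by (rule iffD1[OF diff_eq_eq])
  qed
  have contr: "h2_norm (\<lambda>z. ?\<Phi> f z - ?\<Phi> h z) \<le> C * cmod (\<nu> - \<mu>) * h2_norm (\<lambda>z. f z - h z)"
    if fh: "f \<in> hardy2" "h \<in> hardy2" for f h
  proof -
    let ?f = "?\<Phi> f" and ?h = "?\<Phi> h"
    have "eq_on_disk (\<lambda>z. (T ?f z - \<mu> * ?f z) - (T ?h z - \<mu> * ?h z)) (\<lambda>z. (\<nu> - \<mu>) * (f z - h z))"
      unfolding eq_on_disk_def
    proof
      fix z :: complex assume z: "z \<in> ball 0 1"
      have "((x + c * u) + m * p - m * p) - ((x + c * v) + m * q - m * q) = c * (u - v)" for m p q x c u v :: complex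
        by (simp add: right_diff_distrib)
      then show "(T ?f z - \<mu> * ?f z) - (T ?h z - \<mu> * ?h z) = (\<nu> - \<mu>) * (f z - h z)"
        unfolding SR[OF fh(1) z] SR[OF fh(2) z] .
    qed
    then have "h2_norm (\<lambda>z. (T ?f z - \<mu> * ?f z) - (T ?h z - \<mu> * ?h z)) = h2_norm (\<lambda>z. (\<nu> - \<mu>) * (f z - h z))"
      by (rule h2_norm_eq_on_disk)
    also have "\<dots> = cmod (\<nu> - \<mu>) * h2_norm (\<lambda>z. f z - h z)"
      by (rule h2_norm_cmult[OF hardy2_diff[OF fh]])
    finally show ?thesis
      using lower_bound_diff[OF low S(1)[OF R[OF fh(1)]] S(1)[OF R[OF fh(2)]]] by (simp only: mult.assoc)
  qed
  have \<Phi>: "?\<Phi> f \<in> hardy2" if "f \<in> hardy2" for f by (rule S(1)[OF R[OF that]])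
  have "0 \<le> C * cmod (\<nu> - \<mu>)" using \<open>0 \<le> C\<close> by simp
  from hardy2_contraction_fixpoint[of ?\<Phi>, OF \<Phi> this assms(4) contr]
  obtain f where f: "f \<in> hardy2" "eq_on_disk (?\<Phi> f) f" by blast
  \<comment> \<open>Taking \<open>?\<Phi> f\<close> as the solution, rather than f, lets the
    defining property of S apply directly and avoids comparing values of T on two functions that
    agree only on the disk.\<close>
  have "eq_on_disk (\<lambda>z. T (?\<Phi> f) z - \<nu> * ?\<Phi> f z) g"
    unfolding eq_on_disk_def
  proof
    fix z :: complex assume z: "z \<in> ball 0 1"
    have eq: "?\<Phi> f z = f z" using f(2) z unfolding eq_on_disk_def by blast
    have "(x + (\<nu> - \<mu>) * u) + \<mu> * p - \<nu> * p = x" if "p = u" for p x u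
      using that by (simp add: algebra_simps)
    from this[OF eq] show "T (?\<Phi> f) z - \<nu> * ?\<Phi> f z = g z"
      unfolding SR[OF f(1) z] .
  qed
  with S(1)[OF R[OF f(1)]] show "\<exists>f\<in>hardy2. eq_on_disk (\<lambda>z. T f z - \<nu> * f z) g" by blast
qed

text \<open>Method of continuity: along a path that escapes to infinity, a uniform lower bound carries
  surjectivity from large parameters back to the start.\<close>

lemma surj_path:
  fixes p :: "real \<Rightarrow> complex"
  assumes p: "continuous_on {0..L} p" and "0 \<le> L" "0 \<le> B" "B < cmod (p L)" and "0 < C"
    and low: "\<And>t. t \<in> {0..L} \<Longrightarrow> h2_lower_bound T (p t) C"
  shows "h2_surj T (p 0)"
proof -
  have "uniformly_continuous_on {0..L} p" using p by (intro compact_uniformly_continuous) auto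
  moreover have "0 < 1 / C" using \<open>0 < C\<close> by simp
  ultimately obtain \<delta> where \<delta>: "0 < \<delta>"
    "\<And>s t. s \<in> {0..L} \<Longrightarrow> t \<in> {0..L} \<Longrightarrow> dist s t < \<delta> \<Longrightarrow> dist (p s) (p t) < 1 / C"
    unfolding uniformly_continuous_on_def by metis
  \<comment> \<open>Walk back from L in steps of \<delta> / 2. Uniform continuity keeps each move of
    the parameter below 1 / C, where \<open>surj_step\<close> applies with the same C every time;
    \<open>max\<close> clips the last step at 0.\<close>
  have "h2_surj T (p (max 0 (L - real k * (\<delta> / 2))))" for k :: nat
  proof (induction k)
    case 0
    then show ?case using surj_large[OF assms(3,4)] \<open>0 \<le> L\<close> by simp
  next
    case (Suc k)
    let ?s = "max 0 (L - real k * (\<delta> / 2))" and ?t = "max 0 (L - real (Suc k) * (\<delta> / 2))"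
    have st: "?s \<in> {0..L}" "?t \<in> {0..L}" "dist ?t ?s < \<delta>"
      using \<open>0 \<le> L\<close> \<delta>(1) by (auto simp: dist_real_def algebra_simps max_def)
    have "cmod (p ?t - p ?s) < 1 / C" using \<delta>(2)[OF st(2,1,3)] by (simp add: dist_norm)
    then have "C * cmod (p ?t - p ?s) < 1" using \<open>0 < C\<close> by (simp add: field_simps)
    then show ?case using \<open>0 < C\<close> by (intro surj_step[OF Suc low[OF st(1)]]) auto
  qed
  moreover obtain k :: nat where "L < k * (\<delta> / 2)"
    using reals_Archimedean3[of "\<delta> / 2"] \<delta>(1) by auto
  then have "max 0 (L - real k * (\<delta> / 2)) = 0" by simp
  ultimately show ?thesis by metis
qed

text \<open>Any choice of preimages is an inverse: the lower bound makes preimages unique on the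
  disk, which gives compatibility with \<open>eq_on_disk\<close> and the left inverse law, and C
  bounds the norm.\<close>

lemma invertibleI:
  assumes surj: "h2_surj T \<mu>" and low: "h2_lower_bound T \<mu> C"
  shows "h2_invertible (\<lambda>f z. T f z - \<mu> * f z)"
proof -
  let ?A = "\<lambda>f z. T f z - \<mu> * f z"
  obtain S where S: "\<And>h. h \<in> hardy2 \<Longrightarrow> S h \<in> hardy2" "\<And>h. h \<in> hardy2 \<Longrightarrow> eq_on_disk (?A (S h)) h"
    using surj unfolding h2_surj_def by metis
  have inj: "eq_on_disk f g" if fg: "f \<in> hardy2" "g \<in> hardy2" and eq: "eq_on_disk (?A f) (?A g)" for f g
  proof (rule eq_on_disk_if_norm_diff_le_0[OF fg])
    have "eq_on_disk (\<lambda>z. ?A f z - ?A g z) (\<lambda>_. 0)" using eq by (simp add: eq_on_disk_def)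
    then have "h2_norm (\<lambda>z. ?A f z - ?A g z) = 0" using h2_norm_eq_on_disk by fastforce
    then show "h2_norm (\<lambda>z. f z - g z) \<le> 0" using lower_bound_diff[OF low fg] by simp
  qed
  have 1: "eq_on_disk (S f) (S g)" if "f \<in> hardy2" "g \<in> hardy2" "eq_on_disk f g" for f g
    by (rule inj[OF S(1)[OF that(1)] S(1)[OF that(2)]])
       (use S(2)[OF that(1)] S(2)[OF that(2)] that(3) in \<open>unfold eq_on_disk_def, metis\<close>)
  have 2: "eq_on_disk (S (?A f)) f" if "f \<in> hardy2" for f
    by (rule inj[OF S(1)[OF shift_hardy2[OF that]] that S(2)[OF shift_hardy2[OF that]]])
  have 3: "h2_norm (S f) \<le> C * h2_norm f" if "f \<in> hardy2" for f
    using low S[OF that] h2_norm_eq_on_disk[OF S(2)[OF that]] by (auto simp: h2_lower_bound_def)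
  show ?thesis
    unfolding h2_invertible_def using S 1 2 3 shift_hardy2 by blast
qed

lemma invertible_lower_bound:
  assumes "h2_invertible (\<lambda>f z. T f z - \<mu> * f z)"
  obtains C where "0 < C" "h2_lower_bound T \<mu> C"
proof -
  obtain S C where S: "\<And>f. f \<in> hardy2 \<Longrightarrow> eq_on_disk (S (\<lambda>z. T f z - \<mu> * f z)) f"
    and C: "\<And>f. f \<in> hardy2 \<Longrightarrow> h2_norm (S f) \<le> C * h2_norm f"
    using assms unfolding h2_invertible_def by blast
  have "h2_norm f \<le> (\<bar>C\<bar> + 1) * h2_norm (\<lambda>z. T f z - \<mu> * f z)" if f: "f \<in> hardy2" for f
  proof -
    have n: "0 \<le> h2_norm (\<lambda>z. T f z - \<mu> * f z)" by (intro h2_norm_nonneg shift_hardy2 f)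
    have "h2_norm f = h2_norm (S (\<lambda>z. T f z - \<mu> * f z))" by (rule h2_norm_eq_on_disk[OF S[OF f], symmetric])
    also have "\<dots> \<le> C * h2_norm (\<lambda>z. T f z - \<mu> * f z)" by (rule C[OF shift_hardy2[OF f]])
    also have "\<dots> \<le> (\<bar>C\<bar> + 1) * h2_norm (\<lambda>z. T f z - \<mu> * f z)" using n by (intro mult_right_mono) auto
    finally show ?thesis .
  qed
  then show thesis by (intro that[of "\<bar>C\<bar> + 1"]) (auto simp: h2_lower_bound_def)
qed

text \<open>Half of the norm of f is absorbed on the left. This later moves a lower bound at 0 to
  nearby points of the spiral.\<close>

lemma lower_bound_perturb:
  assumes low: "h2_lower_bound T \<mu> C" and "0 < C" "C * cmod (\<nu> - \<mu>) \<le> 1 / 2"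
  shows "h2_lower_bound T \<nu> (2 * C)"
  unfolding h2_lower_bound_def
proof
  fix f assume f: "f \<in> hardy2"
  have "h2_norm f \<le> C * h2_norm (\<lambda>z. T f z - \<mu> * f z)" using low f by (simp add: h2_lower_bound_def)
  also have "(\<lambda>z. T f z - \<mu> * f z) = (\<lambda>z. (T f z - \<nu> * f z) + (\<nu> - \<mu>) * f z)"
    by (simp add: fun_eq_iff algebra_simps)
  also have "h2_norm \<dots> \<le> h2_norm (\<lambda>z. T f z - \<nu> * f z) + cmod (\<nu> - \<mu>) * h2_norm f"
    using h2_norm_triangle[OF shift_hardy2[OF f] hardy2_cmult(1)[OF f]] by (simp add: h2_norm_cmult f)
  finally have "h2_norm f \<le> C * h2_norm (\<lambda>z. T f z - \<nu> * f z) + C * cmod (\<nu> - \<mu>) * h2_norm f"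
    using \<open>0 < C\<close> by (simp add: distrib_left)
  moreover have "C * cmod (\<nu> - \<mu>) * h2_norm f \<le> 1 / 2 * h2_norm f"
    using assms(3) h2_norm_nonneg[OF f] by (rule mult_right_mono)
  ultimately show "h2_norm f \<le> 2 * C * h2_norm (\<lambda>z. T f z - \<nu> * f z)" by linarith
qed

end

section \<open>Invertibility off the spiral\<close>

lemma quad_spectrum_upper:
  assumes a: "2 * (cmod a)\<^sup>2 < Re a" and \<psi>: "\<psi> \<in> hinfty"
    and cont: "continuous (at 1 within insert 1 (ball 0 1)) \<psi>"
    and \<mu>: "\<mu> \<noteq> 0" "\<And>s::real. 0 \<le> s \<Longrightarrow> \<mu> \<noteq> \<psi> 1 * exp (- a * of_real s)"
  shows "h2_invertible (\<lambda>f z. wcomp \<psi> (quad_map a) f z - \<mu> * f z)"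
proof -
  have ra: "0 < Re a" using quad_map_param_less[OF a] by simp
  obtain B where B: "0 \<le> B" "\<And>f. f \<in> hardy2 \<Longrightarrow> wcomp \<psi> (quad_map a) f \<in> hardy2"
    "\<And>f. f \<in> hardy2 \<Longrightarrow> h2_norm (wcomp \<psi> (quad_map a) f) \<le> B * h2_norm f"
    using wcomp_bounded[OF holomorphic_quad_map quad_map_disk[OF a] \<psi>] by blast
  interpret hardy2_operator "wcomp \<psi> (quad_map a)" B
    by unfold_locales (auto simp: B wcomp_diff_cmult)
  \<comment> \<open>Beyond some S the spiral lies within |\<mu>| / 2 of 0, hence at distance at
    least |\<mu>| / 2 from \<mu>; on the remaining compact arc the distance attains a positive
    minimum.\<close>
  have "\<exists>d>0. \<forall>s::real. 0 \<le> s \<longrightarrow> d \<le> cmod (\<psi> 1 * exp (- a * of_real s) - \<mu>)"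
  proof -
    define h where "h s = cmod (\<psi> 1 * exp (- a * of_real s) - \<mu>)" for s :: real
    have "((\<lambda>s. cmod (\<psi> 1) * exp (- Re a * s)) \<longlongrightarrow> cmod (\<psi> 1) * 0) at_top"
      by (intro tendsto_intros) (use ra in real_asymp)
    then have "\<forall>\<^sub>F s in at_top. cmod (\<psi> 1) * exp (- Re a * s) < cmod \<mu> / 2"
      using \<mu>(1) by (intro order_tendstoD) auto
    then obtain S where S: "\<And>s. S \<le> s \<Longrightarrow> cmod (\<psi> 1) * exp (- Re a * s) < cmod \<mu> / 2"
      by (auto simp: eventually_at_top_linorder)
    have far: "cmod \<mu> / 2 \<le> h s" if "S \<le> s" for s
    proof -
      have "cmod (\<psi> 1 * exp (- a * of_real s)) = cmod (\<psi> 1) * exp (- Re a * s)"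
        by (simp add: norm_mult norm_exp_eq_Re)
      then show ?thesis
        using S[OF that] norm_triangle_ineq2[of \<mu> "\<psi> 1 * exp (- a * of_real s)"]
        by (simp add: h_def norm_minus_commute)
    qed
    have "\<exists>x\<in>{0..max 0 S}. \<forall>y\<in>{0..max 0 S}. h x \<le> h y"
      unfolding h_def by (intro continuous_attains_inf continuous_intros) auto
    then obtain x where x: "0 \<le> x" "\<And>y. y \<in> {0..max 0 S} \<Longrightarrow> h x \<le> h y" by auto
    have "0 < h x" using \<mu>(2)[OF x(1)] by (auto simp: h_def)
    moreover have "min (h x) (cmod \<mu> / 2) \<le> h s" if "0 \<le> s" for s
      using far[of s] x(2)[of s] that by (cases "S \<le> s") (auto simp: min_le_iff_disj)
    ultimately show ?thesis using \<mu>(1) unfolding h_def[symmetric]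
      by (intro exI[of _ "min (h x) (cmod \<mu> / 2)"]) auto
  qed
  then obtain d where d: "0 < d" "\<And>s::real. 0 \<le> s \<Longrightarrow> d \<le> cmod (\<psi> 1 * exp (- a * of_real s) - \<mu>)" by blast
  \<comment> \<open>Moving along this path is the same as shifting the spiral: the difference
    between the spiral at s and p t is exp (a t) times the difference between the spiral at s + t
    and \<mu>. As |exp (a t)| >= 1, neither d nor the lower bound |\<mu>| deteriorates.\<close>
  define p where "p t = \<mu> * exp (a * of_real t)" for t :: real
  have p0: "p 0 = \<mu>" by (simp add: p_def)
  have np: "cmod (p t) = cmod \<mu> * exp (Re a * t)" for t by (simp add: p_def norm_mult norm_exp_eq_Re)
  obtain C where C: "0 < C" "\<And>\<nu> f. f \<in> hardy2 \<Longrightarrow> cmod \<mu> \<le> cmod \<nu> \<Longrightarrow>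
     (\<And>s::real. 0 \<le> s \<Longrightarrow> d \<le> cmod (\<psi> 1 * exp (- a * of_real s) - \<nu>)) \<Longrightarrow>
     h2_norm f \<le> C * h2_norm (\<lambda>z. wcomp \<psi> (quad_map a) f z - \<nu> * f z)"
    using wcomp_quad_lower_bound[OF a \<psi> cont d(1), of "cmod \<mu>"] \<mu>(1) by (auto 4 3)
  have low: "h2_lower_bound (wcomp \<psi> (quad_map a)) (p t) C" if t: "0 \<le> t" for t
    unfolding h2_lower_bound_def
  proof
    fix f assume f: "f \<in> hardy2"
    have e1: "1 \<le> exp (Re a * t)" using t ra by simp
    show "h2_norm f \<le> C * h2_norm (\<lambda>z. wcomp \<psi> (quad_map a) f z - p t * f z)"
    proof (rule C(2)[OF f])
      show "cmod \<mu> \<le> cmod (p t)" using mult_left_mono[OF e1, of "cmod \<mu>"] by (simp add: np)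
      fix s :: real assume s: "0 \<le> s"
      have "exp (- a * of_real s) = exp (- a * of_real (s + t)) * exp (a * of_real t)"
        by (simp add: algebra_simps flip: exp_add)
      then have "\<psi> 1 * exp (- a * of_real s) - p t = (\<psi> 1 * exp (- a * of_real (s + t)) - \<mu>) * exp (a * of_real t)"
        by (simp add: p_def algebra_simps)
      then have "cmod (\<psi> 1 * exp (- a * of_real s) - p t) =
          cmod (\<psi> 1 * exp (- a * of_real (s + t)) - \<mu>) * exp (Re a * t)"
        by (simp only: norm_mult norm_exp_eq_Re) simp
      also have "\<dots> \<ge> d * 1"
        using d(2)[of "s + t"] s t e1 d(1) by (intro mult_mono) auto
      finally show "d \<le> cmod (\<psi> 1 * exp (- a * of_real s) - p t)" by simp
    qed
  qed
  have "\<forall>\<^sub>F t in at_top. B < cmod \<mu> * exp (Re a * t)"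
  proof -
    have "0 < cmod \<mu>" using \<mu>(1) by simp
    then have "filterlim (\<lambda>t. cmod \<mu> * exp (Re a * t)) at_top at_top" using ra by real_asymp
    then show ?thesis by (simp add: filterlim_at_top_dense)
  qed
  then have "\<forall>\<^sub>F t in at_top. 0 \<le> t \<and> B < cmod \<mu> * exp (Re a * t)"
    using eventually_ge_at_top[of 0] by eventually_elim auto
  then obtain L where L: "0 \<le> L" "B < cmod (p L)"
    using eventually_happens'[OF trivial_limit_at_top_linorder] unfolding np by blast
  have "h2_surj (wcomp \<psi> (quad_map a)) (p 0)"
  proof (rule surj_path[of L p, OF _ L(1) B(1) L(2) C(1)])
    show "continuous_on {0..L} p" unfolding p_def by (intro continuous_intros)
  qed (use low in auto)
  then show ?thesis using low[of 0] unfolding p0 by (intro invertibleI) auto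
qed

section \<open>The spectrum\<close>

text \<open>For \<epsilon> = 0 this is u exp (- s u), formally the Laplace image of a unit mass at
  s, the generalised eigenvector of a multiplication operator on the half line. It narrowly fails to
  lie in H^2; \<epsilon> > 0 makes it bounded.\<close>

definition horo_test :: "real \<Rightarrow> real \<Rightarrow> complex \<Rightarrow> complex" where
  "horo_test s \<epsilon> z = exp (- of_real s / (1 - z)) / (1 - z + of_real \<epsilon>)"

lemma Re_one_minus_pos: "cmod z < 1 \<Longrightarrow> 0 < Re (1 - z)"
  using complex_Re_le_cmod[of z] by simp

lemma cmod_le_cmod_add_of_real:
  assumes "0 < Re w" "0 \<le> \<epsilon>"
  shows "cmod w \<le> cmod (w + of_real \<epsilon>)" "\<epsilon> \<le> cmod (w + of_real \<epsilon>)"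
proof -
  have "(Re w)\<^sup>2 \<le> (Re w + \<epsilon>)\<^sup>2" using assms by (intro power_mono) auto
  then show "cmod w \<le> cmod (w + of_real \<epsilon>)" by (simp add: cmod_def)
  show "\<epsilon> \<le> cmod (w + of_real \<epsilon>)" using complex_Re_le_cmod[of "w + of_real \<epsilon>"] assms by simp
qed

lemma one_minus_add_nonzero: "cmod z < 1 \<Longrightarrow> 0 \<le> \<epsilon> \<Longrightarrow> 1 - z + of_real \<epsilon> \<noteq> 0"
  using Re_one_minus_pos[of z] by (auto simp: complex_eq_iff)

lemma holomorphic_horo_test:
  assumes "0 \<le> \<epsilon>"
  shows "horo_test s \<epsilon> holomorphic_on ball 0 1"
proof -
  have "1 - z \<noteq> 0" if "z \<in> ball 0 1" for z :: complex using that by auto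
  moreover have "1 - z + of_real \<epsilon> \<noteq> 0" if "z \<in> ball 0 1" for z :: complex
    using one_minus_add_nonzero[OF _ assms] that by auto
  ultimately show ?thesis unfolding horo_test_def by (intro holomorphic_intros)
qed

lemma cmod_horo_exp:
  "cmod (exp (- of_real s / (1 - z))) = exp (- s * Re (1 / (1 - z)))"
  unfolding norm_exp_eq_Re by (simp add: Re_divide)

lemma cmod_horo_test:
  "cmod (horo_test s \<epsilon> z) = exp (- s * Re (1 / (1 - z))) / cmod (1 - z + of_real \<epsilon>)"
  unfolding horo_test_def norm_divide cmod_horo_exp ..

text \<open>The first bound is uniform in \<epsilon> and controls the functions away from 1; the
  second gives membership in H^2.\<close>

lemma cmod_horo_test_le:
  assumes "0 \<le> s" "0 \<le> \<epsilon>" "cmod z < 1"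
  shows "cmod (horo_test s \<epsilon> z) \<le> 1 / cmod (1 - z)" "0 < \<epsilon> \<Longrightarrow> cmod (horo_test s \<epsilon> z) \<le> 1 / \<epsilon>"
proof -
  have e: "exp (- s * Re (1 / (1 - z))) \<le> 1"
    using assms by (simp add: disk_iff_halfplane)
  note le = cmod_le_cmod_add_of_real[OF Re_one_minus_pos[OF assms(3)] assms(2)]
  have "1 - z \<noteq> 0" using assms(3) by auto
  with e le show "cmod (horo_test s \<epsilon> z) \<le> 1 / cmod (1 - z)"
    unfolding cmod_horo_test by (intro frac_le) auto
  show "cmod (horo_test s \<epsilon> z) \<le> 1 / \<epsilon>" if "0 < \<epsilon>"
    unfolding cmod_horo_test using e le that by (intro frac_le) auto
qed

lemma hardy2_horo_test:
  assumes "0 \<le> s" "0 < \<epsilon>"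
  shows "horo_test s \<epsilon> \<in> hardy2"
  by (rule hardy2_bounded(1)[where K = "1 / \<epsilon>"])
     (use assms cmod_horo_test_le(2)[of s \<epsilon>] in \<open>auto intro: holomorphic_horo_test\<close>)

text \<open>The limit function violates \<open>|f z|\<^sup>2 (1 - |z|\<^sup>2) \<rightarrow> 0\<close> along the horocycle \<open>Re (1 / (1 - z)) = 1\<close>.\<close>

lemma horo_test_zero_notin_hardy2: "horo_test s 0 \<notin> hardy2"
proof
  assume f: "horo_test s 0 \<in> hardy2"
  let ?a = "taylor_coeff (horo_test s 0)"
  have "summable (\<lambda>n. (cmod (?a n))\<^sup>2)" using f by (simp add: hardy2_def)
  from suminf_exist_split[OF _ this, of "(exp (- s) / 2)\<^sup>2"]
  obtain m where m: "norm (\<Sum>i. (cmod (?a (i + m)))\<^sup>2) < (exp (- s) / 2)\<^sup>2" by auto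
  define A where "A = (\<Sum>n<m. cmod (?a n))"
  have tail: "sqrt (\<Sum>n. (cmod (?a (n + m)))\<^sup>2) \<le> exp (- s) / 2"
    using m by (intro real_le_lsqrt) (auto simp: abs_less_iff)
  have bound: "exp (- s) / 2 \<le> A / y" if y: "0 < y" for y :: real
  proof -
    define u where "u = Complex 1 y"
    define z where "z = 1 - 1 / u"
    have u0: "u \<noteq> 0" by (simp add: u_def complex_eq_iff)
    have zu: "1 / (1 - z) = u" by (simp add: z_def)
    have z: "cmod z < 1" unfolding disk_iff_halfplane zu by (simp add: u_def)
    have uy: "y \<le> cmod u" using abs_Im_le_cmod[of u] y by (simp add: u_def)
    have "(cmod z)\<^sup>2 = (cmod (u - 1) / cmod u)\<^sup>2"
      using u0 by (simp add: z_def norm_divide[symmetric] diff_divide_distrib)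
    also have "\<dots> = y\<^sup>2 / (cmod u)\<^sup>2" by (simp add: u_def cmod_def power_divide)
    finally have "(cmod z)\<^sup>2 = y\<^sup>2 / (cmod u)\<^sup>2" .
    then have z2: "1 - (cmod z)\<^sup>2 = 1 / (cmod u)\<^sup>2"
    proof -
      have "(cmod u)\<^sup>2 = 1 + y\<^sup>2" by (simp add: u_def cmod_power2)
      moreover have "0 < 1 + y\<^sup>2" by (simp add: add_pos_nonneg)
      ultimately show ?thesis using \<open>(cmod z)\<^sup>2 = y\<^sup>2 / (cmod u)\<^sup>2\<close> by (simp add: field_simps)
    qed
    then have sq: "sqrt (1 - (cmod z)\<^sup>2) = 1 / cmod u" by (simp add: real_sqrt_divide)
    \<comment> \<open>On the horocycle u = 1 + i y the product of this modulus with
      \<open>sqrt (1 - (cmod z)\<^sup>2)\<close> is the constant exp (- s). The coefficient tail was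
      chosen to account for at most half of it, and the head decays like A / y.\<close>
    have "cmod (horo_test s 0 z) = exp (- s) * cmod u"
      unfolding cmod_horo_test zu by (simp add: u_def[symmetric] norm_divide z_def) (simp add: u_def)
    then have "exp (- s) \<le> A * (1 / cmod u) + sqrt (\<Sum>n. (cmod (?a (n + m)))\<^sup>2)"
      using hardy2_point_bound[OF f z, of m] u0 unfolding sq A_def[symmetric] by simp
    also have "\<dots> \<le> A * (1 / y) + exp (- s) / 2"
    proof (intro add_mono tail mult_left_mono)
      show "1 / cmod u \<le> 1 / y" using uy y by (intro frac_le) auto
      show "0 \<le> A" by (auto simp: A_def intro: sum_nonneg)
    qed
    finally have "exp (- s) \<le> A / y + exp (- s) / 2" by simp
    then show ?thesis by linarith
  qed
  have "((\<lambda>y. A / y) \<longlongrightarrow> 0) at_top" by real_asymp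
  then have "\<forall>\<^sub>F y in at_top. A / y < exp (- s) / 2" by (intro order_tendstoD) auto
  then have "\<forall>\<^sub>F y in at_top. A / y < exp (- s) / 2 \<and> 0 < y"
    using eventually_gt_at_top[of 0] by eventually_elim auto
  then obtain y where "A / y < exp (- s) / 2" "0 < y"
    using eventually_happens'[OF trivial_limit_at_top_linorder] by blast
  with bound show False by force
qed

text \<open>On the circle of radius r the functions for 0 and \<epsilon> differ by a factor of at
  most 1 + \<epsilon> / (1 - r). Letting \<epsilon> tend to 0 with r fixed, a uniform norm bound
  would put the limit function into H^2.\<close>

lemma horo_test_norm_unbounded:
  assumes "0 \<le> s" "0 \<le> M" and M: "\<And>\<epsilon>. 0 < \<epsilon> \<Longrightarrow> h2_norm (horo_test s \<epsilon>) \<le> M"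
  shows False
proof -
  have "h2_mean r (horo_test s 0) \<le> M\<^sup>2" if r: "0 \<le> r" "r < 1" for r
  proof -
    have le: "h2_mean r (horo_test s 0) \<le> (1 + \<epsilon> / (1 - r))\<^sup>2 * M\<^sup>2" if e: "0 < \<epsilon>" for \<epsilon>
    proof -
      let ?K = "1 + \<epsilon> / (1 - r)"
      have pt: "(cmod (horo_test s 0 z))\<^sup>2 \<le> ?K\<^sup>2 * (cmod (horo_test s \<epsilon> z))\<^sup>2" if z: "cmod z = r" for z
      proof -
        have "1 - r \<le> cmod (1 - z)" using norm_triangle_ineq2[of 1 z] z by simp
        then have w: "0 < cmod (1 - z)" "\<epsilon> / cmod (1 - z) \<le> \<epsilon> / (1 - r)"
          using r e by (auto intro!: frac_le)
        have "cmod (1 - z + of_real \<epsilon>) \<le> cmod (1 - z) + \<epsilon>"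
          using norm_triangle_ineq[of "1 - z" "of_real \<epsilon>"] e by simp
        also have "\<dots> = cmod (1 - z) * (1 + \<epsilon> / cmod (1 - z))" using w by (simp add: field_simps)
        also have "\<dots> \<le> cmod (1 - z) * ?K" using w by (intro mult_left_mono) auto
        finally have n: "cmod (1 - z + of_real \<epsilon>) \<le> cmod (1 - z) * ?K" .
        have p: "0 < cmod (1 - z + of_real \<epsilon>)"
          using one_minus_add_nonzero[of z \<epsilon>] z r e by simp
        have "1 / cmod (1 - z) \<le> ?K / cmod (1 - z + of_real \<epsilon>)"
          using n p w by (simp add: divide_simps mult_ac)
        then have "exp (- s * Re (1 / (1 - z))) * (1 / cmod (1 - z)) \<le>
            exp (- s * Re (1 / (1 - z))) * (?K / cmod (1 - z + of_real \<epsilon>))"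
          by (intro mult_left_mono) auto
        then have "cmod (horo_test s 0 z) \<le> ?K * cmod (horo_test s \<epsilon> z)"
          unfolding cmod_horo_test by (simp add: mult.commute)
        then have "(cmod (horo_test s 0 z))\<^sup>2 \<le> (?K * cmod (horo_test s \<epsilon> z))\<^sup>2"
          by (intro power_mono) auto
        then show ?thesis by (simp add: power_mult_distrib)
      qed
      have c: "continuous_on {0..1} (\<lambda>x. horo_test s \<epsilon> (rcis r (2 * pi * x)))" if "0 \<le> \<epsilon>" for \<epsilon>
        using r that by (intro continuous_on_circle holomorphic_horo_test) auto
      have "h2_mean r (horo_test s 0) \<le> integral {0..1} (\<lambda>x. ?K\<^sup>2 * (cmod (horo_test s \<epsilon> (rcis r (2 * pi * x))))\<^sup>2)"
        unfolding h2_mean_def using e r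
        by (intro integral_le integrable_continuous_real continuous_intros c pt) auto
      also have "\<dots> = ?K\<^sup>2 * h2_mean r (horo_test s \<epsilon>)" by (simp add: h2_mean_def)
      also have "\<dots> \<le> ?K\<^sup>2 * M\<^sup>2"
      proof (rule mult_left_mono)
        have "h2_mean r (horo_test s \<epsilon>) \<le> (h2_norm (horo_test s \<epsilon>))\<^sup>2"
          using assms(1) e r by (intro h2_mean_le hardy2_horo_test)
        also have "\<dots> \<le> M\<^sup>2"
          using assms(1) e by (intro power_mono M h2_norm_nonneg hardy2_horo_test)
        finally show "h2_mean r (horo_test s \<epsilon>) \<le> M\<^sup>2" .
      qed simp
      finally show ?thesis .
    qed
    show ?thesis
    proof (rule tendsto_lowerbound)
      show "((\<lambda>\<epsilon>. (1 + \<epsilon> / (1 - r))\<^sup>2 * M\<^sup>2) \<longlongrightarrow> M\<^sup>2) (at_right 0)"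
        by (rule tendsto_eq_intros | (use r in simp))+
      show "\<forall>\<^sub>F \<epsilon> in at_right 0. h2_mean r (horo_test s 0) \<le> (1 + \<epsilon> / (1 - r))\<^sup>2 * M\<^sup>2"
        using eventually_at_right_less[of 0] by eventually_elim (rule le)
    qed simp
  qed
  from hardy2I_mean(1)[OF holomorphic_horo_test \<open>0 \<le> M\<close> this] horo_test_zero_notin_hardy2[of s]
  show False by simp
qed

text \<open>The functions \<open>horo_test s \<epsilon>\<close> are approximate eigenvectors: composition with the quadratic map
  multiplies them by \<open>e\<^sup>-\<^sup>a\<^sup>s\<close> up to a factor close to \<open>1\<close> near the point \<open>1\<close>, uniformly in \<open>\<epsilon>\<close>.\<close>

lemma horo_test_quad_map:
  assumes a: "2 * (cmod a)\<^sup>2 < Re a" and z: "cmod z < 1" and "0 < \<epsilon>"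
  obtains Y where
    "horo_test s \<epsilon> (quad_map a z) = exp (- a * of_real s) * horo_test s \<epsilon> z *
       (exp (- of_real s * (a\<^sup>2 * (1 - z) / (1 - a * (1 - z)))) * Y)"
    "cmod Y \<le> 1 / (1 - 2 * cmod a)" "cmod (Y - 1) \<le> cmod a * cmod (1 - z) / (1 - 2 * cmod a)"
proof -
  let ?w = "1 - z" and ?q = "1 - a * (1 - z)"
  have a2: "0 < 1 - 2 * cmod a" using quad_map_param_less[OF a] by simp
  have q: "?q \<noteq> 0" using cmod_quad_denom(1)[OF z, of a] a2 by auto
  have w0: "0 < cmod ?w" using z by auto
  have n1: "?w + of_real \<epsilon> \<noteq> 0" using one_minus_add_nonzero[OF z] \<open>0 < \<epsilon>\<close> by simp
  have n2: "1 - quad_map a z + of_real \<epsilon> \<noteq> 0"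
    using one_minus_add_nonzero[OF quad_map_disk[OF a z]] \<open>0 < \<epsilon>\<close> by simp
  define Y where "Y = (?w + of_real \<epsilon>) / (1 - quad_map a z + of_real \<epsilon>)"
  \<comment> \<open>With w = 1 - z, the new denominator w - a w^2 + \<epsilon> is (w + \<epsilon>)
    (1 - v). Because Re w > 0, |w| <= |w + \<epsilon>| and so |v| <= |a||w| independently of
    \<epsilon>.\<close>
  define v where "v = a * ?w\<^sup>2 / (?w + of_real \<epsilon>)"
  have den: "1 - quad_map a z + of_real \<epsilon> = (?w + of_real \<epsilon>) * (1 - v)"
    using n1 unfolding one_minus_quad_map v_def by (simp add: field_simps power2_eq_square)
  have v1: "1 - v \<noteq> 0" using n2 unfolding den by auto
  have Y: "Y = 1 / (1 - v)" unfolding Y_def den using n1 by simp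
  have "cmod v = cmod a * cmod ?w * (cmod ?w / cmod (?w + of_real \<epsilon>))"
    by (simp add: v_def norm_divide norm_mult norm_power power2_eq_square)
  also have "\<dots> \<le> cmod a * cmod ?w * 1"
    using cmod_le_cmod_add_of_real(1)[OF Re_one_minus_pos[OF z], of \<epsilon>] \<open>0 < \<epsilon>\<close> w0
    by (intro mult_left_mono) (auto simp: divide_le_eq)
  finally have v: "cmod v \<le> cmod a * cmod ?w" by simp
  also have "\<dots> \<le> cmod a * 2" using cmod_one_minus_le[OF z] by (intro mult_left_mono) auto
  finally have v2: "1 - 2 * cmod a \<le> cmod (1 - v)" using norm_triangle_ineq2[of 1 v] by simp
  have Y1: "cmod Y \<le> 1 / (1 - 2 * cmod a)"
    unfolding Y norm_divide using v2 a2 by (auto intro!: frac_le)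
  have "Y - 1 = v / (1 - v)" unfolding Y using v1 by (simp add: field_simps)
  then have "cmod (Y - 1) = cmod v / cmod (1 - v)" by (simp add: norm_divide)
  also have "\<dots> \<le> cmod a * cmod ?w / (1 - 2 * cmod a)" using v v2 a2 by (intro frac_le) auto
  finally have Y2: "cmod (Y - 1) \<le> cmod a * cmod ?w / (1 - 2 * cmod a)" .
  have "a / ?q = a + a\<^sup>2 * ?w / ?q" using q by (simp add: field_simps power2_eq_square)
  then have "1 / (1 - quad_map a z) = 1 / ?w + (a + a\<^sup>2 * ?w / ?q)"
    unfolding halfplane_quad_map[OF a z] by simp
  then have "- of_real s / (1 - quad_map a z) = - of_real s * (1 / ?w + (a + a\<^sup>2 * ?w / ?q))"
    by (metis mult.right_neutral times_divide_eq_right)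
  also have "\<dots> = - of_real s / ?w + - a * of_real s + - of_real s * (a\<^sup>2 * ?w / ?q)"
    by (simp add: algebra_simps)
  finally have "exp (- of_real s / (1 - quad_map a z)) =
     exp (- of_real s / ?w) * exp (- a * of_real s) * exp (- of_real s * (a\<^sup>2 * ?w / ?q))"
    by (simp only: exp_add)
  then have "horo_test s \<epsilon> (quad_map a z) = exp (- a * of_real s) * horo_test s \<epsilon> z *
       (exp (- of_real s * (a\<^sup>2 * ?w / ?q)) * Y)"
  proof -
    have "p * q * r / n = q * (p / m) * (r * (m / n))" if "m \<noteq> 0" for p q r m n :: complex
      using that by simp
    from this[OF n1] show ?thesis unfolding horo_test_def Y_def \<open>exp (- of_real s / (1 - quad_map a z)) = _\<close> .
  qed
  from that[OF this Y1 Y2] show thesis .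
qed

text \<open>For f = \<open>horo_test s \<epsilon>\<close> the image under W - \<mu> is at most
  \<eta>|f| near 1 and at most M / \<delta> elsewhere, with constants free of \<epsilon>. With
  \<eta> = 1 / (2 C) a lower bound would bound the squared norm of f by a quarter of itself plus a
  constant, contradicting the unbounded norms as \<epsilon> tends to 0.\<close>

lemma quad_not_lower_bound:
  assumes a: "2 * (cmod a)\<^sup>2 < Re a" and \<psi>: "\<psi> \<in> hinfty"
    and cont: "continuous (at 1 within insert 1 (ball 0 1)) \<psi>" and s: "0 \<le> s" and C: "0 < C"
  shows "\<not> h2_lower_bound (wcomp \<psi> (quad_map a)) (\<psi> 1 * exp (- a * of_real s)) C"
proof
  let ?\<mu> = "\<psi> 1 * exp (- a * of_real s)" and ?W = "wcomp \<psi> (quad_map a)"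
  assume low: "h2_lower_bound ?W ?\<mu> C"
  have a2: "0 < 1 - 2 * cmod a" and ra: "0 < Re a" using quad_map_param_less[OF a] by auto
  obtain K where K: "\<psi> holomorphic_on ball 0 1" "\<And>z. cmod z < 1 \<Longrightarrow> cmod (\<psi> z) \<le> K"
    using \<psi> by (force simp: hinfty_def bounded_iff)
  have K0: "0 \<le> K" using K(2)[of 0] norm_ge_zero[of "\<psi> 0"] by (simp del: norm_ge_zero)
  obtain B where B: "0 \<le> B" "\<And>f. f \<in> hardy2 \<Longrightarrow> ?W f \<in> hardy2"
    "\<And>f. f \<in> hardy2 \<Longrightarrow> h2_norm (?W f) \<le> B * h2_norm f"
    using wcomp_bounded[OF holomorphic_quad_map quad_map_disk[OF a] \<psi>] by blast
  \<comment> \<open>The exponential correction factor from \<open>horo_test_quad_map\<close>, equal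
    to 1 at z = 1 and bounded by L on the disk.\<close>
  define X where "X z = exp (- of_real s * (a\<^sup>2 * (1 - z) / (1 - a * (1 - z))))" for z
  define L where "L = exp (s * ((cmod a)\<^sup>2 * 2 / (1 - 2 * cmod a)))"
  have XL: "cmod (X z) \<le> L" if z: "cmod z < 1" for z
  proof -
    let ?e = "- of_real s * (a\<^sup>2 * (1 - z) / (1 - a * (1 - z)))"
    have "cmod ?e = s * ((cmod a)\<^sup>2 * cmod (1 - z) / cmod (1 - a * (1 - z)))"
      using s by (simp add: norm_mult norm_divide norm_power)
    also have "\<dots> \<le> s * ((cmod a)\<^sup>2 * 2 / (1 - 2 * cmod a))"
      using s a2 cmod_one_minus_le[OF z] cmod_quad_denom(1)[OF z, of a]
      by (intro mult_left_mono frac_le) auto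
    finally have "Re ?e \<le> s * ((cmod a)\<^sup>2 * 2 / (1 - 2 * cmod a))"
      using complex_Re_le_cmod[of ?e] by linarith
    then show ?thesis unfolding X_def L_def norm_exp_eq_Re by simp
  qed
  define \<eta> where "\<eta> = 1 / (2 * C)"
  have \<eta>: "0 < \<eta>" using C by (simp add: \<eta>_def)
  have "((\<lambda>z. \<psi> z * X z) \<longlongrightarrow> \<psi> 1 * exp (- of_real s * (a\<^sup>2 * (1 - 1) / (1 - a * (1 - 1))))) (at 1 within insert 1 (ball 0 1))"
    unfolding X_def using cont by (intro tendsto_intros) (auto simp: continuous_within)
  then have "((\<lambda>z. \<psi> z * X z) \<longlongrightarrow> \<psi> 1) (at 1 within insert 1 (ball 0 1))" by simp
  then obtain \<delta>1 where \<delta>1: "0 < \<delta>1"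
    "\<And>z. z \<in> insert 1 (ball 0 1) \<Longrightarrow> 0 < dist z 1 \<Longrightarrow> dist z 1 < \<delta>1 \<Longrightarrow> dist (\<psi> z * X z) (\<psi> 1) < \<eta> / 2"
    using \<eta> unfolding Lim_within by (meson half_gt_zero)
  define M where "M = K * L * (1 / (1 - 2 * cmod a)) + cmod (\<psi> 1)"
  define c where "c = K * L * cmod a / (1 - 2 * cmod a)"
  have L0: "0 \<le> L" by (simp add: L_def)
  have c0: "0 \<le> c" using K0 L0 a2 by (auto simp: c_def)
  have M0: "0 \<le> M" using K0 L0 a2 by (auto simp: M_def)
  \<comment> \<open>Each of the two error parts gets \<eta> / 2: \<delta>1 handles \<psi> X - \<psi>
    1, the second entry handles the part with Y - 1, which is at most c |1 - z|. The summand 1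
    covers c = 0.\<close>
  define \<delta> where "\<delta> = min \<delta>1 (\<eta> / (2 * (c + 1)))"
  have \<delta>: "0 < \<delta>" using \<delta>1(1) \<eta> c0 by (auto simp: \<delta>_def)
  have c\<delta>: "c * \<delta> \<le> \<eta> / 2"
  proof -
    have "c * \<delta> \<le> (c + 1) * (\<eta> / (2 * (c + 1)))"
      using c0 \<delta> by (intro mult_mono) (auto simp: \<delta>_def)
    also have "\<dots> = \<eta> / 2"
    proof -
      have "x * (\<eta> / (2 * x)) = \<eta> / 2" if "x \<noteq> 0" for x :: real using that by simp
      moreover have "c + 1 \<noteq> 0" using c0 by linarith
      ultimately show ?thesis .
    qed
    finally show ?thesis .
  qed
  \<comment> \<open>The factor 4/3 is 1 / (1 - 1/4), from absorbing the quarter of the squared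
    norm.\<close>
  have "h2_norm (horo_test s \<epsilon>) \<le> sqrt (4 / 3 * (C\<^sup>2 * (M / \<delta>)\<^sup>2))" if e: "0 < \<epsilon>" for \<epsilon>
  proof -
    let ?f = "horo_test s \<epsilon>"
    let ?g = "\<lambda>z. ?W ?f z - ?\<mu> * ?f z"
    have f: "?f \<in> hardy2" by (rule hardy2_horo_test[OF s e])
    have g: "?g \<in> hardy2" by (intro hardy2_diff hardy2_cmult B f)
    have pt: "(cmod (?g z))\<^sup>2 \<le> \<eta>\<^sup>2 * (cmod (?f z))\<^sup>2 + (M / \<delta>)\<^sup>2" if z: "cmod z < 1" for z
    proof -
      obtain Y where Y: "?f (quad_map a z) = exp (- a * of_real s) * ?f z * (X z * Y)"
        "cmod Y \<le> 1 / (1 - 2 * cmod a)" "cmod (Y - 1) \<le> cmod a * cmod (1 - z) / (1 - 2 * cmod a)"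
        using horo_test_quad_map[OF a z e, of s] unfolding X_def by blast
      define E where "E = \<psi> z * X z * Y - \<psi> 1"
      have "?g z = exp (- a * of_real s) * ?f z * E"
        unfolding wcomp_def Y(1) E_def by (simp add: algebra_simps)
      then have "cmod (?g z) = exp (- (Re a * s)) * (cmod (?f z) * cmod E)"
        by (simp add: norm_mult norm_exp_eq_Re)
      also have "\<dots> \<le> 1 * (cmod (?f z) * cmod E)" using ra s by (intro mult_right_mono) auto
      finally have gE: "cmod (?g z) \<le> cmod (?f z) * cmod E" by simp
      have \<psi>X: "cmod (\<psi> z * X z) \<le> K * L"
        unfolding norm_mult using K(2)[OF z] XL[OF z] K0 by (intro mult_mono) auto
      show ?thesis
      proof (cases "cmod (1 - z) < \<delta>")
        case True
        have "0 < dist z 1" "dist z 1 < \<delta>1"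
          using True z by (auto simp: \<delta>_def dist_norm norm_minus_commute)
        then have d1: "cmod (\<psi> z * X z - \<psi> 1) < \<eta> / 2" using \<delta>1(2)[of z] z by (simp add: dist_norm)
        have "cmod (\<psi> z * X z * (Y - 1)) \<le> (K * L) * (cmod a * cmod (1 - z) / (1 - 2 * cmod a))"
          unfolding norm_mult[of "\<psi> z * X z"] using \<psi>X Y(3) K0 L0 by (intro mult_mono) auto
        also have "\<dots> = c * cmod (1 - z)" by (simp add: c_def)
        also have "\<dots> \<le> c * \<delta>" using True c0 by (intro mult_left_mono) auto
        finally have d2: "cmod (\<psi> z * X z * (Y - 1)) \<le> \<eta> / 2" using c\<delta> by linarith
        have "E = \<psi> z * X z * (Y - 1) + (\<psi> z * X z - \<psi> 1)" by (simp add: E_def algebra_simps)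
        then have "cmod E \<le> \<eta>" using norm_triangle_le[of "\<psi> z * X z * (Y - 1)" "\<psi> z * X z - \<psi> 1" \<eta>] d1 d2 by simp
        then have "cmod (?g z) \<le> \<eta> * cmod (?f z)"
          using gE mult_left_mono[of "cmod E" \<eta> "cmod (?f z)"] by (simp add: mult.commute)
        then have "(cmod (?g z))\<^sup>2 \<le> (\<eta> * cmod (?f z))\<^sup>2" by (intro power_mono) auto
        then show ?thesis by (simp add: power_mult_distrib add_increasing2)
      next
        case False
        have "cmod (\<psi> z * X z * Y) \<le> (K * L) * (1 / (1 - 2 * cmod a))"
          unfolding norm_mult[of "\<psi> z * X z"] using \<psi>X Y(2) K0 L0 by (intro mult_mono) auto
        then have EM: "cmod E \<le> M"
          unfolding E_def M_def using norm_triangle_ineq4[of "\<psi> z * X z * Y" "\<psi> 1"] by linarith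
        have "cmod (?f z) \<le> 1 / cmod (1 - z)" using e by (intro cmod_horo_test_le(1) s z) auto
        also have "\<dots> \<le> 1 / \<delta>" using False \<delta> by (intro frac_le) auto
        finally have "cmod (?f z) * cmod E \<le> 1 / \<delta> * M" using EM \<delta> by (intro mult_mono) auto
        then have "cmod (?g z) \<le> M / \<delta>" using gE by simp
        then have "(cmod (?g z))\<^sup>2 \<le> (M / \<delta>)\<^sup>2" by (intro power_mono) auto
        then show ?thesis by (simp add: add_increasing)
      qed
    qed
    have gn: "(h2_norm ?g)\<^sup>2 \<le> \<eta>\<^sup>2 * (h2_norm ?f)\<^sup>2 + (M / \<delta>)\<^sup>2"
      by (rule hardy2_dominated(2)[OF hardy2_holomorphic[OF g] f _ _ pt]) auto
    have "h2_norm ?f \<le> C * h2_norm ?g" using low f by (simp add: h2_lower_bound_def)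
    then have "(h2_norm ?f)\<^sup>2 \<le> (C * h2_norm ?g)\<^sup>2" using h2_norm_nonneg[OF f] by (intro power_mono)
    also have "\<dots> \<le> C\<^sup>2 * (\<eta>\<^sup>2 * (h2_norm ?f)\<^sup>2 + (M / \<delta>)\<^sup>2)"
      unfolding power_mult_distrib using gn by (intro mult_left_mono) auto
    also have "\<dots> = 1 / 4 * (h2_norm ?f)\<^sup>2 + C\<^sup>2 * (M / \<delta>)\<^sup>2"
      using C by (simp add: \<eta>_def power2_eq_square field_simps)
    finally have "(h2_norm ?f)\<^sup>2 \<le> 4 / 3 * (C\<^sup>2 * (M / \<delta>)\<^sup>2)" by simp
    then show ?thesis by (rule real_le_rsqrt)
  qed
  then show False by (intro horo_test_norm_unbounded[OF s, of "sqrt (4 / 3 * (C\<^sup>2 * (M / \<delta>)\<^sup>2))"]) auto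
qed

section \<open>Both inclusions for the spectrum\<close>

lemma quad_spectrum:
  assumes a: "2 * (cmod a)\<^sup>2 < Re a" and \<psi>: "\<psi> \<in> hinfty"
    and cont: "continuous (at 1 within insert 1 (ball 0 1)) \<psi>"
  shows "h2_spectrum (wcomp \<psi> (quad_map a)) = {\<psi> 1 * exp (- a * of_real s) | s. 0 \<le> s} \<union> {0}"
proof -
  let ?W = "wcomp \<psi> (quad_map a)"
  have ra: "0 < Re a" using quad_map_param_less[OF a] by simp
  obtain B where B: "0 \<le> B" "\<And>f. f \<in> hardy2 \<Longrightarrow> ?W f \<in> hardy2"
    "\<And>f. f \<in> hardy2 \<Longrightarrow> h2_norm (?W f) \<le> B * h2_norm f"
    using wcomp_bounded[OF holomorphic_quad_map quad_map_disk[OF a] \<psi>] by blast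
  interpret hardy2_operator ?W B
    by unfold_locales (auto simp: B wcomp_diff_cmult)
  have no: "\<not> h2_invertible (\<lambda>f z. ?W f z - \<psi> 1 * exp (- a * of_real s) * f z)" if s: "0 \<le> s" for s :: real
  proof
    assume "h2_invertible (\<lambda>f z. ?W f z - \<psi> 1 * exp (- a * of_real s) * f z)"
    then obtain C where "0 < C" "h2_lower_bound ?W (\<psi> 1 * exp (- a * of_real s)) C"
      by (rule invertible_lower_bound)
    with quad_not_lower_bound[OF a \<psi> cont s] show False by blast
  qed
  have no0: "\<not> h2_invertible (\<lambda>f z. ?W f z - 0 * f z)"
  proof
    assume "h2_invertible (\<lambda>f z. ?W f z - 0 * f z)"
    then obtain C where C: "0 < C" "h2_lower_bound ?W 0 C" by (rule invertible_lower_bound)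
    \<comment> \<open>A lower bound at 0 would persist at spiral points with s large, where none
      exists. For \<psi> 1 = 0 these points are 0 itself and the same argument applies.\<close>
    have "((\<lambda>s. C * (cmod (\<psi> 1) * exp (- Re a * s))) \<longlongrightarrow> C * (cmod (\<psi> 1) * 0)) at_top"
      by (intro tendsto_intros) (use ra in real_asymp)
    then have "\<forall>\<^sub>F s in at_top. C * (cmod (\<psi> 1) * exp (- Re a * s)) < 1 / 2" by (intro order_tendstoD) auto
    then have "\<forall>\<^sub>F s in at_top. 0 \<le> s \<and> C * (cmod (\<psi> 1) * exp (- Re a * s)) < 1 / 2"
      using eventually_ge_at_top[of 0] by eventually_elim auto
    then obtain s where s: "0 \<le> s" "C * (cmod (\<psi> 1) * exp (- Re a * s)) < 1 / 2"
      using eventually_happens'[OF trivial_limit_at_top_linorder] by blast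
    have "h2_lower_bound ?W (\<psi> 1 * exp (- a * of_real s)) (2 * C)"
      by (rule lower_bound_perturb[OF C(2,1)]) (use s(2) in \<open>simp add: norm_mult norm_exp_eq_Re\<close>)
    with quad_not_lower_bound[OF a \<psi> cont s(1), of "2 * C"] C(1) show False by simp
  qed
  show ?thesis
  proof (intro equalityI subsetI)
    fix \<mu> assume \<mu>: "\<mu> \<in> h2_spectrum ?W"
    show "\<mu> \<in> {\<psi> 1 * exp (- a * of_real s) | s. 0 \<le> s} \<union> {0}"
    proof (rule ccontr)
      assume "\<mu> \<notin> {\<psi> 1 * exp (- a * of_real s) | s. 0 \<le> s} \<union> {0}"
      then have "\<mu> \<noteq> 0" "\<And>s::real. 0 \<le> s \<Longrightarrow> \<mu> \<noteq> \<psi> 1 * exp (- a * of_real s)" by auto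
      from quad_spectrum_upper[OF a \<psi> cont this] \<mu> show False by (simp add: h2_spectrum_def)
    qed
  next
    fix \<mu> assume "\<mu> \<in> {\<psi> 1 * exp (- a * of_real s) | s. 0 \<le> s} \<union> {0}"
    then consider s where "0 \<le> s" "\<mu> = \<psi> 1 * exp (- a * of_real s)" | "\<mu> = 0" by blast
    then show "\<mu> \<in> h2_spectrum ?W"
    proof cases
      case 1
      then show ?thesis using no by (simp add: h2_spectrum_def)
    next
      case 2
      then show ?thesis using no0 by (simp add: h2_spectrum_def)
    qed
  qed
qed

theorem mainTheorem6:
  fixes a :: complex and \<phi> \<psi> :: "complex \<Rightarrow> complex"
  assumes "cmod (a - 1/4) < 1/4"
    and "\<phi> = (\<lambda>z. a * z^2 + (1 - 2*a) * z + a)"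
    and "\<psi> \<in> hinfty"
    and "continuous (at 1 within insert 1 (ball 0 1)) \<psi>"
  shows "h2_spectrum (wcomp \<psi> \<phi>) = h2_spectrum (\<lambda>f z. \<psi> 1 * comp_op \<phi> f z)
       \<and> h2_spectrum (wcomp \<psi> \<phi>) =
           {\<psi> 1 * exp (- 2 * a * complex_of_real t) | t. t \<ge> 0} \<union> {0}"
proof -
  have "(cmod (a - 1/4))\<^sup>2 < (1/4)\<^sup>2" using assms(1) by (intro power_strict_mono) auto
  then have a: "2 * (cmod a)\<^sup>2 < Re a"
    unfolding cmod_power2 by (simp add: power2_eq_square algebra_simps)
  have \<phi>: "\<phi> = quad_map a" by (simp add: assms(2) quad_map_def fun_eq_iff)
  \<comment> \<open>The two parametrisations are related by s = 2 t.\<close>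
  have set: "{\<psi> 1 * exp (- a * of_real s) | s. 0 \<le> s} = {\<psi> 1 * exp (- 2 * a * complex_of_real t) | t. t \<ge> 0}"
    (is "?A = ?B")
  proof (intro equalityI subsetI)
    fix x assume "x \<in> ?A"
    then obtain s where "0 \<le> s" "x = \<psi> 1 * exp (- a * of_real s)" by blast
    then show "x \<in> ?B" by (intro CollectI exI[of _ "s / 2"]) auto
  next
    fix x assume "x \<in> ?B"
    then obtain t where "0 \<le> t" "x = \<psi> 1 * exp (- 2 * a * of_real t)" by blast
    then show "x \<in> ?A" by (intro CollectI exI[of _ "2 * t"]) (auto simp: mult_ac)
  qed
  \<comment> \<open>The multiple of the composition operator is weighted composition with a constant
    weight. That weight has the same value at 1 as \<psi>, so \<open>quad_spectrum\<close> yields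
    the same set for both operators.\<close>
  have "(\<lambda>f z. \<psi> 1 * comp_op \<phi> f z) = wcomp (\<lambda>_. \<psi> 1) \<phi>"
    by (simp add: wcomp_def comp_op_def fun_eq_iff)
  moreover have "(\<lambda>_. \<psi> 1) \<in> hinfty"
    by (auto simp: hinfty_def image_constant_conv)
  ultimately show ?thesis
    using quad_spectrum[OF a assms(3,4)] quad_spectrum[OF a, of "\<lambda>_. \<psi> 1"]
    unfolding \<phi> set by simp
qed

end
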